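(* Let $N\ge1$, $\omega_1,\dots,\omega_N\in\mathbb{R}$, $\Gamma\in C^3(\mathbb{T},\mathbb{R})$ and $H\in C^3(\mathbb{T}^2,\mathbb{R})$. For small $\varepsilon>0$ consider on $\mathbb{T}^N\times\mathbb{R}^{N\times N}$ the system $$\dot\theta_i=f_i(\theta,A):=\omega_i+\frac1N\sum_{j=1}^N a_{ij}\,\Gamma(\theta_j-\theta_i),\qquad \varepsilon\,\dot a_{ij}=-a_{ij}+H(\theta_i,\theta_j),\qquad i,j=1,\dots,N,$$ with associated slow manifold $M_\varepsilon=\{(\theta,A):A=h_\varepsilon(\theta)\}$, and put $h_{0,ij}(\theta)=H(\theta_i,\theta_j)$. Then $h_\varepsilon=h_0+\varepsilon h_1+o(\varepsilon)$ in the $C^2$ topology as $\varepsilon\to0$, where $$h_{1,ij}(\theta)=-\partial_1H(\theta_i,\theta_j)\,f_i(\theta,h_0(\theta))-\partial_2H(\theta_i,\theta_j)\,f_j(\theta,h_0(\theta)),$$ and the reduced phase dynamics $\dot\theta_i=\omega_i+\frac1N\sum_{j=1}^N h_{\varepsilon,ij}(\theta)\Gamma(\theta_j-\theta_i)$ on $M_\varepsilon$ satisfy, in the $C^2$ topology as $\varepsilon\to0$, $$\dot\theta_i=\omega_i+\frac1N\sum_{j=1}^N H(\theta_i,\theta_j)\Gamma(\theta_j-\theta_i)+\frac{\varepsilon}{N}\sum_{j=1}^N\mathcal{P}_{ij}(\theta)+\frac{\varepsilon}{N^2}\sum_{j=1}^N\sum_{k=1}^N T_{ijk}(\theta)+o(\varepsilon),$$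 where $$\mathcal{P}_{ij}(\theta)=-\Gamma(\theta_j-\theta_i)\bigl(\partial_1H(\theta_i,\theta_j)\,\omega_i+\partial_2H(\theta_i,\theta_j)\,\omega_j\bigr),$$ $$T_{ijk}(\theta)=-\Gamma(\theta_j-\theta_i)\,\partial_1H(\theta_i,\theta_j)\,H(\theta_i,\theta_k)\,\Gamma(\theta_k-\theta_i)-\Gamma(\theta_j-\theta_i)\,\partial_2H(\theta_i,\theta_j)\,H(\theta_j,\theta_k)\,\Gamma(\theta_k-\theta_j).$$
   Context: $\mathbb{T}=\mathbb{R}/2\pi\mathbb{Z}$; $\partial_1H,\partial_2H$ are the partial derivatives of $H(u,v)$ in its first and second argument; $A=(a_{ij})\in\mathbb{R}^{N\times N}$. Slow manifold: the critical manifold is the compact graph $M_0=\{(\theta,A):A=h_0(\theta)\}$, $h_{0,ij}(\theta)=H(\theta_i,\theta_j)$; it is normally hyperbolic and attracting (the linearisation of the fast equation in $A$ is $-I_{N^2}$). The associated slow manifold is the family given by Fenichel's theorem: for all sufficiently small $\varepsilon>0$, a map $h_\varepsilon:\mathbb{T}^N\to\mathbb{R}^{N\times N}$ of class $C^3$ whose graph $M_\varepsilon$ is locally invariant under the flow of the system and is $O(\varepsilon)$-close to $M_0$ as $\varepsilon\to0$. "$o(\varepsilon)$ in the $C^2$ topology" means a remainder whose $C^2(\mathbb{T}^N)$ norm divided by $\varepsilon$ tends to $0$ as $\varepsilon\to0$. *)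

theory Defs
  imports "HOL-Analysis.Analysis" "HOL-Library.Landau_Symbols"
begin

text \<open>
  Functions on the torus \<open>\<T>\<^sup>d\<close>, \<open>\<T> = \<real>/2\<pi>\<int>\<close>, are represented by their lifts to \<open>\<real>\<^sup>d\<close>, i.e. by
  functions that are \<open>2\<pi>\<close>-periodic in every coordinate. The number \<open>N\<close> of oscillators is
  \<open>CARD('n)\<close>, and the matrix entry \<open>a\<^sub>i\<^sub>j\<close> is \<open>A $ i $ j\<close>.
\<close>

definition torus_periodic :: "('a::euclidean_space \<Rightarrow> 'b) \<Rightarrow> bool" where
  "torus_periodic f \<longleftrightarrow> (\<forall>x. \<forall>b\<in>Basis. f (x + (2 * pi) *\<^sub>R b) = f x)"

text \<open>
  On a finite-dimensional space, continuity of all iterated directional derivatives up to order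
  \<open>k\<close> (together with differentiability up to order \<open>k - 1\<close>) is the usual notion of class \<open>C\<^sup>k\<close>.
\<close>

primrec class_C :: "nat \<Rightarrow> ('a::euclidean_space \<Rightarrow> 'b::real_normed_vector) \<Rightarrow> bool" where
  "class_C 0 f \<longleftrightarrow> continuous_on UNIV f"
| "class_C (Suc k) f \<longleftrightarrow>
     (\<forall>x. f differentiable (at x)) \<and> (\<forall>v. class_C k (\<lambda>x. frechet_derivative f (at x) v))"

definition torus_C :: "nat \<Rightarrow> ('a::euclidean_space \<Rightarrow> 'b::real_normed_vector) \<Rightarrow> bool" where
  "torus_C k f \<longleftrightarrow> torus_periodic f \<and> class_C k f"

text \<open>
  The sum of the sup norms of all iterated partial derivatives of order at most \<open>k\<close>. The suprema
  are meaningful only for bounded derivatives, in particular for functions satisfying \<open>torus_C k\<close>.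
\<close>

primrec C_norm :: "nat \<Rightarrow> ('a::euclidean_space \<Rightarrow> 'b::real_normed_vector) \<Rightarrow> real" where
  "C_norm 0 f = (SUP x. norm (f x))"
| "C_norm (Suc k) f =
     (SUP x. norm (f x)) + (\<Sum>b\<in>Basis. C_norm k (\<lambda>x. frechet_derivative f (at x) b))"

definition little_o_eps_in_C ::
    "nat \<Rightarrow> (real \<Rightarrow> 'a::euclidean_space \<Rightarrow> 'b::real_normed_vector) \<Rightarrow> bool" where
  "little_o_eps_in_C k r \<longleftrightarrow>
     (\<forall>\<^sub>F \<epsilon> in at_right 0. torus_C k (r \<epsilon>)) \<and>
     ((\<lambda>\<epsilon>. C_norm k (r \<epsilon>) / \<epsilon>) \<longlongrightarrow> 0) (at_right 0)"

definition d1 :: "(real \<times> real \<Rightarrow> real) \<Rightarrow> real \<Rightarrow> real \<Rightarrow> real" where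
  "d1 H u v = deriv (\<lambda>s. H (s, v)) u"

definition d2 :: "(real \<times> real \<Rightarrow> real) \<Rightarrow> real \<Rightarrow> real \<Rightarrow> real" where
  "d2 H u v = deriv (\<lambda>s. H (u, s)) v"

definition phase_field ::
    "real^'n \<Rightarrow> (real \<Rightarrow> real) \<Rightarrow> real^'n \<Rightarrow> real^'n^'n \<Rightarrow> real^'n" where
  "phase_field \<omega> \<Gamma> \<theta> A =
     (\<chi> i. \<omega> $ i + 1 / real CARD('n) * (\<Sum>j\<in>UNIV. A $ i $ j * \<Gamma> (\<theta> $ j - \<theta> $ i)))"

definition h0 :: "(real \<times> real \<Rightarrow> real) \<Rightarrow> real^'n \<Rightarrow> real^'n^'n" where
  "h0 H \<theta> = (\<chi> i j. H (\<theta> $ i, \<theta> $ j))"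

definition slow_fast_field ::
    "real^'n \<Rightarrow> (real \<Rightarrow> real) \<Rightarrow> (real \<times> real \<Rightarrow> real) \<Rightarrow> real
      \<Rightarrow> (real^'n) \<times> (real^'n^'n) \<Rightarrow> (real^'n) \<times> (real^'n^'n)" where
  "slow_fast_field \<omega> \<Gamma> H \<epsilon> = (\<lambda>(\<theta>, A).
     (phase_field \<omega> \<Gamma> \<theta> A,
      \<chi> i j. (- A $ i $ j + H (\<theta> $ i, \<theta> $ j)) / \<epsilon>))"

text \<open>
  Every point of \<open>M\<close> stays in \<open>M\<close> under the flow of \<open>X\<close> for all times in some open interval around
  \<open>0\<close>. (For \<open>X\<close> of class \<open>C\<^sup>1\<close> the solution through a point is unique, so \<open>x\<close> is the flow line.)
\<close>

definition locally_invariant :: "('a::real_normed_vector \<Rightarrow> 'a) \<Rightarrow> 'a set \<Rightarrow> bool" where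
  "locally_invariant X M \<longleftrightarrow>
     (\<forall>p\<in>M. \<exists>\<delta>>0. \<exists>x. x 0 = p \<and>
        (\<forall>t\<in>{-\<delta><..<\<delta>}. (x has_vector_derivative X (x t)) (at t) \<and> x t \<in> M))"

definition slow_manifold ::
    "real^'n \<Rightarrow> (real \<Rightarrow> real) \<Rightarrow> (real \<times> real \<Rightarrow> real)
      \<Rightarrow> (real \<Rightarrow> real^'n \<Rightarrow> real^'n^'n) \<Rightarrow> bool" where
  "slow_manifold \<omega> \<Gamma> H h \<longleftrightarrow>
     (\<forall>\<^sub>F \<epsilon> in at_right 0.
        torus_C 3 (h \<epsilon>) \<and>
        locally_invariant (slow_fast_field \<omega> \<Gamma> H \<epsilon>) {(\<theta>, A). A = h \<epsilon> \<theta>}) \<and>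
     (\<lambda>\<epsilon>. SUP \<theta>. norm (h \<epsilon> \<theta> - h0 H \<theta>)) \<in> O[at_right 0](\<lambda>\<epsilon>. \<epsilon>)"

definition h1 ::
    "real^'n \<Rightarrow> (real \<Rightarrow> real) \<Rightarrow> (real \<times> real \<Rightarrow> real) \<Rightarrow> real^'n \<Rightarrow> real^'n^'n" where
  "h1 \<omega> \<Gamma> H \<theta> =
     (\<chi> i j. - d1 H (\<theta> $ i) (\<theta> $ j) * phase_field \<omega> \<Gamma> \<theta> (h0 H \<theta>) $ i
            - d2 H (\<theta> $ i) (\<theta> $ j) * phase_field \<omega> \<Gamma> \<theta> (h0 H \<theta>) $ j)"

definition pair_term ::
    "real^'n \<Rightarrow> (real \<Rightarrow> real) \<Rightarrow> (real \<times> real \<Rightarrow> real) \<Rightarrow> 'n \<Rightarrow> 'n \<Rightarrow> real^'n \<Rightarrow> real" where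
  "pair_term \<omega> \<Gamma> H i j \<theta> =
     - \<Gamma> (\<theta> $ j - \<theta> $ i) *
       (d1 H (\<theta> $ i) (\<theta> $ j) * \<omega> $ i + d2 H (\<theta> $ i) (\<theta> $ j) * \<omega> $ j)"

definition triple_term ::
    "(real \<Rightarrow> real) \<Rightarrow> (real \<times> real \<Rightarrow> real) \<Rightarrow> 'n \<Rightarrow> 'n \<Rightarrow> 'n \<Rightarrow> real^'n \<Rightarrow> real" where
  "triple_term \<Gamma> H i j k \<theta> =
     - \<Gamma> (\<theta> $ j - \<theta> $ i) * d1 H (\<theta> $ i) (\<theta> $ j) * H (\<theta> $ i, \<theta> $ k) * \<Gamma> (\<theta> $ k - \<theta> $ i)
     - \<Gamma> (\<theta> $ j - \<theta> $ i) * d2 H (\<theta> $ i) (\<theta> $ j) * H (\<theta> $ j, \<theta> $ k) * \<Gamma> (\<theta> $ k - \<theta> $ j)"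

end

theory Submission
  imports Defs
begin

text \<open>
  Local invariance of the graph of \<open>h\<^sub>\<epsilon>\<close> says \<open>\<epsilon> Dh\<^sub>\<epsilon> \<cdot> g = h\<^sub>0 - h\<^sub>\<epsilon>\<close> with \<open>g(\<theta>) = f(\<theta>, h\<^sub>\<epsilon>(\<theta>))\<close>. Hence
  \<open>u = (h\<^sub>0 - h\<^sub>\<epsilon>)/\<epsilon>\<close>, which is bounded and of class \<open>C\<^sup>3\<close>, solves the transport equation
  \<open>u + \<epsilon> Du \<cdot> g = Dh\<^sub>0 \<cdot> g\<close>, and the claim is that \<open>u\<close> converges to \<open>Dh\<^sub>0 \<cdot> f(\<cdot>, h\<^sub>0) = - h\<^sub>1\<close> in \<open>C\<^sup>2\<close>.

  At a maximum of \<open>w\<close> over the torus the term \<open>Dw \<cdot> g\<close> vanishes, so \<open>w + \<epsilon> Dw \<cdot> g = R\<close> implies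
  \<open>sup |w| \<le> sup |R|\<close>. Differentiating the equation once and twice bounds the first and second
  derivatives of \<open>u\<close>, provided \<open>\<epsilon> Du\<close> is bounded. This last fact, a Lipschitz bound on \<open>h\<^sub>\<epsilon>\<close> uniform
  in \<open>\<epsilon>\<close>, cannot be read off the differentiated equation, which is quadratic in \<open>Dh\<^sub>\<epsilon>\<close> and also allows
  \<open>|Dh\<^sub>\<epsilon>|\<close> of order \<open>1/\<epsilon>\<close>; it follows from looking at a maximum of
  \<open>|h\<^sub>\<epsilon> p - h\<^sub>\<epsilon> q|\<^sup>2 - L\<^sup>2 |p - q|\<^sup>2\<close>. The second derivatives of \<open>u\<close> satisfy a transport equation whose
  right-hand side is \<open>O(\<epsilon>)\<close>-close to a continuous function \<open>R\<^sub>0\<close>, and the same two-point argument shows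
  that they converge uniformly to \<open>R\<^sub>0\<close> although \<open>R\<^sub>0\<close> need not be differentiable.
\<close>

section \<open>Directional derivatives and functions of class \<open>C\<^sup>k\<close>\<close>

text \<open>The point comes last, so that \<open>dirder v\<close> is an operator on functions:
  iterated derivatives are written \<open>dirder b' (dirder b f)\<close>, and equations can be
  differentiated as equations between functions.\<close>

definition dirder :: "'a \<Rightarrow> ('a::euclidean_space \<Rightarrow> 'b::real_normed_vector) \<Rightarrow> 'a \<Rightarrow> 'b" where
  "dirder v f x = frechet_derivative f (at x) v"

lemma class_C_Suc:
  "class_C (Suc k) f \<longleftrightarrow> (\<forall>x. f differentiable (at x)) \<and> (\<forall>v. class_C k (dirder v f))"
  by (simp add: dirder_def[abs_def])

declare class_C.simps(2)[simp del]

lemma dirder_eqI: "(f has_derivative f') (at x) \<Longrightarrow> dirder v f x = f' v"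
  unfolding dirder_def by (metis frechet_derivative_at)

lemma dirder_add:
  "f differentiable (at x) \<Longrightarrow> g differentiable (at x)
    \<Longrightarrow> dirder v (\<lambda>x. f x + g x) x = dirder v f x + dirder v g x"
  by (rule dirder_eqI) (auto simp: dirder_def frechet_derivative_works intro!: has_derivative_add)

lemma dirder_mult:
  fixes f g :: "'a::euclidean_space \<Rightarrow> real"
  shows "f differentiable (at x) \<Longrightarrow> g differentiable (at x)
    \<Longrightarrow> dirder v (\<lambda>x. f x * g x) x = f x * dirder v g x + dirder v f x * g x"
  by (rule dirder_eqI) (auto simp: dirder_def frechet_derivative_works intro!: has_derivative_mult)

lemma dirder_bounded_linear:
  assumes "bounded_linear L" "f differentiable (at x)"
  shows "dirder v (\<lambda>x. L (f x)) x = L (dirder v f x)"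
  using bounded_linear.has_derivative[OF assms(1)] assms(2)
  by (intro dirder_eqI) (auto simp: dirder_def frechet_derivative_works)

lemma dirder_comp_linear:
  assumes "bounded_linear L" "f differentiable (at (L x))"
  shows "dirder v (\<lambda>x. f (L x)) x = dirder (L v) f (L x)"
proof (rule dirder_eqI)
  have "(f has_derivative frechet_derivative f (at (L x))) (at (L x))"
    using assms(2) by (simp add: frechet_derivative_works)
  from diff_chain_at[OF bounded_linear_imp_has_derivative[OF assms(1)] this]
  show "((\<lambda>x. f (L x)) has_derivative (\<lambda>v. dirder (L v) f (L x))) (at x)"
    by (simp add: o_def dirder_def)
qed

lemma dirder_const [simp]: "dirder v (\<lambda>x. c) = (\<lambda>x. 0)"
  by (simp add: dirder_def fun_eq_iff)

lemma class_C_continuous_on: "class_C k f \<Longrightarrow> continuous_on S f"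
proof (cases k)
  case (Suc m)
  assume "class_C k f"
  then show ?thesis
    unfolding Suc class_C_Suc
    by (intro continuous_at_imp_continuous_on ballI differentiable_imp_continuous_within) auto
qed (auto intro: continuous_on_subset)

lemma class_C_SucD: "class_C (Suc k) f \<Longrightarrow> class_C k f"
proof (induction k arbitrary: f)
  case 0
  then show ?case by (simp add: class_C_continuous_on)
next
  case (Suc k)
  then show ?case by (subst class_C_Suc) (simp add: class_C_Suc[of "Suc k"])
qed

lemma class_C_mono: "class_C k f \<Longrightarrow> m \<le> k \<Longrightarrow> class_C m f"
  by (induction k) (auto simp: le_Suc_eq dest: class_C_SucD)

lemma class_C_dirder: "class_C (Suc k) f \<Longrightarrow> class_C k (dirder v f)"
  by (simp add: class_C_Suc)

lemma class_C_differentiable: "class_C k f \<Longrightarrow> 0 < k \<Longrightarrow> f differentiable (at x)"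
  by (cases k) (auto simp: class_C_Suc)

lemma class_C_const [simp]: "class_C k (\<lambda>x. c)"
  by (induction k arbitrary: c) (auto simp: class_C_Suc)

lemma class_C_add: "class_C k f \<Longrightarrow> class_C k g \<Longrightarrow> class_C k (\<lambda>x. f x + g x)"
proof (induction k arbitrary: f g)
  case 0
  then show ?case by (auto intro: continuous_intros)
next
  case (Suc k)
  then have "dirder v (\<lambda>x. f x + g x) = (\<lambda>x. dirder v f x + dirder v g x)" for v
    by (auto simp: class_C_Suc dirder_add)
  with Suc show ?case by (auto simp: class_C_Suc)
qed

lemma class_C_bounded_linear: "bounded_linear L \<Longrightarrow> class_C k f \<Longrightarrow> class_C k (\<lambda>x. L (f x))"
proof (induction k arbitrary: f)
  case 0
  then show ?case by (auto intro: bounded_linear.continuous_on)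
next
  case (Suc k)
  then have "dirder v (\<lambda>x. L (f x)) = (\<lambda>x. L (dirder v f x))" for v
    by (auto simp: class_C_Suc dirder_bounded_linear)
  with Suc show ?case
    by (auto simp: class_C_Suc intro: bounded_linear_imp_differentiable
        differentiable_compose[of L, OF bounded_linear_imp_differentiable])
qed

lemma class_C_comp_linear: "bounded_linear L \<Longrightarrow> class_C k f \<Longrightarrow> class_C k (\<lambda>x. f (L x))"
proof (induction k arbitrary: f)
  case 0
  then show ?case
    by (auto intro: continuous_on_compose2[of UNIV f] simp: linear_continuous_on)
next
  case (Suc k)
  then have "dirder v (\<lambda>x. f (L x)) = (\<lambda>x. dirder (L v) f (L x))" for v
    by (auto simp: class_C_Suc dirder_comp_linear)
  with Suc show ?case
    by (auto simp: class_C_Suc intro: differentiable_compose[of f L] bounded_linear_imp_differentiable)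
qed

lemma class_C_mult:
  fixes f g :: "'a::euclidean_space \<Rightarrow> real"
  shows "class_C k f \<Longrightarrow> class_C k g \<Longrightarrow> class_C k (\<lambda>x. f x * g x)"
proof (induction k arbitrary: f g)
  case 0
  then show ?case by (auto intro: continuous_intros)
next
  case (Suc k)
  then have "dirder v (\<lambda>x. f x * g x) = (\<lambda>x. f x * dirder v g x + dirder v f x * g x)" for v
    by (auto simp: class_C_Suc dirder_mult)
  moreover have "class_C k f" "class_C k g"
    using Suc.prems by (auto dest: class_C_SucD)
  ultimately show ?case using Suc
    by (auto simp: class_C_Suc intro!: class_C_add)
qed

lemma class_C_scaleR: "class_C k f \<Longrightarrow> class_C k (\<lambda>x. c *\<^sub>R f x)"
  by (rule class_C_bounded_linear[OF bounded_linear_scaleR_right])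

lemma class_C_cmult: "class_C k f \<Longrightarrow> class_C k (\<lambda>x. c * f x :: real)"
  by (rule class_C_mult) auto

lemma class_C_diff: "class_C k f \<Longrightarrow> class_C k g \<Longrightarrow> class_C k (\<lambda>x. f x - g x)"
  using class_C_add[of k f "\<lambda>x. (-1) *\<^sub>R g x"] class_C_scaleR[of k g "-1"] by simp

lemma class_C_sum: "(\<And>i. i \<in> I \<Longrightarrow> class_C k (f i)) \<Longrightarrow> class_C k (\<lambda>x. \<Sum>i\<in>I. f i x)"
  by (induction I rule: infinite_finite_induct) (auto intro: class_C_add)

lemma dirder_scaleR: "f differentiable (at x) \<Longrightarrow> dirder v (\<lambda>x. c *\<^sub>R f x) x = c *\<^sub>R dirder v f x"
  by (rule dirder_bounded_linear[OF bounded_linear_scaleR_right])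

lemma dirder_cmult: "f differentiable (at x) \<Longrightarrow> dirder v (\<lambda>x. c * f x :: real) x = c * dirder v f x"
  using dirder_scaleR[of f x v c] by simp

lemma dirder_diff:
  "f differentiable (at x) \<Longrightarrow> g differentiable (at x)
    \<Longrightarrow> dirder v (\<lambda>x. f x - g x) x = dirder v f x - dirder v g x"
  by (rule dirder_eqI) (auto simp: dirder_def frechet_derivative_works intro!: has_derivative_diff)

lemma dirder_sum:
  "(\<And>i. i \<in> I \<Longrightarrow> f i differentiable (at x))
    \<Longrightarrow> dirder v (\<lambda>x. \<Sum>i\<in>I. f i x) x = (\<Sum>i\<in>I. dirder v (f i) x)"
  by (rule dirder_eqI) (auto simp: dirder_def frechet_derivative_works intro!: has_derivative_sum)

section \<open>Symmetry of mixed second derivatives\<close>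

lemma has_real_derivative_line:
  fixes f :: "'a::euclidean_space \<Rightarrow> real"
  assumes "f differentiable (at (x + s *\<^sub>R v))"
  shows "((\<lambda>s. f (x + s *\<^sub>R v)) has_real_derivative dirder v f (x + s *\<^sub>R v)) (at s)"
proof -
  have d: "(f has_derivative frechet_derivative f (at (x + s *\<^sub>R v))) (at (x + s *\<^sub>R v))"
    using assms by (simp add: frechet_derivative_works)
  have "((\<lambda>s. x + s *\<^sub>R v) has_derivative (\<lambda>s. s *\<^sub>R v)) (at s)"
    by (auto intro!: derivative_eq_intros)
  from diff_chain_at[OF this d] show ?thesis
    using linear_frechet_derivative[OF assms]
    by (simp add: o_def has_field_derivative_def dirder_def linear_cmul mult_commute_abs)
qed

text \<open>Two applications of the mean value theorem: along \<open>a\<close> to the increment of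
  \<open>f\<close> in direction \<open>b\<close>, then along \<open>b\<close> to
  \<open>dirder a f\<close>. The second difference becomes exactly a value of one mixed derivative
  at a nearby point.\<close>

lemma second_difference_mean_value:
  fixes f :: "'a::euclidean_space \<Rightarrow> real"
  assumes f: "\<And>x. f differentiable (at x)" and fa: "\<And>x. dirder a f differentiable (at x)"
    and h: "0 < h"
  shows "\<exists>s t. 0 < s \<and> s < h \<and> 0 < t \<and> t < h \<and>
    f (x + h *\<^sub>R a + h *\<^sub>R b) - f (x + h *\<^sub>R a) - f (x + h *\<^sub>R b) + f x
      = h * h * dirder b (dirder a f) (x + s *\<^sub>R a + t *\<^sub>R b)"
proof -
  define \<phi> where "\<phi> s = f (x + h *\<^sub>R b + s *\<^sub>R a) - f (x + s *\<^sub>R a)" for s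
  have "(\<phi> has_real_derivative
      dirder a f (x + h *\<^sub>R b + s *\<^sub>R a) - dirder a f (x + s *\<^sub>R a)) (at s)" for s
    unfolding \<phi>_def by (intro DERIV_diff has_real_derivative_line f)
  from MVT2[OF h this] obtain s where s: "0 < s" "s < h"
    "\<phi> h - \<phi> 0 = h * (dirder a f (x + h *\<^sub>R b + s *\<^sub>R a) - dirder a f (x + s *\<^sub>R a))" by auto
  have "((\<lambda>t. dirder a f (x + s *\<^sub>R a + t *\<^sub>R b)) has_real_derivative
      dirder b (dirder a f) (x + s *\<^sub>R a + t *\<^sub>R b)) (at t)" for t
    by (intro has_real_derivative_line fa)
  from MVT2[OF h this] obtain t where t: "0 < t" "t < h"
    "dirder a f (x + s *\<^sub>R a + h *\<^sub>R b) - dirder a f (x + s *\<^sub>R a)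
      = h * dirder b (dirder a f) (x + s *\<^sub>R a + t *\<^sub>R b)" by auto
  show ?thesis
    using s t unfolding \<phi>_def by (intro exI[of _ s] exI[of _ t]) (auto simp: algebra_simps)
qed

text \<open>The second difference quotient is symmetric in \<open>a\<close> and \<open>b\<close>,
  and by continuity its limit is either mixed derivative, depending on which direction is treated
  first.\<close>

lemma dirder_commute:
  fixes f :: "'a::euclidean_space \<Rightarrow> real"
  assumes "class_C 2 f"
  shows "dirder a (dirder b f) x = dirder b (dirder a f) x"
proof -
  have c: "class_C (Suc 1) f" using assms by (simp add: numeral_2_eq_2)
  have f: "f differentiable (at x)" for x
    using c by (simp add: class_C_Suc)
  have fd: "dirder v f differentiable (at x)" for v x
    using c by (auto simp: class_C_Suc)
  have cont: "isCont (dirder v (dirder w f)) x" for v w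
    using c by (auto simp: class_C_Suc continuous_on_eq_continuous_at)
  define h where "h n = inverse (real (Suc n))" for n
  have h: "h n > 0" for n by (simp add: h_def)
  have h0: "h \<longlonglongrightarrow> 0" unfolding h_def by (rule LIMSEQ_inverse_real_of_nat)
  have lim: "\<exists>q. q \<longlonglongrightarrow> dirder w (dirder v f) x \<and> (\<forall>n. f (x + h n *\<^sub>R v + h n *\<^sub>R w) - f (x + h n *\<^sub>R v)
      - f (x + h n *\<^sub>R w) + f x = h n * h n * q n)" for v w
  proof -
    obtain s t where st: "\<And>n. 0 < s n \<and> s n < h n \<and> 0 < t n \<and> t n < h n \<and>
      f (x + h n *\<^sub>R v + h n *\<^sub>R w) - f (x + h n *\<^sub>R v) - f (x + h n *\<^sub>R w) + f x
      = h n * h n * dirder w (dirder v f) (x + s n *\<^sub>R v + t n *\<^sub>R w)"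
      using second_difference_mean_value[where f=f and a=v and b=w and x=x, OF f fd h] by metis
    have s0: "s \<longlonglongrightarrow> 0" "t \<longlonglongrightarrow> 0"
      using st by (auto intro!: tendsto_sandwich[OF _ _ tendsto_const h0] always_eventually less_imp_le)
    have "(\<lambda>n. x + s n *\<^sub>R v + t n *\<^sub>R w) \<longlonglongrightarrow> x + 0 *\<^sub>R v + 0 *\<^sub>R w"
      by (intro tendsto_intros s0)
    then have "(\<lambda>n. dirder w (dirder v f) (x + s n *\<^sub>R v + t n *\<^sub>R w)) \<longlonglongrightarrow> dirder w (dirder v f) x"
      using isCont_tendsto_compose[OF cont] by simp
    with st show ?thesis by blast
  qed
  obtain q where q: "q \<longlonglongrightarrow> dirder b (dirder a f) x" "\<And>n. f (x + h n *\<^sub>R a + h n *\<^sub>R b) - f (x + h n *\<^sub>R a)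
      - f (x + h n *\<^sub>R b) + f x = h n * h n * q n" using lim[where v=a and w=b] by blast
  obtain q' where q': "q' \<longlonglongrightarrow> dirder a (dirder b f) x" "\<And>n. f (x + h n *\<^sub>R b + h n *\<^sub>R a) - f (x + h n *\<^sub>R b)
      - f (x + h n *\<^sub>R a) + f x = h n * h n * q' n" using lim[where v=b and w=a] by blast
  have "q n = q' n" for n
  proof -
    have "h n * h n * q n = h n * h n * q' n"
      using q(2)[of n] q'(2)[of n] by (simp add: algebra_simps)
    then show ?thesis using h[of n] by simp
  qed
  then have "q = q'" by auto
  then show ?thesis using q(1) q'(1) LIMSEQ_unique by blast
qed

section \<open>Periodic functions and \<open>C\<^sup>k\<close> bounds\<close>

lemma torus_periodic_shift_int:
  assumes "torus_periodic f" "b \<in> Basis"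
  shows "f (x + (2 * pi * real_of_int n) *\<^sub>R b) = f x"
proof (induction n rule: int_induct[where k=0])
  case (step1 i)
  have "f (x + (2 * pi * real_of_int (i + 1)) *\<^sub>R b) = f (x + (2 * pi * real_of_int i) *\<^sub>R b + (2 * pi) *\<^sub>R b)"
    by (simp add: algebra_simps)
  with step1 assms show ?case by (simp add: torus_periodic_def)
next
  case (step2 i)
  have "f (x + (2 * pi * real_of_int (i - 1)) *\<^sub>R b)
      = f (x + (2 * pi * real_of_int (i - 1)) *\<^sub>R b + (2 * pi) *\<^sub>R b)"
    using assms by (simp add: torus_periodic_def)
  also have "\<dots> = f (x + (2 * pi * real_of_int i) *\<^sub>R b)"
    by (simp add: algebra_simps)
  finally show ?case using step2 by simp
qed simp

lemma torus_periodic_shift_sum: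
  assumes "torus_periodic f" "finite B" "B \<subseteq> Basis"
  shows "f (x + (\<Sum>b\<in>B. (2 * pi * real_of_int (n b)) *\<^sub>R b)) = f x"
  using assms(2,3)
proof (induction B rule: finite_induct)
  case (insert b B)
  have "f (x + (\<Sum>b\<in>insert b B. (2 * pi * real_of_int (n b)) *\<^sub>R b))
      = f (x + (\<Sum>b\<in>B. (2 * pi * real_of_int (n b)) *\<^sub>R b) + (2 * pi * real_of_int (n b)) *\<^sub>R b)"
    using insert by (simp add: algebra_simps)
  with insert show ?case using torus_periodic_shift_int[OF assms(1)] by auto
qed simp

lemma torus_periodic_fundamental_domain:
  fixes f :: "'a::euclidean_space \<Rightarrow> 'b"
  assumes "torus_periodic f"
  obtains y where "y \<in> cbox 0 ((2 * pi) *\<^sub>R One)" "f y = f x"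
proof
  \<comment> \<open>Removing the integer part of \<open>(x \<bullet> b) / (2 * pi)\<close> in each
    coordinate leaves a fractional part in \<open>[0, 1)\<close>; the closed cube is used for its
    compactness.\<close>
  define n where "n b = - \<lfloor>(x \<bullet> b) / (2 * pi)\<rfloor>" for b
  let ?y = "x + (\<Sum>b\<in>Basis. (2 * pi * real_of_int (n b)) *\<^sub>R b)"
  show "f ?y = f x" by (rule torus_periodic_shift_sum[OF assms]) auto
  show "?y \<in> cbox 0 ((2 * pi) *\<^sub>R One)"
  proof (unfold mem_box, intro ballI)
    fix b :: 'a assume b: "b \<in> Basis"
    define s where "s = (x \<bullet> b) / (2 * pi)"
    have xs: "x \<bullet> b = 2 * pi * s" by (simp add: s_def)
    have "(\<Sum>c\<in>Basis. (2 * pi * real_of_int (n c)) *\<^sub>R c) \<bullet> b = 2 * pi * real_of_int (n b)"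
      using b by (subst inner_sum_left_Basis) auto
    then have "?y \<bullet> b = 2 * pi * (s - of_int \<lfloor>s\<rfloor>)"
      by (simp add: inner_add_left n_def xs algebra_simps flip: s_def)
    moreover have "0 \<le> s - of_int \<lfloor>s\<rfloor>" "s - of_int \<lfloor>s\<rfloor> \<le> 1" by linarith+
    ultimately show "0 \<bullet> b \<le> ?y \<bullet> b \<and> ?y \<bullet> b \<le> ((2 * pi) *\<^sub>R One) \<bullet> b"
      using b by (simp add: mult_left_le)
  qed
qed

lemma torus_periodic_attains_max:
  fixes f :: "'a::euclidean_space \<Rightarrow> real"
  assumes "torus_periodic f" "continuous_on UNIV f"
  obtains x where "\<And>y. f y \<le> f x"
proof -
  let ?K = "cbox 0 ((2 * pi) *\<^sub>R One) :: 'a set"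
  obtain y0 where y0: "y0 \<in> ?K"
    using torus_periodic_fundamental_domain[OF assms(1)] by blast
  then obtain x where x: "x \<in> ?K" "\<And>y. y \<in> ?K \<Longrightarrow> f y \<le> f x"
    using continuous_attains_sup[OF compact_cbox _ continuous_on_subset[OF assms(2) subset_UNIV], of 0 "(2 * pi) *\<^sub>R One"]
    by blast
  show thesis
    using x torus_periodic_fundamental_domain[OF assms(1)] by (metis that)
qed

text \<open>\<open>W\<close> is periodic only under simultaneous shifts of both points. In the
  coordinates \<open>(p, q - p)\<close> the first can therefore be moved into the cube, while
  \<open>far\<close> confines the second to a ball. This is the compactness behind both doubling
  arguments below.\<close>

lemma two_point_attains_max:
  fixes W :: "'a::euclidean_space \<Rightarrow> 'a \<Rightarrow> real"
  assumes cont: "continuous_on UNIV (\<lambda>z. W (fst z) (snd z))"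
    and per: "\<And>s. torus_periodic (\<lambda>p. W p (p + s))"
    and far: "\<And>p q. norm (q - p) > R \<Longrightarrow> W p q \<le> W 0 0"
  obtains p q where "\<And>p' q'. W p' q' \<le> W p q"
proof -
  \<comment> \<open>\<open>max R 0\<close> keeps \<open>(0, 0)\<close>, with which far pairs are
    compared, in the set also for negative \<open>R\<close>.\<close>
  let ?K = "cbox 0 ((2 * pi) *\<^sub>R One) \<times> cball 0 (max R 0) :: ('a \<times> 'a) set"
  let ?V = "\<lambda>z. W (fst z) (fst z + snd z)"
  have "continuous_on UNIV (\<lambda>z::'a \<times> 'a. (fst z, fst z + snd z))"
    by (intro continuous_intros)
  from continuous_on_compose2[OF cont this] have "continuous_on ?K ?V"
    by (auto intro: continuous_on_subset)
  moreover have K0: "(0, 0) \<in> ?K" by (auto simp: mem_box)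
  moreover have "compact ?K" by (intro compact_Times compact_cbox compact_cball)
  ultimately obtain z where z: "z \<in> ?K" "\<And>y. y \<in> ?K \<Longrightarrow> ?V y \<le> ?V z"
    using continuous_attains_sup[of ?K ?V] by blast
  have "W p' q' \<le> W (fst z) (fst z + snd z)" for p' q'
  proof (cases "norm (q' - p') > R")
    case True
    then show ?thesis using order_trans[OF far[OF True]] z(2)[OF K0] by simp
  next
    case False
    obtain y where y: "y \<in> cbox 0 ((2 * pi) *\<^sub>R One)" "W y (y + (q' - p')) = W p' (p' + (q' - p'))"
      using torus_periodic_fundamental_domain[OF per[of "q' - p'"], of p'] by blast
    have "(y, q' - p') \<in> ?K" using y(1) False by simp
    from z(2)[OF this] show ?thesis using y(2) by simp
  qed
  then show thesis using that by blast
qed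

lemma torus_periodic_dirder:
  assumes "torus_periodic f" "\<And>x. f differentiable (at x)"
  shows "torus_periodic (dirder v f)"
  unfolding torus_periodic_def
proof (intro allI ballI)
  fix x b :: 'a assume b: "b \<in> Basis"
  let ?c = "(2 * pi) *\<^sub>R b"
  have "(f has_derivative frechet_derivative f (at (x + ?c))) (at (x + ?c))"
    using assms(2) by (simp add: frechet_derivative_works)
  moreover have "((\<lambda>x. x + ?c) has_derivative (\<lambda>h. h)) (at x)"
    by (intro has_derivative_add_const has_derivative_ident)
  ultimately have "(f \<circ> (\<lambda>x. x + ?c) has_derivative frechet_derivative f (at (x + ?c)) \<circ> (\<lambda>h. h)) (at x)"
    by (intro diff_chain_at)
  moreover have "f \<circ> (\<lambda>x. x + ?c) = f"
    using assms(1) b by (simp add: torus_periodic_def fun_eq_iff)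
  ultimately have "(f has_derivative frechet_derivative f (at (x + ?c))) (at x)"
    by (simp add: o_def)
  from dirder_eqI[OF this] show "dirder v f (x + ?c) = dirder v f x"
    by (simp only: dirder_def)
qed

section \<open>Periodic functions of class C^k\<close>

lemma torus_periodic_const [simp]: "torus_periodic (\<lambda>x. c)"
  by (simp add: torus_periodic_def)

lemma torus_C_dirder: "torus_C (Suc k) f \<Longrightarrow> torus_C k (dirder v f)"
  by (auto simp: torus_C_def class_C_Suc torus_periodic_dirder)

lemma torus_C_mono: "torus_C k f \<Longrightarrow> m \<le> k \<Longrightarrow> torus_C m f"
  by (auto simp: torus_C_def intro: class_C_mono)

lemma torus_C_add: "torus_C k f \<Longrightarrow> torus_C k g \<Longrightarrow> torus_C k (\<lambda>x. f x + g x)"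
  by (auto simp: torus_C_def torus_periodic_def intro: class_C_add)

lemma torus_C_diff: "torus_C k f \<Longrightarrow> torus_C k g \<Longrightarrow> torus_C k (\<lambda>x. f x - g x)"
  by (auto simp: torus_C_def torus_periodic_def intro: class_C_diff)

lemma torus_C_mult: "torus_C k f \<Longrightarrow> torus_C k g \<Longrightarrow> torus_C k (\<lambda>x. f x * g x :: real)"
  by (auto simp: torus_C_def torus_periodic_def intro: class_C_mult)

lemma torus_C_bounded_linear: "bounded_linear L \<Longrightarrow> torus_C k f \<Longrightarrow> torus_C k (\<lambda>x. L (f x))"
  by (auto simp: torus_C_def torus_periodic_def intro: class_C_bounded_linear)

lemma torus_C_const [simp]: "torus_C k (\<lambda>x. c)"
  by (auto simp: torus_C_def)

lemma torus_C_sum: "(\<And>i. i \<in> I \<Longrightarrow> torus_C k (f i)) \<Longrightarrow> torus_C k (\<lambda>x. \<Sum>i\<in>I. f i x)"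
  by (auto simp: torus_C_def torus_periodic_def intro!: class_C_sum sum.cong)

lemma torus_C_differentiable: "torus_C k f \<Longrightarrow> 0 < k \<Longrightarrow> f differentiable (at x)"
  by (auto simp: torus_C_def intro: class_C_differentiable)

text \<open>One constant for all iterated partial derivatives up to order \<open>k\<close>:
  estimates are made without suprema, and \<open>C_norm_bounds\<close> returns to
  \<open>C_norm\<close> in the end.\<close>

primrec C_bdd :: "nat \<Rightarrow> real \<Rightarrow> ('a::euclidean_space \<Rightarrow> 'b::real_normed_vector) \<Rightarrow> bool" where
  "C_bdd 0 C f \<longleftrightarrow> (\<forall>x. norm (f x) \<le> C)"
| "C_bdd (Suc k) C f \<longleftrightarrow> (\<forall>x. norm (f x) \<le> C) \<and> (\<forall>b\<in>Basis. C_bdd k C (dirder b f))"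

lemma C_bdd_norm: "C_bdd k C f \<Longrightarrow> norm (f x) \<le> C"
  by (cases k) auto

lemma C_bdd_nonneg: "C_bdd k C f \<Longrightarrow> 0 \<le> C"
  using C_bdd_norm[of k C f undefined] norm_ge_zero order_trans by blast

lemma C_bdd_dirder: "C_bdd (Suc k) C f \<Longrightarrow> b \<in> Basis \<Longrightarrow> C_bdd k C (dirder b f)"
  by simp

lemma C_bdd_weaken: "C_bdd k C f \<Longrightarrow> C \<le> D \<Longrightarrow> C_bdd k D f"
  by (induction k arbitrary: f) (auto intro: order_trans)

lemma C_bdd_SucD: "C_bdd (Suc k) C f \<Longrightarrow> C_bdd k C f"
  by (induction k arbitrary: f) auto

lemma C_bdd_lower: "C_bdd k C f \<Longrightarrow> m \<le> k \<Longrightarrow> C_bdd m C f"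
  by (induction k) (auto simp: le_Suc_eq dest: C_bdd_SucD simp del: C_bdd.simps)

lemma C_bdd_zero: "C_bdd k 0 (\<lambda>x. 0)"
  by (induction k) auto

lemma C_bdd_add:
  assumes "class_C k f" "class_C k g" "C_bdd k C f" "C_bdd k D g"
  shows "C_bdd k (C + D) (\<lambda>x. f x + g x)"
  using assms
proof (induction k arbitrary: f g)
  case 0
  then show ?case by (auto intro: norm_triangle_mono)
next
  case (Suc k)
  then have "dirder v (\<lambda>x. f x + g x) = (\<lambda>x. dirder v f x + dirder v g x)" for v
    by (auto simp: class_C_Suc dirder_add)
  with Suc show ?case by (auto simp: class_C_Suc intro: norm_triangle_mono)
qed

lemma C_bdd_scaleR:
  assumes "class_C k f" "C_bdd k C f"
  shows "C_bdd k (\<bar>c\<bar> * C) (\<lambda>x. c *\<^sub>R f x)"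
  using assms
proof (induction k arbitrary: f)
  case 0
  then show ?case by (auto intro: mult_left_mono)
next
  case (Suc k)
  then have "dirder v (\<lambda>x. c *\<^sub>R f x) = (\<lambda>x. c *\<^sub>R dirder v f x)" for v
    by (auto simp: class_C_Suc dirder_scaleR)
  with Suc show ?case by (auto simp: class_C_Suc intro: mult_left_mono)
qed

lemma C_bdd_cmult:
  "class_C k f \<Longrightarrow> C_bdd k C f \<Longrightarrow> C_bdd k (\<bar>c\<bar> * C) (\<lambda>x. c * f x :: real)"
  using C_bdd_scaleR[of k f C c] by simp

lemma C_bdd_diff:
  assumes "class_C k f" "class_C k g" "C_bdd k C f" "C_bdd k D g"
  shows "C_bdd k (C + D) (\<lambda>x. f x - g x)"
  using C_bdd_add[OF assms(1) class_C_scaleR[OF assms(2), of "-1"] assms(3)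
      C_bdd_scaleR[OF assms(2,4), of "-1"]] by simp

text \<open>The factor \<open>2 ^ k\<close> counts the terms of the Leibniz rule: each
  differentiation turns one product into two of the same kind.\<close>

lemma C_bdd_mult:
  fixes f g :: "'a::euclidean_space \<Rightarrow> real"
  assumes "class_C k f" "class_C k g" "C_bdd k C f" "C_bdd k D g"
  shows "C_bdd k (2 ^ k * (C * D)) (\<lambda>x. f x * g x)"
  using assms
proof (induction k arbitrary: f g)
  case 0
  then show ?case using C_bdd_nonneg[OF 0(3)] by (auto simp: abs_mult intro!: mult_mono)
next
  case (Suc k)
  have nn: "0 \<le> C" "0 \<le> D" using C_bdd_nonneg Suc.prems by blast+
  have d: "dirder v (\<lambda>x. f x * g x) = (\<lambda>x. f x * dirder v g x + dirder v f x * g x)" for v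
    using Suc by (auto simp: class_C_Suc dirder_mult)
  have "\<bar>f x * g x\<bar> \<le> 2 ^ Suc k * (C * D)" for x
  proof -
    have "\<bar>f x * g x\<bar> \<le> 1 * (C * D)"
      using Suc.prems(3,4) nn by (auto simp: abs_mult intro!: mult_mono)
    also have "\<dots> \<le> 2 ^ Suc k * (C * D)"
      using nn by (intro mult_right_mono one_le_power) auto
    finally show ?thesis .
  qed
  moreover have "C_bdd k (2 ^ Suc k * (C * D)) (dirder b (\<lambda>x. f x * g x))" if "b \<in> Basis" for b
  proof -
    have c: "class_C k f" "class_C k g" "class_C k (dirder b f)" "class_C k (dirder b g)"
      using Suc.prems by (auto intro: class_C_SucD class_C_dirder)
    have b: "C_bdd k C f" "C_bdd k D g" "C_bdd k C (dirder b f)" "C_bdd k D (dirder b g)"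
      using Suc.prems(3,4) that by (simp_all add: C_bdd_SucD del: C_bdd.simps(2))
        (simp_all add: C_bdd_dirder del: C_bdd.simps(2))
    have "C_bdd k (2 ^ k * (C * D) + 2 ^ k * (C * D)) (\<lambda>x. f x * dirder b g x + dirder b f x * g x)"
      by (intro C_bdd_add class_C_mult Suc.IH c b)
    moreover have "2 ^ k * (C * D) + 2 ^ k * (C * D) = 2 ^ Suc k * (C * D)" by simp
    ultimately show ?thesis by (simp only: d)
  qed
  ultimately show ?case by (simp only: C_bdd.simps real_norm_def) blast
qed

lemma C_bdd_sum:
  assumes "\<And>i. i \<in> I \<Longrightarrow> class_C k (f i)" "\<And>i. i \<in> I \<Longrightarrow> C_bdd k (C i) (f i)"
  shows "C_bdd k (\<Sum>i\<in>I. C i) (\<lambda>x. \<Sum>i\<in>I. f i x)"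
  using assms
  by (induction I rule: infinite_finite_induct) (auto simp: C_bdd_zero intro!: C_bdd_add class_C_sum)

lemma torus_C_bdd:
  assumes "torus_C k f"
  shows "\<exists>C. C_bdd k C f"
  using assms
proof (induction k arbitrary: f)
  case 0
  let ?K = "cbox 0 ((2 * pi) *\<^sub>R One) :: 'a set"
  have "compact (f ` ?K)"
    using 0 class_C_continuous_on[of 0 f ?K]
    by (intro compact_continuous_image compact_cbox) (simp add: torus_C_def)
  then have "bounded (f ` ?K)" by (rule compact_imp_bounded)
  then obtain C where C: "\<And>y. y \<in> ?K \<Longrightarrow> norm (f y) \<le> C"
    by (auto simp only: bounded_iff ball_simps)
  have "norm (f x) \<le> C" for x
  proof -
    obtain y where "y \<in> ?K" "f y = f x"
      using torus_periodic_fundamental_domain[of f x] 0 by (auto simp: torus_C_def)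
    then show ?thesis using C[of y] by simp
  qed
  then show ?case by (intro exI[of _ C]) simp
next
  case (Suc k)
  have "\<exists>C. C_bdd k C (dirder b f)" for b
    by (rule Suc.IH[OF torus_C_dirder[OF Suc.prems]])
  then obtain C where C: "\<And>b. C_bdd k (C b) (dirder b f)" by metis
  have "torus_C k f" using Suc.prems by (rule torus_C_mono) simp
  then obtain D where D: "C_bdd k D f" using Suc.IH by blast
  let ?M = "D + (\<Sum>b\<in>Basis. C b)"
  have nn: "0 \<le> C b" "0 \<le> D" for b
    by (rule C_bdd_nonneg[OF C], rule C_bdd_nonneg[OF D])
  have "C_bdd k ?M (dirder b f)" if "b \<in> Basis" for b
  proof (rule C_bdd_weaken[OF C])
    have "C b \<le> (\<Sum>b\<in>Basis. C b)"
      by (rule member_le_sum[OF that nn(1) finite_Basis])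
    then show "C b \<le> ?M" using nn(2) by linarith
  qed
  moreover have "norm (f x) \<le> ?M" for x
  proof -
    have "0 \<le> (\<Sum>b\<in>Basis. C b)" by (intro sum_nonneg nn)
    with C_bdd_norm[OF D, of x] show ?thesis by linarith
  qed
  ultimately show ?case by (intro exI[of _ ?M]) simp
qed

lemma C_norm_Suc: "C_norm (Suc k) f = (SUP x. norm (f x)) + (\<Sum>b\<in>Basis. C_norm k (dirder b f))"
  by (simp add: dirder_def[abs_def])

text \<open>Every level of \<open>C_norm\<close> adds one supremum to \<open>DIM('a)\<close> norms
  of lower order, which multiplies the bound by at most \<open>1 + DIM('a)\<close>. Nonnegativity
  allows the limit in \<open>little_o_eps_in_C\<close> to be handled by upper bounds alone.\<close>

lemma C_norm_bounds:
  fixes f :: "'a::euclidean_space \<Rightarrow> 'b::real_normed_vector"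
  assumes "C_bdd k C f"
  shows "0 \<le> C_norm k f" "C_norm k f \<le> (1 + real DIM('a)) ^ k * C"
proof -
  have sup: "(SUP x. norm (f x)) \<le> C" "0 \<le> (SUP x. norm (f x))" if "C_bdd k C f" for k and f :: "'a \<Rightarrow> 'b"
  proof -
    show "(SUP x. norm (f x)) \<le> C"
      using C_bdd_norm[OF that] by (auto intro: cSUP_least)
    have "norm (f 0) \<le> (SUP x. norm (f x))"
      using C_bdd_norm[OF that] by (auto intro!: cSUP_upper bdd_aboveI[of _ C])
    then show "0 \<le> (SUP x. norm (f x))" using norm_ge_zero order_trans by blast
  qed
  have C: "0 \<le> C" using C_bdd_nonneg[OF assms] .
  have "0 \<le> C_norm k f \<and> C_norm k f \<le> (1 + real DIM('a)) ^ k * C" using assms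
  proof (induction k arbitrary: f)
    case 0
    then show ?case using sup[OF 0] by simp
  next
    case (Suc k)
    let ?q = "(1 + real DIM('a)) ^ k * C"
    have d: "0 \<le> C_norm k (dirder b f) \<and> C_norm k (dirder b f) \<le> ?q" if "b \<in> Basis" for b
      using Suc that by auto
    have "(\<Sum>b\<in>Basis. C_norm k (dirder b f)) \<le> (\<Sum>b\<in>(Basis::'a set). ?q)"
      using d by (intro sum_mono) auto
    moreover have "1 * C \<le> ?q" using C by (intro mult_right_mono one_le_power) auto
    ultimately have "C_norm (Suc k) f \<le> ?q + real DIM('a) * ?q"
      using sup[OF Suc.prems] unfolding C_norm_Suc by simp
    moreover have "0 \<le> C_norm (Suc k) f"
      using sup[OF Suc.prems] d unfolding C_norm_Suc by (intro add_nonneg_nonneg sum_nonneg) auto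
    ultimately show ?case by (simp add: algebra_simps del: C_norm.simps)
  qed
  then show "0 \<le> C_norm k f" "C_norm k f \<le> (1 + real DIM('a)) ^ k * C" by auto
qed

text \<open>The constant between \<open>C_bdd\<close> and \<open>C_norm\<close> depends only on
  \<open>k\<close> and the dimension, so it can be absorbed into the arbitrary \<eta>.\<close>

lemma little_o_eps_in_CI:
  fixes r :: "real \<Rightarrow> 'a::euclidean_space \<Rightarrow> 'b::real_normed_vector"
  assumes "\<forall>\<^sub>F \<epsilon> in at_right 0. torus_C k (r \<epsilon>)"
    and "\<And>\<eta>. 0 < \<eta> \<Longrightarrow> \<forall>\<^sub>F \<epsilon> in at_right 0. C_bdd k (\<eta> * \<epsilon>) (r \<epsilon>)"
  shows "little_o_eps_in_C k r"
  unfolding little_o_eps_in_C_def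
proof (intro conjI tendstoI)
  fix e :: real assume e: "0 < e"
  define q where "q = (1 + real DIM('a)) ^ k"
  have q: "0 < q" by (simp add: q_def)
  then have eq: "0 < e / (2 * q)" using e by simp
  show "\<forall>\<^sub>F \<epsilon> in at_right 0. dist (C_norm k (r \<epsilon>) / \<epsilon>) 0 < e"
    using assms(2)[OF eq] eventually_at_right_less[of 0]
  proof eventually_elim
    case (elim \<epsilon>)
    have "C_norm k (r \<epsilon>) \<le> q * (e / (2 * q) * \<epsilon>)" "0 \<le> C_norm k (r \<epsilon>)"
      using C_norm_bounds[of k "e / (2 * q) * \<epsilon>" "r \<epsilon>"] elim(1) e q by (auto simp: q_def)
    moreover have "q * (e / (2 * q) * \<epsilon>) < e * \<epsilon>"
      using q e elim by simp
    ultimately show ?case using elim by (simp add: field_simps dist_real_def)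
  qed
qed (rule assms(1))

section \<open>The transport equation on the torus\<close>

lemma dirder_Basis_sum:
  assumes "f differentiable (at x)"
  shows "dirder v f x = (\<Sum>b\<in>Basis. (v \<bullet> b) *\<^sub>R dirder b f x)"
proof -
  have l: "linear (frechet_derivative f (at x))" by (rule linear_frechet_derivative[OF assms])
  have "dirder v f x = frechet_derivative f (at x) (\<Sum>b\<in>Basis. (v \<bullet> b) *\<^sub>R b)"
    by (simp add: dirder_def euclidean_representation)
  also have "\<dots> = (\<Sum>b\<in>Basis. (v \<bullet> b) *\<^sub>R dirder b f x)"
    by (simp add: linear_sum[OF l] linear_scale[OF l] dirder_def)
  finally show ?thesis .
qed

lemma C_bdd_imp_Lipschitz:
  fixes f :: "'a::euclidean_space \<Rightarrow> 'b::real_normed_vector"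
  assumes "class_C 1 f" "C_bdd 1 C f"
  shows "norm (f p - f q) \<le> real DIM('a) * C * norm (p - q)"
proof (rule differentiable_bound[OF convex_UNIV])
  have d: "f differentiable (at x)" for x
    using assms(1) by (rule class_C_differentiable) simp
  show "(f has_derivative frechet_derivative f (at x)) (at x within UNIV)" for x
    using iffD1[OF frechet_derivative_works d] by simp
  show "onorm (frechet_derivative f (at x)) \<le> real DIM('a) * C" for x
  proof (rule onorm_le)
    fix v
    have "norm (dirder v f x) \<le> (\<Sum>b\<in>(Basis::'a set). norm v * C)"
    proof (subst dirder_Basis_sum[OF d], rule order_trans[OF norm_sum], rule sum_mono)
      fix b :: 'a assume b: "b \<in> Basis"
      have "norm (dirder b f x) \<le> C" using assms(2) b by simp
      with Basis_le_norm[OF b, of v] show "norm ((v \<bullet> b) *\<^sub>R dirder b f x) \<le> norm v * C"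
        unfolding norm_scaleR by (rule mult_mono) simp_all
    qed
    then show "norm (frechet_derivative f (at x) v) \<le> real DIM('a) * C * norm v"
      by (simp add: dirder_def mult.assoc mult.commute[of C])
  qed
qed auto

text \<open>Difference quotients inherit the Lipschitz constant, and the error of the linear
  approximation on a short step is below any prescribed \<open>e\<close>.\<close>

lemma Lipschitz_imp_dirder_bound:
  fixes f :: "'a::euclidean_space \<Rightarrow> 'b::real_normed_vector"
  assumes lip: "\<And>p q. norm (f p - f q) \<le> L * norm (p - q)" and d: "f differentiable (at x)"
  shows "norm (dirder v f x) \<le> L * norm v"
proof (cases "v = 0")
  case True
  then show ?thesis using linear_0[OF linear_frechet_derivative[OF d]] by (simp add: dirder_def)
next
  case False
  have l: "linear (frechet_derivative f (at x))" by (rule linear_frechet_derivative[OF d])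
  have "norm (dirder v f x) \<le> L * norm v + e" if "0 < e" for e
  proof -
    define e' where "e' = e / norm v"
    have "0 < e'" using that False by (simp add: e'_def)
    then obtain r where r: "0 < r" "\<And>y. norm (y - x) < r \<Longrightarrow>
        norm (f y - f x - frechet_derivative f (at x) (y - x)) \<le> e' * norm (y - x)"
      using iffD1[OF frechet_derivative_works d] unfolding has_derivative_at_alt by blast
    \<comment> \<open>Half of the admissible step, so that \<open>x + s *\<^sub>R v\<close> stays
      strictly inside the ball of radius \<open>r\<close>.\<close>
    define s where "s = r / (2 * norm v)"
    have s: "0 < s" "s * norm v < r" using r(1) False by (auto simp: s_def)
    have "norm (f (x + s *\<^sub>R v) - f x - s *\<^sub>R dirder v f x) \<le> e' * (s * norm v)"
      using r(2)[of "x + s *\<^sub>R v"] s by (simp add: linear_scale[OF l] dirder_def)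
    moreover have "norm (f (x + s *\<^sub>R v) - f x) \<le> L * (s * norm v)"
      using lip[of "x + s *\<^sub>R v" x] s by simp
    moreover have "norm (s *\<^sub>R dirder v f x) \<le> norm (f (x + s *\<^sub>R v) - f x)
        + norm (f (x + s *\<^sub>R v) - f x - s *\<^sub>R dirder v f x)"
      using norm_triangle_sub[of "s *\<^sub>R dirder v f x" "f (x + s *\<^sub>R v) - f x"]
      unfolding norm_minus_commute[of "s *\<^sub>R dirder v f x" "f (x + s *\<^sub>R v) - f x"] .
    moreover have "norm (s *\<^sub>R dirder v f x) = s * norm (dirder v f x)" using s(1) by simp
    ultimately have "s * norm (dirder v f x) \<le> L * (s * norm v) + e' * (s * norm v)"
      by linarith
    also have "\<dots> = s * (L * norm v + e' * norm v)" by (simp add: distrib_left)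
    finally have "norm (dirder v f x) \<le> L * norm v + e' * norm v"
      using s(1) by (rule mult_left_le_imp_le)
    then show ?thesis using False by (simp add: e'_def)
  qed
  then show ?thesis by (rule field_le_epsilon)
qed

section \<open>The transport equation and its maximum principle\<close>

lemma dirder_zero_at_max:
  fixes f :: "'a::euclidean_space \<Rightarrow> real"
  assumes "(f has_derivative f') (at x)" "\<And>y. f y \<le> f x"
  shows "f' v = 0"
  using differential_zero_maxmin[of x UNIV f f'] assms by auto

text \<open>Here \<open>g\<close> is a given field. In the application it depends on the solution
  itself, but the estimates for a single equation are made with that dependence frozen.\<close>

definition transport :: "real \<Rightarrow> ('a::euclidean_space \<Rightarrow> 'a) \<Rightarrow> ('a \<Rightarrow> real) \<Rightarrow> ('a \<Rightarrow> real) \<Rightarrow> bool" where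
  "transport \<epsilon> g f r \<longleftrightarrow> (\<forall>x. f x + \<epsilon> * dirder (g x) f x = r x)"

lemma transport_le:
  assumes "torus_C 1 f" "transport \<epsilon> g f r" "\<And>x. r x \<le> C"
  shows "f x \<le> C"
proof -
  have d: "f differentiable (at x)" for x
    using assms(1) by (rule torus_C_differentiable) simp
  obtain p where p: "\<And>y. f y \<le> f p"
    using torus_periodic_attains_max assms(1) class_C_continuous_on unfolding torus_C_def by blast
  have "dirder (g p) f p = 0"
    unfolding dirder_def using d p frechet_derivative_works by (blast intro: dirder_zero_at_max)
  then have "f p \<le> C" using assms(2)[unfolded transport_def, rule_format, of p] assms(3)[of p] by simp
  then show ?thesis using p order_trans by blast
qed

lemma transport_bound:
  assumes "torus_C 1 f" "transport \<epsilon> g f r" "\<And>x. \<bar>r x\<bar> \<le> C"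
  shows "\<bar>f x\<bar> \<le> C"
proof -
  have d: "f differentiable (at x)" for x
    using assms(1) by (rule torus_C_differentiable) simp
  have "torus_C 1 (\<lambda>x. - f x)"
    using torus_C_diff[OF torus_C_const[of 1 0] assms(1)] by simp
  moreover have "transport \<epsilon> g (\<lambda>x. - f x) (\<lambda>x. - r x)"
    using assms(2) dirder_cmult[OF d, of _ "-1"] by (auto simp: transport_def algebra_simps)
  moreover have "- r x \<le> C" for x using assms(3)[of x] by linarith
  ultimately have "- f x \<le> C" by (rule transport_le)
  moreover have "r x \<le> C" for x using assms(3)[of x] by linarith
  then have "f x \<le> C" by (rule transport_le[OF assms(1,2)])
  ultimately show ?thesis by linarith
qed

text \<open>By symmetry of second derivatives the terms
  \<open>(g x \<bullet> c) * dirder b (dirder c f) x\<close> recombine to the transport of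
  \<open>dirder b f\<close>; the terms in which \<open>g\<close> is differentiated move to the
  right-hand side with their factor \<epsilon>.\<close>

lemma transport_dirder:
  fixes f :: "'a::euclidean_space \<Rightarrow> real"
  assumes tr: "transport \<epsilon> g f r" and f: "class_C 2 f"
    and g: "\<And>c. c \<in> Basis \<Longrightarrow> class_C 1 (\<lambda>x. g x \<bullet> c)"
  shows "transport \<epsilon> g (dirder b f)
    (\<lambda>x. dirder b r x - \<epsilon> * (\<Sum>c\<in>Basis. dirder b (\<lambda>x. g x \<bullet> c) x * dirder c f x))"
  unfolding transport_def
proof
  fix x
  have f1: "class_C 1 (dirder c f)" for c
    using f class_C_dirder[of 1 f c] by (simp add: numeral_2_eq_2)
  have df: "f differentiable (at x)" "dirder c f differentiable (at x)" for c x
    using class_C_differentiable[OF f] class_C_differentiable[OF f1] by auto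
  have dg: "(\<lambda>x. g x \<bullet> c) differentiable (at x)" if "c \<in> Basis" for c x
    using class_C_differentiable[OF g[OF that]] by simp
  \<comment> \<open>The equation is read as a formula for \<open>r\<close>, so that the derivative
    of \<open>r\<close> is computed from those of \<open>f\<close> and \<open>g\<close>.\<close>
  have "r = (\<lambda>x. f x + \<epsilon> * (\<Sum>c\<in>Basis. (g x \<bullet> c) * dirder c f x))"
    using tr by (simp add: transport_def fun_eq_iff flip: real_scaleR_def dirder_Basis_sum[OF df(1)])
  moreover have "dirder b (\<lambda>x. f x + \<epsilon> * (\<Sum>c\<in>Basis. (g x \<bullet> c) * dirder c f x)) x
      = dirder b f x + \<epsilon> * (\<Sum>c\<in>Basis. (g x \<bullet> c) * dirder b (dirder c f) x
          + dirder b (\<lambda>x. g x \<bullet> c) x * dirder c f x)"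
    using df dg
    by (simp add: dirder_add dirder_cmult dirder_sum dirder_mult
        differentiable_mult differentiable_sum)
  moreover have "dirder (g x) (dirder b f) x = (\<Sum>c\<in>Basis. (g x \<bullet> c) * dirder b (dirder c f) x)"
    by (subst dirder_Basis_sum[OF df(2)]) (simp add: dirder_commute[OF f, of b])
  ultimately show "dirder b f x + \<epsilon> * dirder (g x) (dirder b f) x =
      dirder b r x - \<epsilon> * (\<Sum>c\<in>Basis. dirder b (\<lambda>x. g x \<bullet> c) x * dirder c f x)"
    by (simp add: sum.distrib algebra_simps)
qed

text \<open>
  The doubling of variables (maximising \<open>(w p - R\<^sub>0 q)\<^sup>2 - K |p - q|\<^sup>2\<close>) replaces a mollification of the
  merely continuous limit \<open>R\<^sub>0\<close>.
\<close>

lemma transport_near: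
  fixes w R R0 :: "'a::euclidean_space \<Rightarrow> real"
  assumes w: "torus_C 1 w" and R0: "torus_C 0 R0" and tr: "transport \<epsilon> g w R" and eps: "0 \<le> \<epsilon>"
    and g: "\<And>x. norm (g x) \<le> G" and RR0: "\<And>x. \<bar>R x - R0 x\<bar> \<le> \<kappa>"
    and bd: "\<And>x. \<bar>w x\<bar> \<le> B" "\<And>x. \<bar>R0 x\<bar> \<le> B"
    and uc: "\<And>p q. norm (p - q) \<le> \<rho> \<Longrightarrow> \<bar>R0 p - R0 q\<bar> \<le> \<nu>"
    and K: "0 < K" "4 * B\<^sup>2 \<le> K * \<rho>\<^sup>2" "0 \<le> \<rho>"
  shows "(w x - R0 x)\<^sup>2 \<le> 2 * B * (\<kappa> + \<nu>) + \<epsilon> * K * \<rho> * G"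
proof -
  \<comment> \<open>The penalty forces a maximising pair to be close. \<open>R0\<close> has its own
    point \<open>q\<close>, so that varying \<open>p\<close> differentiates only \<open>w\<close>
    and the penalty.\<close>
  define W where "W p q = (w p - R0 q)\<^sup>2 - K * ((p - q) \<bullet> (p - q))" for p q
  have "\<bar>w p - R0 q\<bar> \<le> \<bar>2 * B\<bar>" for p q using bd(1)[of p] bd(2)[of q] by linarith
  then have z4: "(w p - R0 q)\<^sup>2 \<le> 4 * B\<^sup>2" for p q
    using power2_abs abs_le_square_iff[of "w p - R0 q" "2 * B"] by (simp add: power_mult_distrib)
  \<comment> \<open>The square is at most \<open>4 * B\<^sup>2 \<le> K * \<rho>\<^sup>2\<close>, so
    a pair at distance above \<rho> has negative \<open>W\<close>.\<close>
  have near: "norm (p - q) \<le> \<rho>" if "0 \<le> W p q" for p q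
  proof -
    have "K * (norm (p - q))\<^sup>2 \<le> K * \<rho>\<^sup>2"
      using that z4[of p q] K(2) by (simp add: W_def power2_norm_eq_inner)
    then show ?thesis using K(1,3) by (simp add: power2_le_iff_abs_le)
  qed
  have cw: "continuous_on UNIV w" "continuous_on UNIV R0"
    using w R0 class_C_continuous_on by (auto simp: torus_C_def)
  obtain p q where pq: "\<And>p' q'. W p' q' \<le> W p q"
  proof (rule two_point_attains_max[of W \<rho>])
    show "continuous_on UNIV (\<lambda>z. W (fst z) (snd z))"
      unfolding W_def
      by (intro continuous_intros continuous_on_compose2[OF cw(1)] continuous_on_compose2[OF cw(2)]) auto
    show "torus_periodic (\<lambda>p. W p (p + s))" for s
      unfolding torus_periodic_def
    proof (intro allI ballI)
      fix p b :: 'a assume b: "b \<in> Basis"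
      have "R0 (p + (2 * pi) *\<^sub>R b + s) = R0 (p + s + (2 * pi) *\<^sub>R b)" by (simp add: algebra_simps)
      then show "W (p + (2 * pi) *\<^sub>R b) (p + (2 * pi) *\<^sub>R b + s) = W p (p + s)"
        using w R0 b by (simp add: W_def torus_C_def torus_periodic_def)
    qed
    show "W p q \<le> W 0 0" if "\<rho> < norm (q - p)" for p q
    proof -
      have "\<not> 0 \<le> W p q" using near[of p q] that by (auto simp: norm_minus_commute)
      moreover have "0 \<le> W 0 0" by (simp add: W_def)
      ultimately show ?thesis by linarith
    qed
  qed blast
  have "W x x = (w x - R0 x)\<^sup>2" by (simp add: W_def)
  then have wx: "(w x - R0 x)\<^sup>2 \<le> W p q" using pq[of x x] by linarith
  then have W0: "0 \<le> W p q" by (rule order_trans[OF zero_le_power2])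
  have wd: "(w has_derivative frechet_derivative w (at p)) (at p)"
    using torus_C_differentiable[OF w] frechet_derivative_works by auto
  let ?z = "w p - R0 q"
  \<comment> \<open>Stationarity in \<open>p\<close> trades the derivative of \<open>w\<close> along
    \<open>g\<close> for the gradient of the penalty.\<close>
  have "((\<lambda>p. W p q) has_derivative
      (\<lambda>v. 2 * ?z * frechet_derivative w (at p) v - K * (2 * ((p - q) \<bullet> v)))) (at p)"
    unfolding W_def by (auto intro!: derivative_eq_intros wd simp: inner_commute algebra_simps)
  from dirder_zero_at_max[OF this pq, of "g p"]
  have "?z * dirder (g p) w p = K * ((p - q) \<bullet> g p)" unfolding dirder_def by linarith
  moreover have "\<epsilon> * dirder (g p) w p = R p - w p"
    using tr[unfolded transport_def, rule_format, of p] by linarith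
  ultimately have "?z * (R p - w p) = \<epsilon> * (K * ((p - q) \<bullet> g p))"
    by (simp only: mult.left_commute[of ?z \<epsilon>] flip: \<open>\<epsilon> * dirder (g p) w p = R p - w p\<close>)
  \<comment> \<open>Here \<open>?z = (R p - R0 q) - (R p - w p)\<close>, and the product of
    \<open>?z\<close> with the last bracket was just computed.\<close>
  then have z2: "?z\<^sup>2 = ?z * (R p - R0 q) - \<epsilon> * (K * ((p - q) \<bullet> g p))"
    by (simp add: power2_eq_square algebra_simps)
  have "\<bar>R p - R0 q\<bar> \<le> \<kappa> + \<nu>" using RR0[of p] uc[OF near[OF W0]] by linarith
  moreover have "\<bar>?z\<bar> \<le> 2 * B" using bd(1)[of p] bd(2)[of q] by linarith
  ultimately have "\<bar>?z * (R p - R0 q)\<bar> \<le> 2 * B * (\<kappa> + \<nu>)"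
    unfolding abs_mult by (intro mult_mono) auto
  moreover have "\<bar>(p - q) \<bullet> g p\<bar> \<le> \<rho> * G"
    by (rule order_trans[OF Cauchy_Schwarz_ineq2 mult_mono[OF near[OF W0] g]]) (use K in auto)
  then have "\<bar>\<epsilon> * (K * ((p - q) \<bullet> g p))\<bar> \<le> \<epsilon> * (K * (\<rho> * G))"
    unfolding abs_mult using eps K by (intro mult_mono) auto
  ultimately have "?z\<^sup>2 \<le> 2 * B * (\<kappa> + \<nu>) + \<epsilon> * (K * (\<rho> * G))"
    unfolding z2 by linarith
  moreover have "(w x - R0 x)\<^sup>2 \<le> ?z\<^sup>2"
    using wx mult_nonneg_nonneg[OF less_imp_le[OF K(1)] inner_ge_zero[of "p - q"]]
    unfolding W_def by linarith
  ultimately show ?thesis by (simp add: mult.assoc)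
qed

text \<open>At a positive maximum of \<open>W\<close>, the equation at \<open>p\<close> minus the
  equation at \<open>q\<close>, paired with \<open>h p - h q\<close>, expresses
  \<open>(norm (h p - h q))\<^sup>2\<close> by a forcing term and a transport term. Stationarity in
  both points replaces the derivatives of \<open>h\<close> by \<open>L\<^sup>2 * (p - q)\<close>, so
  that the gradient of \<open>h\<close> no longer appears. Each term is then at most half of the
  square, the transport term strictly less: a contradiction.\<close>

lemma invariant_graph_Lipschitz:
  fixes h H0 :: "'a::euclidean_space \<Rightarrow> 'b::real_inner"
  assumes h: "torus_C 1 h" and eps: "0 \<le> \<epsilon>"
    and inv: "\<And>p. \<epsilon> *\<^sub>R dirder (g p) h p = H0 p - h p"
    and H0: "\<And>p q. norm (H0 p - H0 q) \<le> L0 * norm (p - q)"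
    and g: "\<And>p q. norm (g p - g q) \<le> C * (norm (p - q) + norm (h p - h q))"
    and L: "0 < L" "2 * L0 \<le> L" "0 \<le> C" "\<epsilon> * C * (1 + L) < 1 / 2"
  shows "norm (h x - h y) \<le> L * norm (x - y)"
proof -
  define W where "W p q = (h p - h q) \<bullet> (h p - h q) - L\<^sup>2 * ((p - q) \<bullet> (p - q))" for p q
  have Wn: "W p q = (norm (h p - h q))\<^sup>2 - (L * norm (p - q))\<^sup>2" for p q
    by (simp add: W_def power2_norm_eq_inner power_mult_distrib)
  obtain B where B: "\<And>x. norm (h x) \<le> B" using torus_C_bdd[OF h] C_bdd_norm by blast
  have hB: "norm (h p - h q) \<le> 2 * B" for p q
    using norm_triangle_ineq4[of "h p" "h q"] B[of p] B[of q] by linarith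
  have ch: "continuous_on UNIV h" using h class_C_continuous_on by (auto simp: torus_C_def)
  obtain p q where pq: "\<And>p' q'. W p' q' \<le> W p q"
  proof (rule two_point_attains_max[of W "2 * B / L"])
    show "continuous_on UNIV (\<lambda>z. W (fst z) (snd z))"
      unfolding W_def by (intro continuous_intros continuous_on_compose2[OF ch]) auto
    show "torus_periodic (\<lambda>p. W p (p + s))" for s
      unfolding torus_periodic_def
    proof (intro allI ballI)
      fix p b :: 'a assume b: "b \<in> Basis"
      have "h (p + (2 * pi) *\<^sub>R b + s) = h (p + s + (2 * pi) *\<^sub>R b)" by (simp add: algebra_simps)
      then show "W (p + (2 * pi) *\<^sub>R b) (p + (2 * pi) *\<^sub>R b + s) = W p (p + s)"
        using h b by (simp add: W_def torus_C_def torus_periodic_def)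
    qed
    show "W p q \<le> W 0 0" if "2 * B / L < norm (q - p)" for p q
    proof -
      \<comment> \<open>Beyond the distance \<open>2 * B / L\<close> the penalty outweighs the
        oscillation of \<open>h\<close>.\<close>
      have "2 * B \<le> L * norm (p - q)"
        using that L(1) by (simp add: field_simps norm_minus_commute)
      then have "(norm (h p - h q))\<^sup>2 \<le> (L * norm (p - q))\<^sup>2"
        using hB[of p q] by (intro power_mono) auto
      then show ?thesis by (simp add: Wn[of p q]) (simp add: W_def)
    qed
  qed blast
  have "W p q \<le> 0"
  proof (rule ccontr)
    assume "\<not> W p q \<le> 0"
    define m d where "m = norm (h p - h q)" and "d = norm (p - q)"
    have "(L * d)\<^sup>2 < m\<^sup>2" using \<open>\<not> W p q \<le> 0\<close> by (simp add: Wn m_def d_def)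
    then have Ld: "L * d < m" using power_less_imp_less_base[of "L * d" 2 m] by (simp add: m_def)
    have "0 \<le> d" by (simp add: d_def)
    with L(1) have "0 \<le> L * d" by simp
    with \<open>0 \<le> d\<close> Ld have d: "0 \<le> d" "0 < m" by linarith+
    have hd: "(h has_derivative frechet_derivative h (at x)) (at x)" for x
      using torus_C_differentiable[OF h] frechet_derivative_works by auto
    have "((\<lambda>p. W p q) has_derivative
        (\<lambda>v. 2 * ((h p - h q) \<bullet> frechet_derivative h (at p) v) - L\<^sup>2 * (2 * ((p - q) \<bullet> v)))) (at p)"
      unfolding W_def by (auto intro!: derivative_eq_intros hd simp: inner_commute algebra_simps)
    from dirder_zero_at_max[OF this pq, of "g p"]
    have 1: "(h p - h q) \<bullet> dirder (g p) h p = L\<^sup>2 * ((p - q) \<bullet> g p)" by (simp add: dirder_def)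
    have "((\<lambda>q. W p q) has_derivative
        (\<lambda>v. - 2 * ((h p - h q) \<bullet> frechet_derivative h (at q) v) + L\<^sup>2 * (2 * ((p - q) \<bullet> v)))) (at q)"
      unfolding W_def by (auto intro!: derivative_eq_intros hd simp: inner_commute algebra_simps)
    from dirder_zero_at_max[OF this pq, of "g q"]
    have 2: "(h p - h q) \<bullet> dirder (g q) h q = L\<^sup>2 * ((p - q) \<bullet> g q)" by (simp add: dirder_def)
    \<comment> \<open>Both stationarity conditions carry the same vector
      \<open>L\<^sup>2 * (p - q)\<close>, so only the increment \<open>g p - g q\<close> enters, and
      it is controlled by \<open>d + m\<close>.\<close>
    have "(h p - h q) \<bullet> (\<epsilon> *\<^sub>R dirder (g p) h p - \<epsilon> *\<^sub>R dirder (g q) h q)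
        = \<epsilon> * L\<^sup>2 * ((p - q) \<bullet> (g p - g q))"
      by (simp only: inner_diff_right[of "h p - h q"] inner_scaleR_right 1 2 inner_diff_right[of "p - q"])
        (simp add: right_diff_distrib mult.assoc)
    then have "m\<^sup>2 = (h p - h q) \<bullet> (H0 p - H0 q) - \<epsilon> * L\<^sup>2 * ((p - q) \<bullet> (g p - g q))"
      unfolding inv by (simp add: m_def power2_norm_eq_inner algebra_simps)
    moreover have "(h p - h q) \<bullet> (H0 p - H0 q) \<le> m * (L0 * d)"
      using order_trans[OF norm_cauchy_schwarz mult_left_mono[OF H0 norm_ge_zero]]
      by (simp add: m_def d_def)
    moreover have "\<bar>(p - q) \<bullet> (g p - g q)\<bar> \<le> d * (C * (d + m))"
      using order_trans[OF Cauchy_Schwarz_ineq2 mult_left_mono[OF g norm_ge_zero]]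
      by (simp add: m_def d_def)
    then have "\<epsilon> * L\<^sup>2 * \<bar>(p - q) \<bullet> (g p - g q)\<bar> \<le> \<epsilon> * L\<^sup>2 * (d * (C * (d + m)))"
      using eps by (intro mult_left_mono) auto
    then have "- (\<epsilon> * L\<^sup>2 * ((p - q) \<bullet> (g p - g q))) \<le> \<epsilon> * L\<^sup>2 * (d * (C * (d + m)))"
      using abs_ge_minus_self[of "\<epsilon> * L\<^sup>2 * ((p - q) \<bullet> (g p - g q))"] eps by (simp add: abs_mult)
    ultimately have main: "m\<^sup>2 \<le> m * (L0 * d) + \<epsilon> * L\<^sup>2 * (d * (C * (d + m)))" by linarith
    have "m * (L0 * d) \<le> m * (m / 2)"
    proof (rule mult_left_mono)
      have "2 * (L0 * d) \<le> L * d" using mult_right_mono[OF L(2) d(1)] by simp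
      then show "L0 * d \<le> m / 2" using Ld by linarith
    qed (use d in simp)
    \<comment> \<open>Grouping each \<open>d\<close> with a factor \<open>L\<close> lets
      \<open>L * d < m\<close> replace it; the smallness of \<epsilon> then leaves less than
      \<open>m\<^sup>2 / 2\<close>.\<close>
    moreover have "\<epsilon> * L\<^sup>2 * (d * (C * (d + m))) = \<epsilon> * C * ((L * d) * (L * d) + L * ((L * d) * m))"
      by (simp add: algebra_simps power2_eq_square)
    moreover have "\<epsilon> * C * ((L * d) * (L * d) + L * ((L * d) * m)) \<le> \<epsilon> * C * (m * m + L * (m * m))"
      using eps L d Ld by (intro mult_left_mono add_mono mult_mono) auto
    moreover have "\<epsilon> * C * (m * m + L * (m * m)) = \<epsilon> * C * (1 + L) * (m * m)"
      by (simp add: algebra_simps)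
    moreover have "\<epsilon> * C * (1 + L) * (m * m) < 1 / 2 * (m * m)"
      using L(4) d(2) by (intro mult_strict_right_mono) auto
    ultimately show False using main unfolding power2_eq_square[of m] by linarith
  qed
  then have "W x y \<le> 0" using pq[of x y] by linarith
  then have "(norm (h x - h y))\<^sup>2 \<le> (L * norm (x - y))\<^sup>2" by (simp add: Wn)
  then show ?thesis by (rule power2_le_imp_le) (simp add: less_imp_le[OF L(1)])
qed

section \<open>Families bounded uniformly in the small parameter\<close>

lemma eventually_eps_small:
  assumes "0 < (e::real)"
  shows "\<forall>\<^sub>F \<epsilon> in at_right 0. 0 < \<epsilon> \<and> \<epsilon> * C < e"
proof -
  have "((\<lambda>\<epsilon>. \<epsilon> * C) \<longlongrightarrow> 0 * C) (at_right 0)" by (intro tendsto_intros)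
  then have "\<forall>\<^sub>F \<epsilon> in at_right 0. \<epsilon> * C < e" using assms by (intro order_tendstoD) auto
  with eventually_at_right_less show ?thesis by (rule eventually_conj)
qed

text \<open>Being O(1) in C^k as \<epsilon> tends to 0. Closure under sums, products and derivatives
  lets bounds on right-hand sides be read off their form.\<close>

definition unif_bdd :: "nat \<Rightarrow> (real \<Rightarrow> 'a::euclidean_space \<Rightarrow> 'b::real_normed_vector) \<Rightarrow> bool" where
  "unif_bdd k f \<longleftrightarrow> (\<exists>C. \<forall>\<^sub>F \<epsilon> in at_right 0. class_C k (f \<epsilon>) \<and> C_bdd k C (f \<epsilon>))"

lemma unif_bddI: "\<forall>\<^sub>F \<epsilon> in at_right 0. class_C k (f \<epsilon>) \<and> C_bdd k C (f \<epsilon>) \<Longrightarrow> unif_bdd k f"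
  by (auto simp: unif_bdd_def)

lemma unif_bddE:
  assumes "unif_bdd k f"
  obtains C where "0 \<le> C" "\<forall>\<^sub>F \<epsilon> in at_right 0. class_C k (f \<epsilon>) \<and> C_bdd k C (f \<epsilon>)"
proof -
  obtain C where C: "\<forall>\<^sub>F \<epsilon> in at_right 0. class_C k (f \<epsilon>) \<and> C_bdd k C (f \<epsilon>)"
    using assms unfolding unif_bdd_def by blast
  show thesis
  proof (rule that[of "max C 0"])
    show "\<forall>\<^sub>F \<epsilon> in at_right 0. class_C k (f \<epsilon>) \<and> C_bdd k (max C 0) (f \<epsilon>)"
      using C by eventually_elim (auto intro: C_bdd_weaken)
  qed simp
qed

lemma unif_bdd_common_bound:
  assumes "finite I" "\<And>i. i \<in> I \<Longrightarrow> unif_bdd k (f i)"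
  obtains C where "0 \<le> C" "\<forall>\<^sub>F \<epsilon> in at_right 0. \<forall>i\<in>I. class_C k (f i \<epsilon>) \<and> C_bdd k C (f i \<epsilon>)"
proof -
  have "\<exists>C. \<forall>i\<in>I. 0 \<le> C i \<and> (\<forall>\<^sub>F \<epsilon> in at_right 0. class_C k (f i \<epsilon>) \<and> C_bdd k (C i) (f i \<epsilon>))"
  proof (rule bchoice, rule ballI)
    fix i assume "i \<in> I"
    then show "\<exists>C. 0 \<le> C \<and> (\<forall>\<^sub>F \<epsilon> in at_right 0. class_C k (f i \<epsilon>) \<and> C_bdd k C (f i \<epsilon>))"
      using unif_bddE[OF assms(2)] by blast
  qed
  then obtain C where C: "\<And>i. i \<in> I \<Longrightarrow> 0 \<le> C i"
    "\<And>i. i \<in> I \<Longrightarrow> \<forall>\<^sub>F \<epsilon> in at_right 0. class_C k (f i \<epsilon>) \<and> C_bdd k (C i) (f i \<epsilon>)" by blast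
  show thesis
  proof (rule that[of "\<Sum>i\<in>I. C i"])
    show "0 \<le> (\<Sum>i\<in>I. C i)" by (rule sum_nonneg[OF C(1)])
    have "\<forall>\<^sub>F \<epsilon> in at_right 0. \<forall>i\<in>I. class_C k (f i \<epsilon>) \<and> C_bdd k (C i) (f i \<epsilon>)"
      using C(2) by (simp add: eventually_ball_finite_distrib[OF assms(1)])
    then show "\<forall>\<^sub>F \<epsilon> in at_right 0. \<forall>i\<in>I. class_C k (f i \<epsilon>) \<and> C_bdd k (\<Sum>i\<in>I. C i) (f i \<epsilon>)"
    proof eventually_elim
      case (elim \<epsilon>)
      have "C i \<le> (\<Sum>i\<in>I. C i)" if "i \<in> I" for i
        using C(1) assms(1) that by (intro member_le_sum) auto
      with elim show ?case by (blast intro: C_bdd_weaken)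
    qed
  qed
qed

lemma unif_bdd_cong:
  assumes "unif_bdd k f" "\<forall>\<^sub>F \<epsilon> in at_right 0. f \<epsilon> = g \<epsilon>"
  shows "unif_bdd k g"
proof -
  obtain C where "\<forall>\<^sub>F \<epsilon> in at_right 0. class_C k (f \<epsilon>) \<and> C_bdd k C (f \<epsilon>)"
    using assms(1) unfolding unif_bdd_def by blast
  with assms(2) have "\<forall>\<^sub>F \<epsilon> in at_right 0. class_C k (g \<epsilon>) \<and> C_bdd k C (g \<epsilon>)"
    by eventually_elim simp
  then show ?thesis by (rule unif_bddI)
qed

lemma unif_bdd_add:
  assumes "unif_bdd k f" "unif_bdd k g"
  shows "unif_bdd k (\<lambda>\<epsilon> x. f \<epsilon> x + g \<epsilon> x)"
proof -
  obtain C D where "\<forall>\<^sub>F \<epsilon> in at_right 0. class_C k (f \<epsilon>) \<and> C_bdd k C (f \<epsilon>)"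
    "\<forall>\<^sub>F \<epsilon> in at_right 0. class_C k (g \<epsilon>) \<and> C_bdd k D (g \<epsilon>)"
    using assms unfolding unif_bdd_def by blast
  then have "\<forall>\<^sub>F \<epsilon> in at_right 0. class_C k (\<lambda>x. f \<epsilon> x + g \<epsilon> x) \<and> C_bdd k (C + D) (\<lambda>x. f \<epsilon> x + g \<epsilon> x)"
    by eventually_elim (simp add: class_C_add C_bdd_add)
  then show ?thesis by (rule unif_bddI)
qed

lemma unif_bdd_diff:
  assumes "unif_bdd k f" "unif_bdd k g"
  shows "unif_bdd k (\<lambda>\<epsilon> x. f \<epsilon> x - g \<epsilon> x)"
proof -
  obtain C D where "\<forall>\<^sub>F \<epsilon> in at_right 0. class_C k (f \<epsilon>) \<and> C_bdd k C (f \<epsilon>)"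
    "\<forall>\<^sub>F \<epsilon> in at_right 0. class_C k (g \<epsilon>) \<and> C_bdd k D (g \<epsilon>)"
    using assms unfolding unif_bdd_def by blast
  then have "\<forall>\<^sub>F \<epsilon> in at_right 0. class_C k (\<lambda>x. f \<epsilon> x - g \<epsilon> x) \<and> C_bdd k (C + D) (\<lambda>x. f \<epsilon> x - g \<epsilon> x)"
    by eventually_elim (simp add: class_C_diff C_bdd_diff)
  then show ?thesis by (rule unif_bddI)
qed

lemma unif_bdd_mult:
  fixes f g :: "real \<Rightarrow> 'a::euclidean_space \<Rightarrow> real"
  assumes "unif_bdd k f" "unif_bdd k g"
  shows "unif_bdd k (\<lambda>\<epsilon> x. f \<epsilon> x * g \<epsilon> x)"
proof -
  obtain C D where "\<forall>\<^sub>F \<epsilon> in at_right 0. class_C k (f \<epsilon>) \<and> C_bdd k C (f \<epsilon>)"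
    "\<forall>\<^sub>F \<epsilon> in at_right 0. class_C k (g \<epsilon>) \<and> C_bdd k D (g \<epsilon>)"
    using assms unfolding unif_bdd_def by blast
  then have "\<forall>\<^sub>F \<epsilon> in at_right 0. class_C k (\<lambda>x. f \<epsilon> x * g \<epsilon> x) \<and> C_bdd k (2 ^ k * (C * D)) (\<lambda>x. f \<epsilon> x * g \<epsilon> x)"
    by eventually_elim (simp add: class_C_mult C_bdd_mult)
  then show ?thesis by (rule unif_bddI)
qed

lemma unif_bdd_const: "torus_C k f \<Longrightarrow> unif_bdd k (\<lambda>_. f)"
  unfolding unif_bdd_def using torus_C_bdd[of k f] by (auto simp: torus_C_def)

lemma unif_bdd_sum:
  assumes "\<And>i. i \<in> I \<Longrightarrow> unif_bdd k (f i)"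
  shows "unif_bdd k (\<lambda>\<epsilon> x. \<Sum>i\<in>I. f i \<epsilon> x)"
  using assms
  by (induction I rule: infinite_finite_induct) (simp_all add: unif_bdd_add unif_bdd_const)

lemma unif_bdd_eps:
  fixes f :: "real \<Rightarrow> 'a::euclidean_space \<Rightarrow> real"
  assumes "unif_bdd k f"
  shows "unif_bdd k (\<lambda>\<epsilon> x. \<epsilon> * f \<epsilon> x)"
proof -
  obtain C where C: "0 \<le> C" "\<forall>\<^sub>F \<epsilon> in at_right 0. class_C k (f \<epsilon>) \<and> C_bdd k C (f \<epsilon>)"
    using unif_bddE[OF assms] .
  have "\<forall>\<^sub>F \<epsilon> in at_right 0. class_C k (\<lambda>x. \<epsilon> * f \<epsilon> x) \<and> C_bdd k C (\<lambda>x. \<epsilon> * f \<epsilon> x)"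
    using C(2) eventually_eps_small[OF zero_less_one, of 1]
  proof eventually_elim
    case (elim \<epsilon>)
    have "\<bar>\<epsilon>\<bar> * C \<le> C" using elim C(1) by (intro mult_left_le_one_le) auto
    with elim show ?case by (blast intro: class_C_cmult C_bdd_weaken[OF C_bdd_cmult])
  qed
  then show ?thesis by (rule unif_bddI)
qed

lemma unif_bdd_dirder:
  assumes "unif_bdd (Suc k) f" "b \<in> Basis"
  shows "unif_bdd k (\<lambda>\<epsilon>. dirder b (f \<epsilon>))"
proof -
  obtain C where "\<forall>\<^sub>F \<epsilon> in at_right 0. class_C (Suc k) (f \<epsilon>) \<and> C_bdd (Suc k) C (f \<epsilon>)"
    using assms(1) unfolding unif_bdd_def by blast
  then have "\<forall>\<^sub>F \<epsilon> in at_right 0. class_C k (dirder b (f \<epsilon>)) \<and> C_bdd k C (dirder b (f \<epsilon>))"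
    by eventually_elim (use assms(2) in \<open>simp add: class_C_dirder C_bdd_dirder del: C_bdd.simps\<close>)
  then show ?thesis by (rule unif_bddI)
qed

lemma unif_bdd_lower:
  assumes "unif_bdd k f" "m \<le> k"
  shows "unif_bdd m f"
proof -
  obtain C where "\<forall>\<^sub>F \<epsilon> in at_right 0. class_C k (f \<epsilon>) \<and> C_bdd k C (f \<epsilon>)"
    using assms(1) unfolding unif_bdd_def by blast
  then have "\<forall>\<^sub>F \<epsilon> in at_right 0. class_C m (f \<epsilon>) \<and> C_bdd m C (f \<epsilon>)"
    by eventually_elim (use assms(2) in \<open>blast intro: class_C_mono C_bdd_lower\<close>)
  then show ?thesis by (rule unif_bddI)
qed

lemma unif_bdd_SucI:
  fixes f :: "real \<Rightarrow> 'a::euclidean_space \<Rightarrow> 'b::real_normed_vector"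
  assumes "\<forall>\<^sub>F \<epsilon> in at_right 0. class_C (Suc k) (f \<epsilon>)" "unif_bdd 0 f"
    "\<And>b. b \<in> Basis \<Longrightarrow> unif_bdd k (\<lambda>\<epsilon>. dirder b (f \<epsilon>))"
  shows "unif_bdd (Suc k) f"
proof -
  obtain C where C: "0 \<le> C" "\<forall>\<^sub>F \<epsilon> in at_right 0. class_C 0 (f \<epsilon>) \<and> C_bdd 0 C (f \<epsilon>)"
    using unif_bddE[OF assms(2)] .
  obtain D where D: "0 \<le> D" "\<forall>\<^sub>F \<epsilon> in at_right 0. \<forall>b\<in>Basis.
      class_C k (dirder b (f \<epsilon>)) \<and> C_bdd k D (dirder b (f \<epsilon>))"
    using unif_bdd_common_bound[OF finite_Basis assms(3)] .
  have "\<forall>\<^sub>F \<epsilon> in at_right 0. class_C (Suc k) (f \<epsilon>) \<and> C_bdd (Suc k) (C + D) (f \<epsilon>)"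
    using assms(1) C(2) D(2)
  proof eventually_elim
    case (elim \<epsilon>)
    have "norm (f \<epsilon> x) \<le> C + D" for x using C_bdd_norm[of 0 C "f \<epsilon>" x] elim D(1) by linarith
    moreover have "C_bdd k (C + D) (dirder b (f \<epsilon>))" if "b \<in> Basis" for b
      by (rule C_bdd_weaken[of k D]) (use that elim C(1) in auto)
    ultimately show ?case using elim by simp
  qed
  then show ?thesis by (rule unif_bddI)
qed

text \<open>The bound in the maximum principle involves neither \<epsilon> nor \<open>g\<close>, so
  it is uniform for the whole family.\<close>

lemma unif_bdd_transport:
  assumes "\<forall>\<^sub>F \<epsilon> in at_right 0. torus_C 1 (f \<epsilon>) \<and> transport \<epsilon> (g \<epsilon>) (f \<epsilon>) (r \<epsilon>)" "unif_bdd 0 r"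
  shows "unif_bdd 0 f"
proof -
  obtain C where C: "\<forall>\<^sub>F \<epsilon> in at_right 0. class_C 0 (r \<epsilon>) \<and> C_bdd 0 C (r \<epsilon>)"
    using assms(2) unfolding unif_bdd_def by blast
  with assms(1) have "\<forall>\<^sub>F \<epsilon> in at_right 0. class_C 0 (f \<epsilon>) \<and> C_bdd 0 C (f \<epsilon>)"
  proof eventually_elim
    case (elim \<epsilon>)
    then have "\<bar>f \<epsilon> x\<bar> \<le> C" for x
      by (intro transport_bound[of "f \<epsilon>" \<epsilon> "g \<epsilon>" "r \<epsilon>"]) auto
    moreover have "class_C 0 (f \<epsilon>)" using elim unfolding torus_C_def by (blast intro: class_C_mono)
    ultimately show ?case by simp
  qed
  then show ?thesis by (rule unif_bddI)
qed

text \<open>Two close points can be moved only by a common shift: one lands in the cube and the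
  other in the unit neighbourhood \<open>K'\<close> of it, where uniform continuity is available by
  compactness.\<close>

lemma torus_C_uniformly_continuous:
  fixes f :: "'a::euclidean_space \<Rightarrow> 'b::real_normed_vector"
  assumes "torus_C 0 f" "0 < \<nu>"
  obtains \<rho> where "0 < \<rho>" "\<And>p q. norm (p - q) \<le> \<rho> \<Longrightarrow> norm (f p - f q) \<le> \<nu>"
proof -
  let ?K = "cbox 0 ((2 * pi) *\<^sub>R One) :: 'a set"
  define K' where "K' = {x + y |x y. x \<in> ?K \<and> y \<in> cball 0 (1::real)}"
  have "compact K'" unfolding K'_def by (intro compact_sums compact_cbox compact_cball)
  moreover have "continuous_on K' f"
    using assms(1) class_C_continuous_on[of 0 f K'] by (simp add: torus_C_def)
  ultimately have "uniformly_continuous_on K' f" by (rule compact_uniformly_continuous[rotated])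
  then obtain d where d: "0 < d" "\<And>x x'. x \<in> K' \<Longrightarrow> x' \<in> K' \<Longrightarrow> dist x' x < d \<Longrightarrow> dist (f x') (f x) < \<nu>"
    using assms(2) unfolding uniformly_continuous_on_def by blast
  show thesis
  proof (rule that[of "min (d / 2) 1"])
    show "0 < min (d / 2) 1" using d(1) by simp
    fix p q :: 'a assume pq: "norm (p - q) \<le> min (d / 2) 1"
    define s where "s = q - p"
    have s: "norm s \<le> 1" "norm s < d" using pq d(1) by (auto simp: s_def norm_minus_commute)
    have "torus_periodic (\<lambda>p. (f p, f (p + s)))"
      unfolding torus_periodic_def
    proof (intro allI ballI)
      fix p b :: 'a assume b: "b \<in> Basis"
      have "f (p + (2 * pi) *\<^sub>R b + s) = f (p + s + (2 * pi) *\<^sub>R b)" by (simp add: algebra_simps)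
      then show "(f (p + (2 * pi) *\<^sub>R b), f (p + (2 * pi) *\<^sub>R b + s)) = (f p, f (p + s))"
        using assms(1) b by (simp add: torus_C_def torus_periodic_def)
    qed
    then obtain y where y: "y \<in> ?K" "(f y, f (y + s)) = (f p, f (p + s))"
      by (rule torus_periodic_fundamental_domain[of _ p])
    have "y = y + 0" by simp
    then have "y \<in> K'" unfolding K'_def using y(1) by force
    moreover have "y + s \<in> K'" unfolding K'_def using y(1) s(1) by force
    moreover have "dist (y + s) y < d" using s(2) by (simp add: dist_norm)
    ultimately have "dist (f (y + s)) (f y) < \<nu>" by (rule d(2))
    then show "norm (f p - f q) \<le> \<nu>" using y(2) by (simp add: s_def dist_norm norm_minus_commute)
  qed
qed

text \<open>The bound of \<open>transport_near\<close> has three sources: the perturbation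
  \<open>\<epsilon> * \<sigma>\<close>, the oscillation \<nu> of \<open>R0\<close>, and the penalty
  term \<open>\<epsilon> * K * \<rho> * G\<close>. The oscillation is fixed first, which determines
  \<rho> and \<open>K\<close>; the other two then vanish with \<epsilon>.\<close>

lemma transport_converges:
  fixes w R \<sigma> :: "real \<Rightarrow> 'a::euclidean_space \<Rightarrow> real"
  assumes tr: "\<forall>\<^sub>F \<epsilon> in at_right 0. torus_C 1 (w \<epsilon>) \<and> transport \<epsilon> (g \<epsilon>) (w \<epsilon>) (R \<epsilon>)"
    and R0: "torus_C 0 R0"
    and R: "\<forall>\<^sub>F \<epsilon> in at_right 0. \<forall>x. R \<epsilon> x = R0 x + \<epsilon> * \<sigma> \<epsilon> x" and \<sigma>: "unif_bdd 0 \<sigma>"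
    and g: "\<forall>\<^sub>F \<epsilon> in at_right 0. \<forall>x. norm (g \<epsilon> x) \<le> G"
    and \<eta>: "0 < \<eta>"
  shows "\<forall>\<^sub>F \<epsilon> in at_right 0. \<forall>x. \<bar>w \<epsilon> x - R0 x\<bar> \<le> \<eta>"
proof -
  obtain B0 where B0: "\<And>x. \<bar>R0 x\<bar> \<le> B0" using torus_C_bdd[OF R0] by auto
  obtain C where C: "0 \<le> C" "\<forall>\<^sub>F \<epsilon> in at_right 0. class_C 0 (\<sigma> \<epsilon>) \<and> C_bdd 0 C (\<sigma> \<epsilon>)"
    using unif_bddE[OF \<sigma>] .
  \<comment> \<open>\<open>B\<close> must bound \<open>R0\<close> and, through the maximum
    principle, \<open>w\<close>; the latter needs a bound on \<open>R\<close>, which is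
    \<open>B0 + C\<close> once \<open>\<epsilon> < 1\<close>. Adding 1 makes it positive for the
    divisions.\<close>
  define B where "B = B0 + C + 1"
  have B: "0 < B" using B0[of 0] C(1) by (simp add: B_def)
  \<comment> \<open>The oscillation is allowed one third of \<open>\<eta>\<^sup>2\<close>; the two
    terms proportional to \<epsilon> get one third each.\<close>
  define \<nu> where "\<nu> = \<eta>\<^sup>2 / (6 * B)"
  have \<nu>: "0 < \<nu>" "2 * B * \<nu> = \<eta>\<^sup>2 / 3" using \<eta> B by (auto simp: \<nu>_def)
  obtain \<rho> where \<rho>: "0 < \<rho>" "\<And>p q. norm (p - q) \<le> \<rho> \<Longrightarrow> \<bar>R0 p - R0 q\<bar> \<le> \<nu>"
    using torus_C_uniformly_continuous[OF R0 \<nu>(1)] by (metis real_norm_def)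
  \<comment> \<open>The least penalty weight that \<open>transport_near\<close> admits for this
    \<rho>.\<close>
  define K where "K = 4 * B\<^sup>2 / \<rho>\<^sup>2"
  have K: "0 < K" "4 * B\<^sup>2 \<le> K * \<rho>\<^sup>2" using B \<rho>(1) by (auto simp: K_def)
  have \<eta>3: "0 < \<eta>\<^sup>2 / 3" using \<eta> by simp
  show ?thesis
    using tr R C(2) g eventually_eps_small[OF \<eta>3, of "2 * B * C"]
      eventually_eps_small[OF \<eta>3, of "K * \<rho> * G"] eventually_eps_small[OF zero_less_one, of 1]
  proof eventually_elim
    case (elim \<epsilon>)
    have \<kappa>: "\<bar>R \<epsilon> x - R0 x\<bar> \<le> \<epsilon> * C" for x
      using elim by (simp add: abs_mult)
    have "\<epsilon> * C \<le> C" using elim C(1) by (intro mult_left_le_one_le) auto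
    then have "\<bar>R \<epsilon> x\<bar> \<le> B" for x
      using \<kappa>[of x] B0[of x] unfolding B_def by linarith
    then have wB: "\<bar>w \<epsilon> x\<bar> \<le> B" for x
      using transport_bound[of "w \<epsilon>" \<epsilon> "g \<epsilon>" "R \<epsilon>" B] elim by blast
    have RB: "\<bar>R0 x\<bar> \<le> B" for x using B0[of x] C(1) unfolding B_def by linarith
    show ?case
    proof
      fix x
      have "(w \<epsilon> x - R0 x)\<^sup>2 \<le> 2 * B * (\<epsilon> * C + \<nu>) + \<epsilon> * K * \<rho> * G"
        using elim by (intro transport_near[of "w \<epsilon>" R0 \<epsilon> "g \<epsilon>" "R \<epsilon>"] R0 \<kappa> wB RB \<rho>(2) K) (use \<rho>(1) in auto)
      also have "\<dots> = \<epsilon> * (2 * B * C) + \<eta>\<^sup>2 / 3 + \<epsilon> * (K * \<rho> * G)"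
        unfolding distrib_left \<nu>(2) by (simp add: mult_ac)
      also have "\<dots> \<le> \<eta>\<^sup>2" using elim by linarith
      finally show "\<bar>w \<epsilon> x - R0 x\<bar> \<le> \<eta>"
        using \<eta> by (simp add: abs_le_square_iff[symmetric])
    qed
  qed
qed

section \<open>A quasilinear relaxation problem\<close>

lemma C_bdd_2:
  "C_bdd 2 C f \<longleftrightarrow> (\<forall>x. norm (f x) \<le> C) \<and> (\<forall>b\<in>Basis. \<forall>x. norm (dirder b f x) \<le> C)
    \<and> (\<forall>b\<in>Basis. \<forall>b'\<in>Basis. \<forall>x. norm (dirder b' (dirder b f) x) \<le> C)"
  by (auto simp: numeral_2_eq_2)

lemma C_bdd_closed:
  assumes "\<And>e. 0 < e \<Longrightarrow> C_bdd k (c + e) f"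
  shows "C_bdd k c f"
  using assms
proof (induction k arbitrary: f)
  case 0
  then have "norm (f x) \<le> c + e" if "0 < e" for e x using that by simp
  then show ?case by (auto intro: field_le_epsilon)
next
  case (Suc k)
  have "norm (f x) \<le> c + e" if "0 < e" for e x
    using Suc.prems[OF that] by simp
  moreover have "C_bdd k c (dirder b f)" if "b \<in> Basis" for b
    using Suc.prems that by (intro Suc.IH) simp
  ultimately show ?case by (auto intro: field_le_epsilon)
qed

text \<open>Iterating the improvement from \<open>M\<close> to \<open>A + M / 2\<close> converges to
  the fixed point \<open>2 * A\<close>, whatever finite bound it starts from. All components are
  treated together because the equation of one may involve the others.\<close>

lemma C_bdd_absorb:
  assumes ex: "\<exists>M. \<forall>i. C_bdd k M (f i)"
    and step: "\<And>M. \<forall>i. C_bdd k M (f i) \<Longrightarrow> \<forall>i. C_bdd k (A + M / 2) (f i)"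
  shows "C_bdd k (2 * A) (f i)"
proof (rule C_bdd_closed)
  fix e :: real assume e: "0 < e"
  obtain M where M: "\<forall>i. C_bdd k M (f i)" using ex by blast
  have it: "\<forall>i. C_bdd k (2 * A + (M - 2 * A) / 2 ^ n) (f i)" for n
  proof (induction n)
    case (Suc n)
    have "A + (2 * A + (M - 2 * A) / 2 ^ n) / 2 = 2 * A + (M - 2 * A) / 2 ^ Suc n"
      by (simp add: field_simps)
    with step[OF Suc] show ?case by simp
  qed (use M in simp)
  have "(\<lambda>n. (M - 2 * A) / 2 ^ n) \<longlonglongrightarrow> 0"
    by (rule LIMSEQ_divide_realpow_zero) simp
  then have "\<forall>\<^sub>F n in sequentially. (M - 2 * A) / 2 ^ n < e"
    using e by (rule order_tendstoD)
  then obtain n where "(M - 2 * A) / 2 ^ n < e"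
    using eventually_happens'[OF sequentially_bot] by blast
  then have "2 * A + (M - 2 * A) / 2 ^ n \<le> 2 * A + e" by linarith
  with it[THEN spec] show "C_bdd k (2 * A + e) (f i)" by (rule C_bdd_weaken)
qed

lemma abs_sum_le_card:
  fixes f :: "'i \<Rightarrow> real"
  assumes "\<And>i. i \<in> I \<Longrightarrow> \<bar>f i\<bar> \<le> C"
  shows "\<bar>\<Sum>i\<in>I. f i\<bar> \<le> real (card I) * C"
  using order_trans[OF sum_abs sum_bounded_above[of I "\<lambda>i. \<bar>f i\<bar>" C]] assms by simp

text \<open>The abstract form of the equation for \<open>u\<close>, which stands for
  \<open>(h0 - h) / \<epsilon>\<close> with \<open>m\<close> running over the matrix entries.
  \<open>G\<close> gives the components of the phase field on the critical manifold,
  \<open>Q\<close> its linear dependence on the entries, and \<open>a\<close> the partial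
  derivatives of the entries of \<open>h0\<close>. The bounds \<open>u0\<close> and
  \<open>eps_grad\<close> encode the closeness to the critical manifold and the uniform Lipschitz
  bound on \<open>h\<close>.\<close>

locale relaxation =
  fixes u :: "real \<Rightarrow> 'm::finite \<Rightarrow> 'a::euclidean_space \<Rightarrow> real" and g :: "real \<Rightarrow> 'a \<Rightarrow> 'a"
    and G :: "'a \<Rightarrow> 'a \<Rightarrow> real" and Q a :: "'a \<Rightarrow> 'm \<Rightarrow> 'a \<Rightarrow> real"
  assumes G: "b \<in> Basis \<Longrightarrow> torus_C 2 (G b)"
    and Q: "b \<in> Basis \<Longrightarrow> torus_C 2 (Q b m)"
    and a: "b \<in> Basis \<Longrightarrow> torus_C 2 (a b m)"
    and u3: "\<forall>\<^sub>F \<epsilon> in at_right 0. \<forall>m. torus_C 3 (u \<epsilon> m)"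
    and g: "\<forall>\<^sub>F \<epsilon> in at_right 0. \<forall>b\<in>Basis. \<forall>x. g \<epsilon> x \<bullet> b = G b x - \<epsilon> * (\<Sum>m\<in>UNIV. Q b m x * u \<epsilon> m x)"
    and pde: "\<forall>\<^sub>F \<epsilon> in at_right 0. \<forall>m. transport \<epsilon> (g \<epsilon>) (u \<epsilon> m) (\<lambda>x. \<Sum>b\<in>Basis. (g \<epsilon> x \<bullet> b) * a b m x)"
    and u0: "unif_bdd 0 (\<lambda>\<epsilon>. u \<epsilon> m)"
    and eps_grad: "b \<in> Basis \<Longrightarrow> unif_bdd 0 (\<lambda>\<epsilon> x. \<epsilon> * dirder b (u \<epsilon> m) x)"
begin

definition r :: "real \<Rightarrow> 'm \<Rightarrow> 'a \<Rightarrow> real" where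
  "r \<epsilon> m x = (\<Sum>b\<in>Basis. (g \<epsilon> x \<bullet> b) * a b m x)"

text \<open>The formal limit of \<open>r\<close>, with \<open>g\<close> replaced by
  \<open>G\<close>; in the application it is the negative of an entry of \<open>h1\<close>.\<close>

definition r0 :: "'m \<Rightarrow> 'a \<Rightarrow> real" where
  "r0 m x = (\<Sum>b\<in>Basis. G b x * a b m x)"

text \<open>\<open>R1\<close> and \<open>R2\<close> are the right-hand sides that
  \<open>transport_dirder\<close> produces for the first and second derivatives of
  \<open>u\<close>.\<close>

definition R1 :: "real \<Rightarrow> 'm \<Rightarrow> 'a \<Rightarrow> 'a \<Rightarrow> real" where
  "R1 \<epsilon> m b x = dirder b (r \<epsilon> m) x
    - \<epsilon> * (\<Sum>c\<in>Basis. dirder b (\<lambda>x. g \<epsilon> x \<bullet> c) x * dirder c (u \<epsilon> m) x)"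

definition R2 :: "real \<Rightarrow> 'm \<Rightarrow> 'a \<Rightarrow> 'a \<Rightarrow> 'a \<Rightarrow> real" where
  "R2 \<epsilon> m b b' x = dirder b' (R1 \<epsilon> m b) x
    - \<epsilon> * (\<Sum>c\<in>Basis. dirder b' (\<lambda>x. g \<epsilon> x \<bullet> c) x * dirder c (dirder b (u \<epsilon> m)) x)"

section \<open>Regularity and the differentiated equations\<close>

lemma r0_C: "torus_C 2 (r0 m)"
  unfolding r0_def[abs_def] by (intro torus_C_sum torus_C_mult G a)

lemma regular:
  "\<forall>\<^sub>F \<epsilon> in at_right 0. (\<forall>m. torus_C 3 (u \<epsilon> m)) \<and> (\<forall>b\<in>Basis. torus_C 2 (\<lambda>x. g \<epsilon> x \<bullet> b))
     \<and> (\<forall>m. torus_C 2 (r \<epsilon> m))"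
  using u3 g
proof eventually_elim
  case (elim \<epsilon>)
  have "torus_C 2 (u \<epsilon> m)" for m by (rule torus_C_mono[of 3]) (use elim(1) in auto)
  then have "torus_C 2 (\<lambda>x. G b x - \<epsilon> * (\<Sum>m\<in>UNIV. Q b m x * u \<epsilon> m x))" if "b \<in> Basis" for b
    using that by (intro torus_C_diff torus_C_mult torus_C_sum G Q torus_C_const)
  with elim(2) have g2: "torus_C 2 (\<lambda>x. g \<epsilon> x \<bullet> b)" if "b \<in> Basis" for b
    using that by simp
  have "torus_C 2 (r \<epsilon> m)" for m
    unfolding r_def[abs_def] by (intro torus_C_sum torus_C_mult g2 a)
  with g2 elim(1) show ?case by blast
qed

lemma transport_u: "\<forall>\<^sub>F \<epsilon> in at_right 0. \<forall>m. transport \<epsilon> (g \<epsilon>) (u \<epsilon> m) (r \<epsilon> m)"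
  using pde by (simp add: r_def[abs_def])

lemma transport_du:
  "\<forall>\<^sub>F \<epsilon> in at_right 0. \<forall>m b. torus_C 2 (dirder b (u \<epsilon> m)) \<and> torus_C 1 (R1 \<epsilon> m b)
     \<and> transport \<epsilon> (g \<epsilon>) (dirder b (u \<epsilon> m)) (R1 \<epsilon> m b)"
  using regular transport_u
proof eventually_elim
  case (elim \<epsilon>)
  have g1: "torus_C (Suc 1) (\<lambda>x. g \<epsilon> x \<bullet> c)" if "c \<in> Basis" for c
    using elim(1) that by (simp add: numeral_2_eq_2)
  have r1: "torus_C (Suc 1) (r \<epsilon> m)" for m
    using elim(1) by (simp add: numeral_2_eq_2)
  have u2: "torus_C 2 (dirder b (u \<epsilon> m))" for b m
    using torus_C_dirder[of 2 "u \<epsilon> m"] elim(1) by (simp add: numeral_3_eq_3 numeral_2_eq_2)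
  then have u1: "torus_C 1 (dirder b (u \<epsilon> m))" for b m
    by (rule torus_C_mono) simp
  have "torus_C 1 (R1 \<epsilon> m b)" for m b
    unfolding R1_def[abs_def]
    by (intro torus_C_diff torus_C_mult torus_C_sum torus_C_const torus_C_dirder r1 g1 u1)
  moreover have "transport \<epsilon> (g \<epsilon>) (dirder b (u \<epsilon> m)) (R1 \<epsilon> m b)" for m b
    unfolding R1_def[abs_def]
  proof (rule transport_dirder)
    show "class_C 2 (u \<epsilon> m)"
      by (rule class_C_mono[of 3]) (use elim(1) in \<open>auto simp: torus_C_def\<close>)
    show "class_C 1 (\<lambda>x. g \<epsilon> x \<bullet> c)" if "c \<in> Basis" for c
      by (rule class_C_SucD) (use g1[OF that] in \<open>simp add: torus_C_def\<close>)
  qed (use elim in blast)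
  ultimately show ?case using u2 by blast
qed

text \<open>The third derivative of \<open>u\<close> is consumed here: it makes the second
  derivatives of class C^1, as the maximum principle requires.\<close>

lemma transport_ddu:
  "\<forall>\<^sub>F \<epsilon> in at_right 0. \<forall>m b b'. torus_C 1 (dirder b' (dirder b (u \<epsilon> m)))
     \<and> transport \<epsilon> (g \<epsilon>) (dirder b' (dirder b (u \<epsilon> m))) (R2 \<epsilon> m b b')"
  using regular transport_du
proof eventually_elim
  case (elim \<epsilon>)
  have "torus_C 1 (dirder b' (dirder b (u \<epsilon> m)))" for m b b'
    using torus_C_dirder[of 1 "dirder b (u \<epsilon> m)"] elim(2) by (simp add: numeral_2_eq_2)
  moreover have "transport \<epsilon> (g \<epsilon>) (dirder b' (dirder b (u \<epsilon> m))) (R2 \<epsilon> m b b')" for m b b'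
    unfolding R2_def[abs_def]
  proof (rule transport_dirder)
    show "class_C 2 (dirder b (u \<epsilon> m))" using elim(2) unfolding torus_C_def by blast
    show "class_C 1 (\<lambda>x. g \<epsilon> x \<bullet> c)" if "c \<in> Basis" for c
      by (rule class_C_mono[of 2]) (use elim(1) that in \<open>auto simp: torus_C_def\<close>)
  qed (use elim in blast)
  ultimately show ?case by blast
qed

section \<open>Bounds in C^2 uniform in \<epsilon>\<close>

lemma eps_u_bdd: "unif_bdd 1 (\<lambda>\<epsilon> x. \<epsilon> * u \<epsilon> m x)"
  unfolding One_nat_def
proof (rule unif_bdd_SucI)
  show "\<forall>\<^sub>F \<epsilon> in at_right 0. class_C (Suc 0) (\<lambda>x. \<epsilon> * u \<epsilon> m x)"
    using u3 by eventually_elim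
      (use class_C_mono[of 3 _ "Suc 0"] in \<open>auto simp: torus_C_def intro!: class_C_cmult\<close>)
  show "unif_bdd 0 (\<lambda>\<epsilon> x. \<epsilon> * u \<epsilon> m x)" by (intro unif_bdd_eps u0)
  show "unif_bdd 0 (\<lambda>\<epsilon>. dirder b (\<lambda>x. \<epsilon> * u \<epsilon> m x))" if "b \<in> Basis" for b
  proof (rule unif_bdd_cong[OF eps_grad[OF that]])
    show "\<forall>\<^sub>F \<epsilon> in at_right 0. (\<lambda>x. \<epsilon> * dirder b (u \<epsilon> m) x) = dirder b (\<lambda>x. \<epsilon> * u \<epsilon> m x)"
      using u3 by eventually_elim (simp add: fun_eq_iff dirder_cmult torus_C_differentiable[of 3])
  qed
qed

text \<open>\<open>g\<close> contains \<open>u\<close> only in the combination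
  \<open>\<epsilon> * u\<close>, so bounds on that product control it.\<close>

lemma g_bdd:
  assumes "\<And>m. unif_bdd k (\<lambda>\<epsilon> x. \<epsilon> * u \<epsilon> m x)" "k \<le> 2" "b \<in> Basis"
  shows "unif_bdd k (\<lambda>\<epsilon> x. g \<epsilon> x \<bullet> b)"
proof (rule unif_bdd_cong)
  show "unif_bdd k (\<lambda>\<epsilon> x. G b x - (\<Sum>m\<in>UNIV. Q b m x * (\<epsilon> * u \<epsilon> m x)))"
    by (intro unif_bdd_diff unif_bdd_sum unif_bdd_mult[OF unif_bdd_const assms(1)] unif_bdd_const
        torus_C_mono[OF G] torus_C_mono[OF Q] assms(2,3))
  show "\<forall>\<^sub>F \<epsilon> in at_right 0. (\<lambda>x. G b x - (\<Sum>m\<in>UNIV. Q b m x * (\<epsilon> * u \<epsilon> m x))) = (\<lambda>x. g \<epsilon> x \<bullet> b)"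
    using g by eventually_elim (use assms(3) in \<open>simp add: fun_eq_iff sum_distrib_left mult_ac\<close>)
qed

lemma g1_bdd: "b \<in> Basis \<Longrightarrow> unif_bdd 1 (\<lambda>\<epsilon> x. g \<epsilon> x \<bullet> b)"
  by (rule g_bdd[OF eps_u_bdd]) auto

text \<open>In \<open>R1\<close> the gradient of \<open>u\<close> carries a factor \<epsilon>, and
  the product is bounded by \<open>eps_grad\<close>; the right-hand side is thus bounded before
  anything is known about the gradient alone.\<close>

lemma u1_bdd: "unif_bdd 1 (\<lambda>\<epsilon>. u \<epsilon> m)"
  unfolding One_nat_def
proof (rule unif_bdd_SucI[OF _ u0])
  show "\<forall>\<^sub>F \<epsilon> in at_right 0. class_C (Suc 0) (u \<epsilon> m)"
    using u3 by eventually_elim (use class_C_mono[of 3 _ "Suc 0"] in \<open>auto simp: torus_C_def\<close>)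
  fix b :: 'a assume b: "b \<in> Basis"
  show "unif_bdd 0 (\<lambda>\<epsilon>. dirder b (u \<epsilon> m))"
  proof (rule unif_bdd_transport)
    show "\<forall>\<^sub>F \<epsilon> in at_right 0. torus_C 1 (dirder b (u \<epsilon> m)) \<and> transport \<epsilon> (g \<epsilon>) (dirder b (u \<epsilon> m)) (R1 \<epsilon> m b)"
      using transport_du by eventually_elim (use torus_C_mono[of 2 _ 1] in auto)
    have "unif_bdd 1 (\<lambda>\<epsilon>. r \<epsilon> m)"
      unfolding r_def[abs_def]
      by (intro unif_bdd_sum unif_bdd_mult g1_bdd unif_bdd_const torus_C_mono[OF a]) auto
    then have "unif_bdd 0 (\<lambda>\<epsilon> x. dirder b (r \<epsilon> m) x
        - (\<Sum>c\<in>Basis. dirder b (\<lambda>x. g \<epsilon> x \<bullet> c) x * (\<epsilon> * dirder c (u \<epsilon> m) x)))"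
      using g1_bdd b
      by (intro unif_bdd_diff unif_bdd_sum unif_bdd_mult eps_grad unif_bdd_dirder) auto
    then show "unif_bdd 0 (\<lambda>\<epsilon>. R1 \<epsilon> m b)"
      by (simp add: R1_def[abs_def] sum_distrib_left mult_ac)
  qed
qed

text \<open>\<open>R2\<close> contains second derivatives of \<open>u\<close>, both explicitly and
  through those of \<open>g\<close>, but always with a factor \<epsilon>. For small \<epsilon> they
  contribute at most half of the bound sought and are absorbed.\<close>

lemma u2_bdd: "unif_bdd 2 (\<lambda>\<epsilon>. u \<epsilon> m)"
proof -
  obtain C1 where C1: "0 \<le> C1" "\<forall>\<^sub>F \<epsilon> in at_right 0. \<forall>m\<in>UNIV. class_C 1 (u \<epsilon> m) \<and> C_bdd 1 C1 (u \<epsilon> m)"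
    using unif_bdd_common_bound[OF finite u1_bdd] .
  obtain C2 where C2: "0 \<le> C2" "\<forall>\<^sub>F \<epsilon> in at_right 0. \<forall>b\<in>Basis.
      class_C 1 (\<lambda>x. g \<epsilon> x \<bullet> b) \<and> C_bdd 1 C2 (\<lambda>x. g \<epsilon> x \<bullet> b)"
    using unif_bdd_common_bound[OF finite_Basis g1_bdd] .
  obtain C3 where C3: "0 \<le> C3" "\<forall>\<^sub>F \<epsilon> in at_right (0::real). \<forall>b\<in>Basis. class_C 2 (G b) \<and> C_bdd 2 C3 (G b)"
    using unif_bdd_common_bound[OF finite_Basis unif_bdd_const[OF G]] .
  obtain C4 where C4: "0 \<le> C4" "\<forall>\<^sub>F \<epsilon> in at_right (0::real). \<forall>z\<in>Basis \<times> UNIV.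
      class_C 2 (Q (fst z) (snd z)) \<and> C_bdd 2 C4 (Q (fst z) (snd z))"
    by (rule unif_bdd_common_bound[of "Basis \<times> (UNIV :: 'm set)" 2 "\<lambda>z _. Q (fst z) (snd z)"])
      (auto intro: unif_bdd_const[OF Q])
  obtain C5 where C5: "0 \<le> C5" "\<forall>\<^sub>F \<epsilon> in at_right (0::real). \<forall>z\<in>Basis \<times> UNIV.
      class_C 2 (a (fst z) (snd z)) \<and> C_bdd 2 C5 (a (fst z) (snd z))"
    by (rule unif_bdd_common_bound[of "Basis \<times> (UNIV :: 'm set)" 2 "\<lambda>z _. a (fst z) (snd z)"])
      (auto intro: unif_bdd_const[OF a])
  define C where "C = C1 + C2 + C3 + C4 + C5"
  have C: "0 \<le> C" "C1 \<le> C" "C2 \<le> C" "C3 \<le> C" "C4 \<le> C" "C5 \<le> C"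
    using C1(1) C2(1) C3(1) C4(1) C5(1) by (auto simp: C_def)
  define d n where "d = real DIM('a)" and "n = real CARD('m)"
  have dn: "0 \<le> d" "0 \<le> n" by (auto simp: d_def n_def)
  \<comment> \<open>\<open>A\<close> collects the terms free of \<open>M\<close>, plus
    \<open>C\<close> to cover the orders 0 and 1; \<open>B\<close> collects the coefficients of
    \<open>\<epsilon> * M\<close>. The 5 in \<open>A\<close>, which with the 4 of \<open>Cg\<close>
    also makes the 20 in \<open>B\<close>, comes from \<open>4 * d * C * Cg\<close> for
    \<open>r\<close> and at most \<open>d * C * Cg\<close> for second derivatives of
    \<open>g\<close> times the gradient of \<open>u\<close>.\<close>
  define A B where "A = 5 * d * C\<^sup>2 + C" and "B = 20 * n * d * C\<^sup>2 + 2 * d * C"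
  have half: "0 < (1 / 2 :: real)" by simp
  have "\<forall>\<^sub>F \<epsilon> in at_right 0. class_C 2 (u \<epsilon> m) \<and> C_bdd 2 (2 * A) (u \<epsilon> m)"
    using regular g transport_du transport_ddu C1(2) C2(2) C3(2) C4(2) C5(2)
      eventually_eps_small[OF half, of B] eventually_eps_small[OF zero_less_one, of 1]
  proof eventually_elim
    case (elim \<epsilon>)
    have eps: "0 < \<epsilon>" "\<epsilon> \<le> 1" "\<epsilon> * B \<le> 1 / 2" using elim by auto
    have u2: "torus_C 2 (u \<epsilon> m)" for m by (rule torus_C_mono[of 3]) (use elim(1) in auto)
    have cu: "class_C 2 (u \<epsilon> m)" for m using u2 by (simp add: torus_C_def)
    have b': "C_bdd 1 C1 (u \<epsilon> m)" "c \<in> Basis \<Longrightarrow> C_bdd 1 C2 (\<lambda>x. g \<epsilon> x \<bullet> c)"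
      "c \<in> Basis \<Longrightarrow> C_bdd 2 C3 (G c)" "c \<in> Basis \<Longrightarrow> C_bdd 2 C4 (Q c m)"
      "c \<in> Basis \<Longrightarrow> C_bdd 2 C5 (a c m)" for c m
      using elim(5-9) by (simp_all del: C_bdd.simps)
    have b: "C_bdd 1 C (u \<epsilon> m)" "c \<in> Basis \<Longrightarrow> C_bdd 1 C (\<lambda>x. g \<epsilon> x \<bullet> c)"
      "c \<in> Basis \<Longrightarrow> C_bdd 2 C (G c)" "c \<in> Basis \<Longrightarrow> C_bdd 2 C (Q c m)"
      "c \<in> Basis \<Longrightarrow> C_bdd 2 C (a c m)" for c m
      by (blast intro: C_bdd_weaken[OF b'(1) C(2)] C_bdd_weaken[OF b'(2) C(3)]
          C_bdd_weaken[OF b'(3) C(4)] C_bdd_weaken[OF b'(4) C(5)] C_bdd_weaken[OF b'(5) C(6)])+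
    have cl: "c \<in> Basis \<Longrightarrow> class_C 2 (G c)" "c \<in> Basis \<Longrightarrow> class_C 2 (Q c m)"
      "c \<in> Basis \<Longrightarrow> class_C 2 (a c m)" for c m
      using elim by auto
    have g2: "c \<in> Basis \<Longrightarrow> class_C 2 (\<lambda>x. g \<epsilon> x \<bullet> c)" for c
      using elim(1) by (auto simp: torus_C_def)
    \<comment> \<open>For each fixed \<epsilon> compactness gives some finite bound; it may depend
      on \<epsilon>, which the absorption tolerates.\<close>
    have "\<forall>m. \<exists>M. C_bdd 2 M (u \<epsilon> m)" using torus_C_bdd[OF u2] by blast
    then obtain Mf where Mf: "\<And>m. C_bdd 2 (Mf m) (u \<epsilon> m)" by metis
    have "C_bdd 2 (2 * A) (u \<epsilon> m)"
    proof (rule C_bdd_absorb[where f = "u \<epsilon>"])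
      have "C_bdd 2 (Max (range Mf)) (u \<epsilon> m)" for m
        by (rule C_bdd_weaken[OF Mf]) simp
      then show "\<exists>M. \<forall>m. C_bdd 2 M (u \<epsilon> m)" by blast
    next
      fix M assume M: "\<forall>m. C_bdd 2 M (u \<epsilon> m)"
      have M0: "0 \<le> M" using M C_bdd_nonneg by blast
      \<comment> \<open>\<open>M\<close> enters the bound for \<open>g\<close> only through
        \<open>\<epsilon> * u\<close>; \<open>2\<^sup>2\<close> is the factor of
        \<open>C_bdd_mult\<close> at order two.\<close>
      define Cg where "Cg = C + \<bar>\<epsilon>\<bar> * (\<Sum>m\<in>(UNIV::'m set). 2\<^sup>2 * (C * M))"
      have Cg: "Cg = C + 4 * \<epsilon> * n * C * M" using eps by (simp add: Cg_def n_def)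
      have Cg0: "0 \<le> Cg" unfolding Cg using eps C(1) M0 dn by simp
      have gM: "C_bdd 2 Cg (\<lambda>x. g \<epsilon> x \<bullet> c)" if c: "c \<in> Basis" for c
      proof -
        have "C_bdd 2 Cg (\<lambda>x. G c x - \<epsilon> * (\<Sum>m\<in>UNIV. Q c m x * u \<epsilon> m x))"
          unfolding Cg_def using M
          by (intro C_bdd_diff C_bdd_cmult C_bdd_sum C_bdd_mult class_C_cmult class_C_sum class_C_mult
              cl[OF c] b(3,4)[OF c] cu) auto
        then show ?thesis using elim(2) c by simp
      qed
      have rM: "C_bdd 2 (4 * d * C * Cg) (r \<epsilon> m)" for m
      proof -
        have "C_bdd 2 (\<Sum>b\<in>(Basis::'a set). 2\<^sup>2 * (Cg * C)) (r \<epsilon> m)"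
          unfolding r_def[abs_def]
          by (intro C_bdd_sum C_bdd_mult class_C_mult g2 gM cl b)
        then show ?thesis by (simp add: d_def mult_ac)
      qed
      have w: "\<bar>dirder b' (dirder c (u \<epsilon> m)) x\<bar> \<le> A + \<epsilon> * B * M"
        if c: "c \<in> Basis" and b': "b' \<in> Basis" for c b' m x
      proof (rule transport_bound[where f = "dirder b' (dirder c (u \<epsilon> m))" and g = "g \<epsilon>" and r = "R2 \<epsilon> m c b'" and \<epsilon> = \<epsilon>])
        show "torus_C 1 (dirder b' (dirder c (u \<epsilon> m)))"
          "transport \<epsilon> (g \<epsilon>) (dirder b' (dirder c (u \<epsilon> m))) (R2 \<epsilon> m c b')"
          using elim(4) by blast+
        fix x
        have "torus_C (Suc 1) (r \<epsilon> m)" "e \<in> Basis \<Longrightarrow> torus_C (Suc 1) (\<lambda>x. g \<epsilon> x \<bullet> e)" for e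
          using elim(1) by (simp_all add: numeral_2_eq_2)
        note t1 = this(1)[THEN torus_C_dirder] this(2)[THEN torus_C_dirder]
        have dd: "dirder c (r \<epsilon> m) differentiable (at x)"
          "e \<in> Basis \<Longrightarrow> dirder c (\<lambda>x. g \<epsilon> x \<bullet> e) differentiable (at x)"
          "dirder e (u \<epsilon> m) differentiable (at x)" for e
          using t1[THEN torus_C_differentiable] elim(3) by (simp_all add: torus_C_differentiable[of 2])
        have "dirder b' (R1 \<epsilon> m c) x = dirder b' (dirder c (r \<epsilon> m)) x
            - \<epsilon> * (\<Sum>e\<in>Basis. dirder c (\<lambda>x. g \<epsilon> x \<bullet> e) x * dirder b' (dirder e (u \<epsilon> m)) x
                + dirder b' (dirder c (\<lambda>x. g \<epsilon> x \<bullet> e)) x * dirder e (u \<epsilon> m) x)"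
          unfolding R1_def[abs_def] using dd
          by (simp add: dirder_diff dirder_cmult dirder_sum dirder_mult differentiable_mult differentiable_sum)
        \<comment> \<open>In each summand, second derivatives of \<open>u\<close> meet first
          derivatives of \<open>g\<close> twice, and a second derivative of \<open>g\<close> meets
          the gradient of \<open>u\<close> once.\<close>
        then have R2: "R2 \<epsilon> m c b' x = dirder b' (dirder c (r \<epsilon> m)) x
            - \<epsilon> * (\<Sum>e\<in>Basis. dirder c (\<lambda>x. g \<epsilon> x \<bullet> e) x * dirder b' (dirder e (u \<epsilon> m)) x
                + dirder b' (dirder c (\<lambda>x. g \<epsilon> x \<bullet> e)) x * dirder e (u \<epsilon> m) x
                + dirder b' (\<lambda>x. g \<epsilon> x \<bullet> e) x * dirder e (dirder c (u \<epsilon> m)) x)"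
          by (simp add: R2_def sum.distrib algebra_simps)
        have "\<bar>\<Sum>e\<in>Basis. dirder c (\<lambda>x. g \<epsilon> x \<bullet> e) x * dirder b' (dirder e (u \<epsilon> m)) x
                + dirder b' (dirder c (\<lambda>x. g \<epsilon> x \<bullet> e)) x * dirder e (u \<epsilon> m) x
                + dirder b' (\<lambda>x. g \<epsilon> x \<bullet> e) x * dirder e (dirder c (u \<epsilon> m)) x\<bar> \<le> d * (C * M + Cg * C + C * M)"
          unfolding d_def
        proof (rule abs_sum_le_card)
          fix e :: 'a assume e: "e \<in> Basis"
          have 1: "\<bar>dirder z (\<lambda>x. g \<epsilon> x \<bullet> e) x\<bar> \<le> C" if "z \<in> Basis" for z
            using b(2)[OF e] that by simp
          have 2: "\<bar>dirder z (dirder y (u \<epsilon> m)) x\<bar> \<le> M" if "z \<in> Basis" "y \<in> Basis" for y z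
            using M that by (simp add: C_bdd_2)
          have 3: "\<bar>dirder b' (dirder c (\<lambda>x. g \<epsilon> x \<bullet> e)) x\<bar> \<le> Cg"
            using gM[OF e] c b' by (simp add: C_bdd_2)
          have 4: "\<bar>dirder e (u \<epsilon> m) x\<bar> \<le> C" using b(1)[of m] e by simp
          have "\<bar>dirder c (\<lambda>x. g \<epsilon> x \<bullet> e) x * dirder b' (dirder e (u \<epsilon> m)) x\<bar> \<le> C * M"
            unfolding abs_mult by (intro mult_mono 1 2 c b' e C(1) abs_ge_zero)
          moreover have "\<bar>dirder b' (dirder c (\<lambda>x. g \<epsilon> x \<bullet> e)) x * dirder e (u \<epsilon> m) x\<bar> \<le> Cg * C"
            unfolding abs_mult by (intro mult_mono 3 4 Cg0 abs_ge_zero)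
          moreover have "\<bar>dirder b' (\<lambda>x. g \<epsilon> x \<bullet> e) x * dirder e (dirder c (u \<epsilon> m)) x\<bar> \<le> C * M"
            unfolding abs_mult by (intro mult_mono 1 2 c b' e C(1) abs_ge_zero)
          ultimately show "\<bar>dirder c (\<lambda>x. g \<epsilon> x \<bullet> e) x * dirder b' (dirder e (u \<epsilon> m)) x
                + dirder b' (dirder c (\<lambda>x. g \<epsilon> x \<bullet> e)) x * dirder e (u \<epsilon> m) x
                + dirder b' (\<lambda>x. g \<epsilon> x \<bullet> e) x * dirder e (dirder c (u \<epsilon> m)) x\<bar> \<le> C * M + Cg * C + C * M"
            by linarith
        qed
        then have "\<epsilon> * \<bar>\<Sum>e\<in>Basis. dirder c (\<lambda>x. g \<epsilon> x \<bullet> e) x * dirder b' (dirder e (u \<epsilon> m)) x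
                + dirder b' (dirder c (\<lambda>x. g \<epsilon> x \<bullet> e)) x * dirder e (u \<epsilon> m) x
                + dirder b' (\<lambda>x. g \<epsilon> x \<bullet> e) x * dirder e (dirder c (u \<epsilon> m)) x\<bar>
            \<le> \<epsilon> * (d * (C * M + Cg * C + C * M))"
          using eps by (intro mult_left_mono) auto
        moreover have "\<bar>dirder b' (dirder c (r \<epsilon> m)) x\<bar> \<le> 4 * d * C * Cg"
          using rM[of m] c b' by (simp add: C_bdd_2)
        ultimately have "\<bar>R2 \<epsilon> m c b' x\<bar> \<le> 4 * d * C * Cg + \<epsilon> * (d * (C * M + Cg * C + C * M))"
          unfolding R2 using eps(1) by (intro order_trans[OF abs_triangle_ineq4] add_mono) (auto simp: abs_mult)
        also have "\<epsilon> * (d * (C * M + Cg * C + C * M)) = 2 * \<epsilon> * d * C * M + \<epsilon> * (d * C * Cg)"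
          by (simp add: algebra_simps)
        \<comment> \<open>Here \<open>\<epsilon> \<le> 1\<close> suffices, since in
          \<open>Cg\<close> the bound \<open>M\<close> already comes with a factor
          \<epsilon>.\<close>
        also have "\<epsilon> * (d * C * Cg) \<le> d * C * Cg"
          using eps dn C(1) Cg0 by (intro mult_left_le_one_le) auto
        also have "4 * d * C * Cg + (2 * \<epsilon> * d * C * M + d * C * Cg) = 5 * d * C\<^sup>2 + \<epsilon> * B * M"
          by (simp add: Cg B_def algebra_simps power2_eq_square)
        finally show "\<bar>R2 \<epsilon> m c b' x\<bar> \<le> A + \<epsilon> * B * M"
          using C(1) by (simp add: A_def)
      qed
      have "\<epsilon> * B * M \<le> 1 / 2 * M" by (rule mult_right_mono[OF eps(3) M0])
      then have w': "\<bar>dirder b' (dirder c (u \<epsilon> m)) x\<bar> \<le> A + M / 2"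
        if c: "c \<in> Basis" and b': "b' \<in> Basis" for c b' m x
        using w[OF c b', of m x] by linarith
      have "C \<le> A + M / 2" using M0 dn by (simp add: A_def)
      then have "C_bdd 1 (A + M / 2) (u \<epsilon> m)" for m by (rule C_bdd_weaken[OF b(1)])
      with w' show "\<forall>m. C_bdd 2 (A + M / 2) (u \<epsilon> m)" by (simp add: C_bdd_2)
    qed
    with cu show ?case by blast
  qed
  then show ?thesis by (rule unif_bddI)
qed

section \<open>Convergence to \<open>r0\<close> in C^2\<close>

lemma g2_bdd: "b \<in> Basis \<Longrightarrow> unif_bdd 2 (\<lambda>\<epsilon> x. g \<epsilon> x \<bullet> b)"
  by (rule g_bdd[OF unif_bdd_eps[OF u2_bdd]]) auto

text \<open>\<open>g\<close> is affine in \<open>\<epsilon> * u\<close>, so the remainder of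
  \<open>r\<close> is an exact multiple of \<epsilon>, with a coefficient controlled by the bounds
  on \<open>u\<close> just obtained.\<close>

lemma r_expansion:
  obtains \<rho> where "\<And>m. unif_bdd 2 (\<lambda>\<epsilon>. \<rho> \<epsilon> m)"
    "\<forall>\<^sub>F \<epsilon> in at_right 0. \<forall>m x. r \<epsilon> m x = r0 m x + \<epsilon> * \<rho> \<epsilon> m x"
proof
  let ?\<rho> = "\<lambda>\<epsilon> m x. \<Sum>b\<in>Basis. (0 - (\<Sum>m'\<in>UNIV. Q b m' x * u \<epsilon> m' x)) * a b m x"
  show "unif_bdd 2 (\<lambda>\<epsilon>. ?\<rho> \<epsilon> m)" for m
    by (intro unif_bdd_sum unif_bdd_mult unif_bdd_diff unif_bdd_const torus_C_const Q a u2_bdd)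
  show "\<forall>\<^sub>F \<epsilon> in at_right 0. \<forall>m x. r \<epsilon> m x = r0 m x + \<epsilon> * ?\<rho> \<epsilon> m x"
    using g
  proof eventually_elim
    case (elim \<epsilon>)
    have "r \<epsilon> m x = (\<Sum>b\<in>Basis. G b x * a b m x
        + \<epsilon> * ((0 - (\<Sum>m'\<in>UNIV. Q b m' x * u \<epsilon> m' x)) * a b m x))" for m x
      unfolding r_def by (rule sum.cong) (use elim in \<open>simp_all add: left_diff_distrib\<close>)
    then show ?case by (simp only: r0_def sum.distrib sum_distrib_left) simp
  qed
qed

text \<open>Each derivative of \<open>u\<close> of order at most two solves a transport equation
  whose right-hand side is the same derivative of \<open>r0\<close> plus \<epsilon> times a bounded
  function, so \<open>transport_converges\<close> applies at every order.\<close>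

theorem relaxation_limit:
  assumes \<eta>: "0 < \<eta>"
  shows "\<forall>\<^sub>F \<epsilon> in at_right 0. \<forall>m. C_bdd 2 \<eta> (\<lambda>x. u \<epsilon> m x - r0 m x)"
proof -
  obtain \<rho> where \<rho>: "\<And>m. unif_bdd 2 (\<lambda>\<epsilon>. \<rho> \<epsilon> m)"
    and r: "\<forall>\<^sub>F \<epsilon> in at_right 0. \<forall>m x. r \<epsilon> m x = r0 m x + \<epsilon> * \<rho> \<epsilon> m x"
    using r_expansion by blast
  obtain Cg where Cg: "0 \<le> Cg" "\<forall>\<^sub>F \<epsilon> in at_right 0. \<forall>b\<in>Basis.
      class_C 1 (\<lambda>x. g \<epsilon> x \<bullet> b) \<and> C_bdd 1 Cg (\<lambda>x. g \<epsilon> x \<bullet> b)"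
    using unif_bdd_common_bound[OF finite_Basis g1_bdd] .
  have gG: "\<forall>\<^sub>F \<epsilon> in at_right 0. \<forall>x. norm (g \<epsilon> x) \<le> real DIM('a) * Cg"
    using Cg(2)
  proof eventually_elim
    case (elim \<epsilon>)
    show ?case
    proof
      fix x
      have "(\<Sum>b\<in>Basis. \<bar>g \<epsilon> x \<bullet> b\<bar>) \<le> real (card (Basis::'a set)) * Cg"
        by (rule sum_bounded_above) (use elim in auto)
      then show "norm (g \<epsilon> x) \<le> real DIM('a) * Cg" using norm_le_l1[of "g \<epsilon> x"] by linarith
    qed
  qed
  \<comment> \<open>\<tau> and \<sigma> are the coefficients of \<epsilon> in \<open>R1\<close> and
    \<open>R2\<close>.\<close>
  define \<tau> where "\<tau> \<epsilon> m b x = dirder b (\<rho> \<epsilon> m) x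
      - (\<Sum>c\<in>Basis. dirder b (\<lambda>x. g \<epsilon> x \<bullet> c) x * dirder c (u \<epsilon> m) x)" for \<epsilon> m b x
  define \<sigma> where "\<sigma> \<epsilon> m b b' x = dirder b' (\<tau> \<epsilon> m b) x
      - (\<Sum>c\<in>Basis. dirder b' (\<lambda>x. g \<epsilon> x \<bullet> c) x * dirder c (dirder b (u \<epsilon> m)) x)" for \<epsilon> m b b' x
  have s2: "unif_bdd (Suc 1) (\<lambda>\<epsilon>. \<rho> \<epsilon> m)" "unif_bdd (Suc 1) (\<lambda>\<epsilon>. u \<epsilon> m)"
    "c \<in> Basis \<Longrightarrow> unif_bdd (Suc 1) (\<lambda>\<epsilon> x. g \<epsilon> x \<bullet> c)" for m c
    using \<rho> u2_bdd g2_bdd by (auto simp: numeral_2_eq_2)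
  have \<tau>: "unif_bdd 1 (\<lambda>\<epsilon>. \<tau> \<epsilon> m b)" if "b \<in> Basis" for m b
    unfolding \<tau>_def[abs_def]
    by (intro unif_bdd_diff unif_bdd_sum unif_bdd_mult unif_bdd_dirder s2 that)
  have \<tau>1: "unif_bdd (Suc 0) (\<lambda>\<epsilon>. \<tau> \<epsilon> m b)" if "b \<in> Basis" for m b
    using \<tau>[OF that] by simp
  have \<sigma>: "unif_bdd 0 (\<lambda>\<epsilon>. \<sigma> \<epsilon> m b b')" if "b \<in> Basis" "b' \<in> Basis" for m b b'
    unfolding \<sigma>_def[abs_def]
    using g1_bdd that unif_bdd_dirder[OF s2(2) that(1), unfolded One_nat_def]
    by (intro unif_bdd_diff unif_bdd_sum unif_bdd_mult
        unif_bdd_dirder[OF \<tau>1] unif_bdd_dirder[of 0 "\<lambda>\<epsilon>. dirder b (u \<epsilon> m)"]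
        unif_bdd_dirder[of 0 "\<lambda>\<epsilon> x. g \<epsilon> x \<bullet> _"]) auto
  have \<rho>d: "\<forall>\<^sub>F \<epsilon> in at_right 0. \<forall>x. \<rho> \<epsilon> m differentiable (at x)" for m
  proof -
    have "\<forall>\<^sub>F \<epsilon> in at_right 0. class_C 2 (\<rho> \<epsilon> m)"
      using \<rho>[of m] unfolding unif_bdd_def by (auto elim: eventually_mono)
    then show ?thesis by eventually_elim (auto intro: class_C_differentiable)
  qed
  have \<tau>d: "\<forall>\<^sub>F \<epsilon> in at_right 0. \<forall>x. \<tau> \<epsilon> m b differentiable (at x)" if "b \<in> Basis" for m b
  proof -
    have "\<forall>\<^sub>F \<epsilon> in at_right 0. class_C 1 (\<tau> \<epsilon> m b)"
      using \<tau>[OF that, of m] unfolding unif_bdd_def by (auto elim: eventually_mono)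
    then show ?thesis by eventually_elim (auto intro: class_C_differentiable)
  qed
  have r0d: "r0 m differentiable (at x)" "dirder b (r0 m) differentiable (at x)" for m b x
    using torus_C_differentiable[OF r0_C] torus_C_differentiable[OF torus_C_dirder[of 1 "r0 m" b]] r0_C[of m]
    by (auto simp: numeral_2_eq_2)
  have R1: "\<forall>\<^sub>F \<epsilon> in at_right 0. \<forall>x. R1 \<epsilon> m b x = dirder b (r0 m) x + \<epsilon> * \<tau> \<epsilon> m b x" for m b
    using r \<rho>d[of m]
  proof eventually_elim
    case (elim \<epsilon>)
    have "r \<epsilon> m = (\<lambda>x. r0 m x + \<epsilon> * \<rho> \<epsilon> m x)" using elim by auto
    then have "dirder b (r \<epsilon> m) x = dirder b (r0 m) x + \<epsilon> * dirder b (\<rho> \<epsilon> m) x" for x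
      using elim r0d by (simp add: dirder_add dirder_cmult)
    then show ?case by (simp add: R1_def \<tau>_def algebra_simps)
  qed
  have R2: "\<forall>\<^sub>F \<epsilon> in at_right 0. \<forall>x. R2 \<epsilon> m b b' x = dirder b' (dirder b (r0 m)) x + \<epsilon> * \<sigma> \<epsilon> m b b' x"
    if "b \<in> Basis" for m b b'
    using R1[of m b] \<tau>d[OF that, of m]
  proof eventually_elim
    case (elim \<epsilon>)
    have "R1 \<epsilon> m b = (\<lambda>x. dirder b (r0 m) x + \<epsilon> * \<tau> \<epsilon> m b x)" using elim by auto
    then have "dirder b' (R1 \<epsilon> m b) x = dirder b' (dirder b (r0 m)) x + \<epsilon> * dirder b' (\<tau> \<epsilon> m b) x" for x
      using elim r0d by (simp add: dirder_add dirder_cmult)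
    then show ?case by (simp add: R2_def \<sigma>_def algebra_simps)
  qed
  have c0: "\<forall>\<^sub>F \<epsilon> in at_right 0. \<forall>x. \<bar>u \<epsilon> m x - r0 m x\<bar> \<le> \<eta>" for m
  proof (rule transport_converges[OF _ torus_C_mono[OF r0_C] _ unif_bdd_lower[OF \<rho>] gG \<eta>])
    show "\<forall>\<^sub>F \<epsilon> in at_right 0. torus_C 1 (u \<epsilon> m) \<and> transport \<epsilon> (g \<epsilon>) (u \<epsilon> m) (r \<epsilon> m)"
      using u3 transport_u by eventually_elim (use torus_C_mono[of 3 _ 1] in auto)
    show "\<forall>\<^sub>F \<epsilon> in at_right 0. \<forall>x. r \<epsilon> m x = r0 m x + \<epsilon> * \<rho> \<epsilon> m x"
      using r by eventually_elim auto
  qed auto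
  have c1: "\<forall>\<^sub>F \<epsilon> in at_right 0. \<forall>x. \<bar>dirder b (u \<epsilon> m) x - dirder b (r0 m) x\<bar> \<le> \<eta>"
    if "b \<in> Basis" for m b
  proof (rule transport_converges[OF _ _ R1 unif_bdd_lower[OF \<tau>[OF that]] gG \<eta>])
    show "\<forall>\<^sub>F \<epsilon> in at_right 0. torus_C 1 (dirder b (u \<epsilon> m)) \<and> transport \<epsilon> (g \<epsilon>) (dirder b (u \<epsilon> m)) (R1 \<epsilon> m b)"
      using transport_du by eventually_elim (use torus_C_mono[of 2 _ 1] in auto)
    show "torus_C 0 (dirder b (r0 m))"
      by (rule torus_C_dirder, rule torus_C_mono[OF r0_C]) simp
  qed auto
  \<comment> \<open>As \<open>r0\<close> is only known to be of class C^2, the limit at this order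
    is merely continuous, the case for which the doubling of variables was set up.\<close>
  have c2: "\<forall>\<^sub>F \<epsilon> in at_right 0. \<forall>x. \<bar>dirder b' (dirder b (u \<epsilon> m)) x - dirder b' (dirder b (r0 m)) x\<bar> \<le> \<eta>"
    if "b \<in> Basis" "b' \<in> Basis" for m b b'
  proof (rule transport_converges[OF _ _ R2[OF that(1)] \<sigma>[OF that] gG \<eta>])
    show "\<forall>\<^sub>F \<epsilon> in at_right 0. torus_C 1 (dirder b' (dirder b (u \<epsilon> m)))
        \<and> transport \<epsilon> (g \<epsilon>) (dirder b' (dirder b (u \<epsilon> m))) (R2 \<epsilon> m b b')"
      using transport_ddu by eventually_elim auto
    show "torus_C 0 (dirder b' (dirder b (r0 m)))"
      by (rule torus_C_dirder, rule torus_C_dirder) (use r0_C[of m] in \<open>simp add: numeral_2_eq_2\<close>)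
  qed
  have "\<forall>\<^sub>F \<epsilon> in at_right 0. \<forall>m x. \<bar>u \<epsilon> m x - r0 m x\<bar> \<le> \<eta>"
    using c0 by (intro eventually_all_finite)
  moreover have "\<forall>\<^sub>F \<epsilon> in at_right 0. \<forall>m. \<forall>b\<in>Basis. \<forall>x. \<bar>dirder b (u \<epsilon> m) x - dirder b (r0 m) x\<bar> \<le> \<eta>"
    using c1 by (intro eventually_all_finite eventually_ball_finite) auto
  moreover have "\<forall>\<^sub>F \<epsilon> in at_right 0. \<forall>m. \<forall>b\<in>Basis. \<forall>b'\<in>Basis. \<forall>x.
      \<bar>dirder b' (dirder b (u \<epsilon> m)) x - dirder b' (dirder b (r0 m)) x\<bar> \<le> \<eta>"
    by (intro eventually_all_finite eventually_ball_finite finite_Basis ballI c2)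
  ultimately show ?thesis using u3 transport_du
  proof eventually_elim
    case (elim \<epsilon>)
    have "dirder b (\<lambda>x. u \<epsilon> m x - r0 m x) = (\<lambda>x. dirder b (u \<epsilon> m) x - dirder b (r0 m) x)" for b m
      using elim(4) r0d by (simp add: fun_eq_iff torus_C_differentiable[of 3] dirder_diff)
    moreover have "dirder b' (\<lambda>x. dirder b (u \<epsilon> m) x - dirder b (r0 m) x)
        = (\<lambda>x. dirder b' (dirder b (u \<epsilon> m)) x - dirder b' (dirder b (r0 m)) x)" for b b' m
      using elim(5) r0d by (simp add: fun_eq_iff dirder_diff torus_C_differentiable[of 2])
    ultimately show ?case using elim(1-3) by (simp add: C_bdd_2)
  qed
qed

end

section \<open>Phase coordinates and invariant graphs\<close>

lemma torus_periodic_real_diff: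
  fixes f :: "real \<Rightarrow> 'b"
  assumes "torus_periodic f"
  shows "f (x + 2 * pi) = f x" "f (x - 2 * pi) = f x"
proof -
  show p: "f (x + 2 * pi) = f x" for x using assms by (simp add: torus_periodic_def)
  show "f (x - 2 * pi) = f x" using p[of "x - 2 * pi"] by simp
qed

lemma torus_periodic_real_pair:
  fixes f :: "real \<times> real \<Rightarrow> 'b"
  assumes "torus_periodic f"
  shows "f (x + 2 * pi, y) = f (x, y)" "f (x, y + 2 * pi) = f (x, y)"
proof -
  have "f ((x, y) + (2 * pi) *\<^sub>R b) = f (x, y)" if "b \<in> Basis" for b
    using assms that unfolding torus_periodic_def by blast
  from this[of "(1, 0)"] this[of "(0, 1)"]
  show "f (x + 2 * pi, y) = f (x, y)" "f (x, y + 2 * pi) = f (x, y)"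
    by (simp_all add: Basis_prod_def)
qed

lemma Basis_vec_eq_axis: "b \<in> (Basis :: (real^'n) set) \<Longrightarrow> \<exists>k. b = axis k 1"
  by (auto simp: Basis_vec_def)

lemma torus_C_phase_difference:
  fixes \<Gamma> :: "real \<Rightarrow> real" and i j :: "'n::finite"
  assumes "torus_C k \<Gamma>"
  shows "torus_C k (\<lambda>\<theta>::real^'n. \<Gamma> (\<theta> $ j - \<theta> $ i))"
  unfolding torus_C_def
proof
  show "class_C k (\<lambda>\<theta>::real^'n. \<Gamma> (\<theta> $ j - \<theta> $ i))"
    using assms unfolding torus_C_def
    by (intro class_C_comp_linear[of "\<lambda>\<theta>::real^'n. \<theta> $ j - \<theta> $ i" k \<Gamma>] bounded_linear_sub
        bounded_linear_vec_nth) auto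
  show "torus_periodic (\<lambda>\<theta>::real^'n. \<Gamma> (\<theta> $ j - \<theta> $ i))"
    unfolding torus_periodic_def
  proof (intro allI ballI)
    fix \<theta> b :: "real^'n" assume "b \<in> Basis"
    then obtain l where b: "b = axis l 1" using Basis_vec_eq_axis by blast
    have p: "torus_periodic \<Gamma>" using assms by (simp add: torus_C_def)
    show "\<Gamma> ((\<theta> + (2 * pi) *\<^sub>R b) $ j - (\<theta> + (2 * pi) *\<^sub>R b) $ i) = \<Gamma> (\<theta> $ j - \<theta> $ i)"
      using torus_periodic_real_diff[OF p, of "\<theta> $ j - \<theta> $ i"]
      by (auto simp: b axis_def algebra_simps)
  qed
qed

lemma torus_C_phase_pair:
  fixes H :: "real \<times> real \<Rightarrow> real" and i j :: "'n::finite"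
  assumes "torus_C k H"
  shows "torus_C k (\<lambda>\<theta>::real^'n. H (\<theta> $ i, \<theta> $ j))"
  unfolding torus_C_def
proof
  show "class_C k (\<lambda>\<theta>::real^'n. H (\<theta> $ i, \<theta> $ j))"
    using assms unfolding torus_C_def
    by (intro class_C_comp_linear[of "\<lambda>\<theta>::real^'n. (\<theta> $ i, \<theta> $ j)" k H] bounded_linear_Pair
        bounded_linear_vec_nth) auto
  show "torus_periodic (\<lambda>\<theta>::real^'n. H (\<theta> $ i, \<theta> $ j))"
    unfolding torus_periodic_def
  proof (intro allI ballI)
    fix \<theta> b :: "real^'n" assume "b \<in> Basis"
    then obtain l where b: "b = axis l 1" using Basis_vec_eq_axis by blast
    have p: "torus_periodic H" using assms by (simp add: torus_C_def)
    show "H ((\<theta> + (2 * pi) *\<^sub>R b) $ i, (\<theta> + (2 * pi) *\<^sub>R b) $ j) = H (\<theta> $ i, \<theta> $ j)"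
      by (simp add: b axis_def torus_periodic_real_pair[OF p])
  qed
qed

text \<open>The chain rule through the linear map onto the two phases yields derivatives of
  \<open>H\<close> along \<open>(1, 0)\<close> and \<open>(0, 1)\<close>; these are identified with
  the one-variable derivatives that define \<open>d1\<close> and \<open>d2\<close>.\<close>

lemma dirder_phase_pair:
  fixes H :: "real \<times> real \<Rightarrow> real" and i j :: "'n::finite" and v \<theta> :: "real^'n"
  assumes d: "\<And>z. H differentiable (at z)"
  shows "dirder v (\<lambda>\<theta>. H (\<theta> $ i, \<theta> $ j)) \<theta> = d1 H (\<theta> $ i) (\<theta> $ j) * v $ i + d2 H (\<theta> $ i) (\<theta> $ j) * v $ j"
proof -
  have "bounded_linear (\<lambda>\<theta>::real^'n. (\<theta> $ i, \<theta> $ j))"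
    by (intro bounded_linear_Pair bounded_linear_vec_nth)
  then have "dirder v (\<lambda>\<theta>. H (\<theta> $ i, \<theta> $ j)) \<theta> = dirder (v $ i, v $ j) H (\<theta> $ i, \<theta> $ j)"
    using dirder_comp_linear[of "\<lambda>\<theta>::real^'n. (\<theta> $ i, \<theta> $ j)" H \<theta> v] d by simp
  also have "\<dots> = v $ i * dirder (1, 0) H (\<theta> $ i, \<theta> $ j) + v $ j * dirder (0, 1) H (\<theta> $ i, \<theta> $ j)"
    by (subst dirder_Basis_sum[OF d]) (simp add: Basis_prod_def sum.union_disjoint)
  also have "dirder (1, 0) H (\<theta> $ i, \<theta> $ j) = d1 H (\<theta> $ i) (\<theta> $ j)"
  proof -
    \<comment> \<open>The base point has first coordinate 0, so that the line parameter is the first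
      argument of \<open>H\<close> itself.\<close>
    have "((\<lambda>s. H ((0, \<theta> $ j) + s *\<^sub>R (1, 0))) has_real_derivative
        dirder (1, 0) H ((0, \<theta> $ j) + (\<theta> $ i) *\<^sub>R (1, 0))) (at (\<theta> $ i))"
      by (rule has_real_derivative_line[OF d])
    then show ?thesis by (simp add: d1_def DERIV_imp_deriv)
  qed
  also have "dirder (0, 1) H (\<theta> $ i, \<theta> $ j) = d2 H (\<theta> $ i) (\<theta> $ j)"
  proof -
    have "((\<lambda>s. H ((\<theta> $ i, 0) + s *\<^sub>R (0, 1))) has_real_derivative
        dirder (0, 1) H ((\<theta> $ i, 0) + (\<theta> $ j) *\<^sub>R (0, 1))) (at (\<theta> $ j))"
      by (rule has_real_derivative_line[OF d])
    then show ?thesis by (simp add: d2_def DERIV_imp_deriv)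
  qed
  finally show ?thesis by (simp add: mult.commute)
qed

lemma C_bdd_bounded_linear:
  assumes L: "bounded_linear L" "\<And>y. norm (L y) \<le> norm y" and "class_C k f" "C_bdd k C f"
  shows "C_bdd k C (\<lambda>x. L (f x))"
  using assms(3,4)
proof (induction k arbitrary: f)
  case 0
  then show ?case using L(2) order_trans by (simp, blast)
next
  case (Suc k)
  have "dirder b (\<lambda>x. L (f x)) = (\<lambda>x. L (dirder b f x))" for b
    using Suc.prems(1) by (auto simp: class_C_Suc dirder_bounded_linear[OF L(1)])
  moreover have "norm (L (f x)) \<le> C" for x
    using order_trans[OF L(2) C_bdd_norm[OF Suc.prems(2)]] .
  ultimately show ?case using Suc by (simp add: class_C_Suc)
qed

text \<open>Expansion in matrix units; it carries regularity and bounds from the scalar entries to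
  matrix-valued maps.\<close>

lemma matrix_entry_sum:
  fixes A :: "real^'n^'m"
  shows "A = (\<Sum>i\<in>UNIV. \<Sum>j\<in>UNIV. (A $ i $ j) *\<^sub>R axis i (axis j 1))"
proof -
  have "(\<Sum>l\<in>UNIV. (A $ k $ l) * (axis k (axis l 1) :: real^'n^'m) $ i $ j) = (if i = k then A $ i $ j else 0)"
    for i j k
    by (simp add: axis_def if_distrib[of "\<lambda>x. _ * x"] cong: if_cong)
  then show ?thesis by (simp add: vec_eq_iff)
qed

lemma torus_C_matrix:
  fixes f :: "'a::euclidean_space \<Rightarrow> real^'n^'m"
  assumes "\<And>i j. torus_C k (\<lambda>x. f x $ i $ j)"
  shows "torus_C k f"
proof -
  have "torus_C k (\<lambda>x. \<Sum>i\<in>UNIV. \<Sum>j\<in>UNIV. (f x $ i $ j) *\<^sub>R axis i (axis j 1) :: real^'n^'m)"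
    by (intro torus_C_sum torus_C_bounded_linear[OF bounded_linear_scaleR_left] assms)
  then show ?thesis by (simp flip: matrix_entry_sum)
qed

lemma C_bdd_matrix:
  fixes f :: "'a::euclidean_space \<Rightarrow> real^'n^'m"
  assumes "\<And>i j. class_C k (\<lambda>x. f x $ i $ j)" "\<And>i j. C_bdd k C (\<lambda>x. f x $ i $ j)"
  shows "C_bdd k (real CARD('m) * (real CARD('n) * C)) f"
proof -
  have "C_bdd k C (\<lambda>x. (f x $ i $ j) *\<^sub>R axis i (axis j 1) :: real^'n^'m)" for i j
    by (rule C_bdd_bounded_linear[OF bounded_linear_scaleR_left _ assms]) (simp add: norm_eq_sqrt_inner inner_axis_axis)
  then have "C_bdd k (\<Sum>i\<in>(UNIV::'m set). \<Sum>j\<in>(UNIV::'n set). C)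
      (\<lambda>x. \<Sum>i\<in>UNIV. \<Sum>j\<in>UNIV. (f x $ i $ j) *\<^sub>R axis i (axis j 1) :: real^'n^'m)"
    by (intro C_bdd_sum class_C_sum class_C_bounded_linear[OF bounded_linear_scaleR_left] assms)
  then show ?thesis by (simp flip: matrix_entry_sum)
qed

lemma bounded_linear_entry: "bounded_linear (\<lambda>A::real^'n^'m. A $ i $ j)"
  using bounded_linear_compose[OF bounded_linear_vec_nth[of j] bounded_linear_vec_nth[of i]] by simp

lemma norm_entry_le: "\<bar>(A::real^'n^'m) $ i $ j\<bar> \<le> norm A"
  using order_trans[OF component_le_norm_cart[of "A $ i" j] Finite_Cartesian_Product.norm_nth_le[of A i]] .

text \<open>The flow line through \<open>(x, h x)\<close> stays on the graph, so its second
  component is \<open>h\<close> of the first; differentiating this identity at time 0 gives the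
  claim.\<close>

lemma locally_invariant_graph_dirder:
  fixes h :: "'a::euclidean_space \<Rightarrow> 'b::real_normed_vector"
  assumes inv: "locally_invariant X {(x, y). y = h x}" and d: "h differentiable (at x)"
  shows "dirder (fst (X (x, h x))) h x = snd (X (x, h x))"
proof -
  obtain \<delta> z where \<delta>: "0 < \<delta>" and z0: "z 0 = (x, h x)"
    and z: "\<And>t. t \<in> {-\<delta><..<\<delta>} \<Longrightarrow> (z has_vector_derivative X (z t)) (at t) \<and> z t \<in> {(x, y). y = h x}"
    using inv unfolding locally_invariant_def by (force)
  have z': "(z has_vector_derivative X (x, h x)) (at 0)" using z[of 0] \<delta> z0 by simp
  have 1: "((\<lambda>t. fst (z t)) has_vector_derivative fst (X (x, h x))) (at 0)"
    by (rule bounded_linear.has_vector_derivative[OF bounded_linear_fst z'])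
  have 2: "((\<lambda>t. snd (z t)) has_vector_derivative snd (X (x, h x))) (at 0)"
    by (rule bounded_linear.has_vector_derivative[OF bounded_linear_snd z'])
  have hd: "(h has_derivative frechet_derivative h (at x)) (at (fst (z 0)))"
    using iffD1[OF frechet_derivative_works d] z0 by simp
  have "((h \<circ> (\<lambda>t. fst (z t))) has_derivative
      frechet_derivative h (at x) \<circ> (\<lambda>t. t *\<^sub>R fst (X (x, h x)))) (at 0)"
    by (rule diff_chain_at[OF 1[unfolded has_vector_derivative_def] hd])
  then have "((\<lambda>t. h (fst (z t))) has_vector_derivative dirder (fst (X (x, h x))) h x) (at 0)"
    by (simp add: has_vector_derivative_def o_def dirder_def linear_scale[OF linear_frechet_derivative[OF d]])
  then have "((\<lambda>t. snd (z t)) has_vector_derivative dirder (fst (X (x, h x))) h x) (at 0)"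
  proof (rule has_vector_derivative_transform_within_open)
    show "0 \<in> {-\<delta><..<\<delta>}" using \<delta> by simp
    show "h (fst (z t)) = snd (z t)" if "t \<in> {-\<delta><..<\<delta>}" for t using z[OF that] by auto
  qed simp
  then show ?thesis using 2 vector_derivative_unique_at by blast
qed

section \<open>A priori estimates for the slow manifold\<close>

lemma phase_field_nth:
  "phase_field \<omega> \<Gamma> \<theta> A $ i
    = \<omega> $ i + 1 / real CARD('n) * (\<Sum>j\<in>UNIV. A $ i $ j * \<Gamma> (\<theta> $ j - \<theta> $ i))" for A :: "real^'n^'n"
  by (simp add: phase_field_def)

lemma h0_nth: "h0 H \<theta> $ i $ j = H (\<theta> $ i, \<theta> $ j)"
  by (simp add: h0_def)

text \<open>Each summand is an entry bounded by \<open>B\<close> times a value of \<Gamma> bounded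
  by \<open>C\<close>; changing one factor at a time gives the constant. The factor 2 comes from the
  two phases in \<open>\<theta> $ j - \<theta> $ i\<close>.\<close>

lemma phase_field_Lipschitz:
  fixes h :: "real^'n \<Rightarrow> real^'n^'n"
  assumes C: "\<And>x. \<bar>\<Gamma> x\<bar> \<le> C" and L: "\<And>x y. \<bar>\<Gamma> x - \<Gamma> y\<bar> \<le> L * \<bar>x - y\<bar>"
    and B: "\<And>p i j. \<bar>h p $ i $ j\<bar> \<le> B" and "0 \<le> L"
  shows "norm (phase_field \<omega> \<Gamma> p (h p) - phase_field \<omega> \<Gamma> q (h q))
    \<le> real CARD('n) * (C + 2 * B * L) * (norm (p - q) + norm (h p - h q))"
proof -
  have nn: "0 \<le> C" "0 \<le> B" using C[of 0] B[of 0] abs_ge_zero order_trans by blast+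
  define K where "K = (C + 2 * B * L) * (norm (p - q) + norm (h p - h q))"
  have entry: "\<bar>h p $ i $ j * \<Gamma> (p $ j - p $ i) - h q $ i $ j * \<Gamma> (q $ j - q $ i)\<bar> \<le> K" for i j
  proof -
    have "\<bar>p $ j - q $ j\<bar> \<le> norm (p - q)" "\<bar>p $ i - q $ i\<bar> \<le> norm (p - q)"
      using component_le_norm_cart[of "p - q"] by auto
    then have "\<bar>(p $ j - p $ i) - (q $ j - q $ i)\<bar> \<le> 2 * norm (p - q)" by linarith
    then have "\<bar>\<Gamma> (p $ j - p $ i) - \<Gamma> (q $ j - q $ i)\<bar> \<le> L * (2 * norm (p - q))"
      by (rule order_trans[OF L mult_left_mono]) (rule \<open>0 \<le> L\<close>)
    then have "\<bar>h q $ i $ j * (\<Gamma> (p $ j - p $ i) - \<Gamma> (q $ j - q $ i))\<bar> \<le> B * (L * (2 * norm (p - q)))"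
      unfolding abs_mult using B nn by (intro mult_mono) auto
    moreover have "\<bar>(h p $ i $ j - h q $ i $ j) * \<Gamma> (p $ j - p $ i)\<bar> \<le> norm (h p - h q) * C"
      unfolding abs_mult using norm_entry_le[of "h p - h q" i j] C nn by (intro mult_mono) auto
    moreover have "h p $ i $ j * \<Gamma> (p $ j - p $ i) - h q $ i $ j * \<Gamma> (q $ j - q $ i)
        = (h p $ i $ j - h q $ i $ j) * \<Gamma> (p $ j - p $ i)
          + h q $ i $ j * (\<Gamma> (p $ j - p $ i) - \<Gamma> (q $ j - q $ i))"
      by (simp add: algebra_simps)
    ultimately have "\<bar>h p $ i $ j * \<Gamma> (p $ j - p $ i) - h q $ i $ j * \<Gamma> (q $ j - q $ i)\<bar>
        \<le> norm (h p - h q) * C + B * (L * (2 * norm (p - q)))" by linarith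
    also have "\<dots> \<le> K"
    proof -
      have "0 \<le> C * norm (p - q)" "0 \<le> 2 * B * L * norm (h p - h q)"
        using nn \<open>0 \<le> L\<close> by auto
      then show ?thesis by (simp add: K_def algebra_simps)
    qed
    finally show ?thesis .
  qed
  have "\<bar>(phase_field \<omega> \<Gamma> p (h p) - phase_field \<omega> \<Gamma> q (h q)) $ i\<bar> \<le> K" for i
  proof -
    have "(phase_field \<omega> \<Gamma> p (h p) - phase_field \<omega> \<Gamma> q (h q)) $ i = 1 / real CARD('n) *
        (\<Sum>j\<in>UNIV. h p $ i $ j * \<Gamma> (p $ j - p $ i) - h q $ i $ j * \<Gamma> (q $ j - q $ i))"
      by (simp add: phase_field_nth sum_subtractf diff_divide_distrib)
    moreover have "\<bar>\<Sum>j\<in>UNIV. h p $ i $ j * \<Gamma> (p $ j - p $ i) - h q $ i $ j * \<Gamma> (q $ j - q $ i)\<bar> \<le> real CARD('n) * K"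
      by (rule abs_sum_le_card[OF entry])
    ultimately show ?thesis by (simp only: abs_mult) (simp add: pos_divide_le_eq mult.commute)
  qed
  \<comment> \<open>The average over \<open>j\<close> costs nothing; the factor
    \<open>CARD('n)\<close> arises from bounding the norm by the sum over components.\<close>
  then have "(\<Sum>i\<in>UNIV. \<bar>(phase_field \<omega> \<Gamma> p (h p) - phase_field \<omega> \<Gamma> q (h q)) $ i\<bar>) \<le> real CARD('n) * K"
    by (rule sum_bounded_above)
  then show ?thesis
    using norm_le_l1_cart[of "phase_field \<omega> \<Gamma> p (h p) - phase_field \<omega> \<Gamma> q (h q)"]
    by (simp add: K_def mult.assoc)
qed

lemma slow_manifold_pde:
  assumes "locally_invariant (slow_fast_field \<omega> \<Gamma> H \<epsilon>) {(\<theta>, A). A = h \<theta>}" "h differentiable (at \<theta>)"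
  shows "dirder (phase_field \<omega> \<Gamma> \<theta> (h \<theta>)) h \<theta> = (1 / \<epsilon>) *\<^sub>R (h0 H \<theta> - h \<theta>)"
  using locally_invariant_graph_dirder[OF assms]
  by (simp add: slow_fast_field_def vec_eq_iff h0_def)

text \<open>The definition in pointwise form. The supremum dominates the values because the
  difference of the two graphs is continuous and periodic, hence bounded.\<close>

lemma slow_manifoldD:
  assumes "slow_manifold \<omega> \<Gamma> H h" and H: "torus_C 3 H"
  shows "\<forall>\<^sub>F \<epsilon> in at_right 0. torus_C 3 (h \<epsilon>)
      \<and> (\<forall>\<theta>. dirder (phase_field \<omega> \<Gamma> \<theta> (h \<epsilon> \<theta>)) (h \<epsilon>) \<theta> = (1 / \<epsilon>) *\<^sub>R (h0 H \<theta> - h \<epsilon> \<theta>))"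
    and "\<exists>C\<ge>0. \<forall>\<^sub>F \<epsilon> in at_right 0. \<forall>\<theta>. norm (h \<epsilon> \<theta> - h0 H \<theta>) \<le> C * \<epsilon>"
proof -
  have ev: "\<forall>\<^sub>F \<epsilon> in at_right 0. torus_C 3 (h \<epsilon>) \<and>
      locally_invariant (slow_fast_field \<omega> \<Gamma> H \<epsilon>) {(\<theta>, A). A = h \<epsilon> \<theta>}"
    using assms(1) by (simp add: slow_manifold_def)
  then show "\<forall>\<^sub>F \<epsilon> in at_right 0. torus_C 3 (h \<epsilon>)
      \<and> (\<forall>\<theta>. dirder (phase_field \<omega> \<Gamma> \<theta> (h \<epsilon> \<theta>)) (h \<epsilon>) \<theta> = (1 / \<epsilon>) *\<^sub>R (h0 H \<theta> - h \<epsilon> \<theta>))"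
    by eventually_elim (simp add: slow_manifold_pde torus_C_differentiable[of 3])
  have "(\<lambda>\<epsilon>. SUP \<theta>. norm (h \<epsilon> \<theta> - h0 H \<theta>)) \<in> O[at_right 0](\<lambda>\<epsilon>. \<epsilon>)"
    using assms(1) by (simp add: slow_manifold_def)
  then obtain C where C: "0 < C" "\<forall>\<^sub>F \<epsilon> in at_right 0. norm (SUP \<theta>. norm (h \<epsilon> \<theta> - h0 H \<theta>)) \<le> C * norm \<epsilon>"
    by (rule landau_o.bigE)
  have "torus_C 3 (h0 H)"
    by (rule torus_C_matrix) (simp add: h0_nth torus_C_phase_pair[OF H])
  have "\<forall>\<^sub>F \<epsilon> in at_right 0. \<forall>\<theta>. norm (h \<epsilon> \<theta> - h0 H \<theta>) \<le> C * \<epsilon>"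
    using C(2) ev eventually_at_right_less[of 0]
  proof eventually_elim
    case (elim \<epsilon>)
    have "torus_C 3 (\<lambda>\<theta>. h \<epsilon> \<theta> - h0 H \<theta>)"
      using elim(2) \<open>torus_C 3 (h0 H)\<close> by (blast intro: torus_C_diff)
    then obtain D where "C_bdd 3 D (\<lambda>\<theta>. h \<epsilon> \<theta> - h0 H \<theta>)" using torus_C_bdd by blast
    then have D: "norm (h \<epsilon> \<theta> - h0 H \<theta>) \<le> D" for \<theta> by (rule C_bdd_norm)
    have "norm (h \<epsilon> \<theta> - h0 H \<theta>) \<le> (SUP \<theta>. norm (h \<epsilon> \<theta> - h0 H \<theta>))" for \<theta>
      by (rule cSUP_upper) (auto intro!: bdd_aboveI[of _ D] D)
    moreover have "(SUP \<theta>. norm (h \<epsilon> \<theta> - h0 H \<theta>)) \<le> C * \<epsilon>" using elim(1,3) by simp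
    ultimately show ?case by (meson order_trans)
  qed
  with C(1) show "\<exists>C\<ge>0. \<forall>\<^sub>F \<epsilon> in at_right 0. \<forall>\<theta>. norm (h \<epsilon> \<theta> - h0 H \<theta>) \<le> C * \<epsilon>"
    by (auto intro: less_imp_le)
qed

text \<open>An instance of \<open>invariant_graph_Lipschitz\<close>: the transporting field is the
  phase field on the graph, whose increments are controlled by those of the phases and of
  \<open>h\<close>.\<close>

lemma slow_manifold_gradient_bounded:
  fixes h :: "real \<Rightarrow> real^'n \<Rightarrow> real^'n^'n"
  assumes \<Gamma>: "torus_C 3 \<Gamma>" and H: "torus_C 3 H" and sm: "slow_manifold \<omega> \<Gamma> H h"
  obtains L where "\<forall>\<^sub>F \<epsilon> in at_right 0. \<forall>v x. norm (dirder v (h \<epsilon>) x) \<le> L * norm v"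
proof -
  obtain C0 where C0: "0 \<le> C0" "\<forall>\<^sub>F \<epsilon> in at_right 0. \<forall>\<theta>. norm (h \<epsilon> \<theta> - h0 H \<theta>) \<le> C0 * \<epsilon>"
    using slow_manifoldD(2)[OF sm H] by blast
  have "torus_C 3 (h0 H :: real^'n \<Rightarrow> _)"
    by (rule torus_C_matrix) (simp add: h0_nth torus_C_phase_pair[OF H])
  then have h01: "torus_C 1 (h0 H :: real^'n \<Rightarrow> _)" by (rule torus_C_mono) simp
  then obtain B0 where B0: "C_bdd 1 B0 (h0 H :: real^'n \<Rightarrow> _)" using torus_C_bdd by blast
  have \<Gamma>1: "torus_C 1 \<Gamma>" using \<Gamma> by (rule torus_C_mono) simp
  then obtain C\<Gamma> where C\<Gamma>: "C_bdd 1 C\<Gamma> \<Gamma>" using torus_C_bdd by blast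
  have \<Gamma>b: "\<bar>\<Gamma> x\<bar> \<le> C\<Gamma>" "\<bar>\<Gamma> x - \<Gamma> y\<bar> \<le> C\<Gamma> * \<bar>x - y\<bar>" for x y
    using C_bdd_norm[OF C\<Gamma>, of x] C_bdd_imp_Lipschitz[of \<Gamma> C\<Gamma> x y] C\<Gamma> \<Gamma>1
    by (auto simp: torus_C_def)
  define L0 where "L0 = real DIM(real^'n) * B0"
  have L0: "norm (h0 H p - h0 H q) \<le> L0 * norm (p - q)" for p q :: "real^'n"
    unfolding L0_def using C_bdd_imp_Lipschitz[OF _ B0] h01 by (simp add: torus_C_def)
  have nn: "0 \<le> L0" "0 \<le> B0" "0 \<le> C\<Gamma>"
    using C_bdd_nonneg[OF B0] C_bdd_nonneg[OF C\<Gamma>] by (auto simp: L0_def)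
  \<comment> \<open>\<open>B\<close> bounds the entries of \<open>h \<epsilon>\<close> when
    \<open>\<epsilon> < 1\<close>, and \<open>C\<close> is then the Lipschitz constant of the phase
    field. \<open>L\<close> is at least \<open>2 * L0\<close>, and positive also when
    \<open>L0\<close> vanishes.\<close>
  define B where "B = B0 + C0"
  define C where "C = real CARD('n) * (C\<Gamma> + 2 * B * C\<Gamma>)"
  define L where "L = 2 * L0 + 1"
  have C: "0 \<le> C" using nn C0(1) by (simp add: C_def B_def)
  have half: "0 < (1 / 2 :: real)" by simp
  have "\<forall>\<^sub>F \<epsilon> in at_right 0. \<forall>v x. norm (dirder v (h \<epsilon>) x) \<le> L * norm v"
    using slow_manifoldD(1)[OF sm H] C0(2) eventually_eps_small[OF half, of "C * (1 + L)"]
      eventually_eps_small[OF zero_less_one, of 1]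
  proof eventually_elim
    case (elim \<epsilon>)
    have "\<bar>h \<epsilon> p $ i $ j\<bar> \<le> B" for p i j
    proof -
      have "C0 * \<epsilon> \<le> C0" using elim C0(1) by (intro mult_left_le) auto
      then show ?thesis
        using norm_entry_le[of "h \<epsilon> p" i j] norm_triangle_sub[of "h \<epsilon> p" "h0 H p"] elim(2)
          C_bdd_norm[OF B0, of p] unfolding B_def by (smt (verit))
    qed
    note gL = phase_field_Lipschitz[of \<Gamma> C\<Gamma> C\<Gamma> "h \<epsilon>" B \<omega>, OF \<Gamma>b this nn(3), folded C_def]
    have h1: "torus_C 1 (h \<epsilon>)" by (rule torus_C_mono[of 3]) (use elim in auto)
    have inv: "\<epsilon> *\<^sub>R dirder (phase_field \<omega> \<Gamma> p (h \<epsilon> p)) (h \<epsilon>) p = h0 H p - h \<epsilon> p" for p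
      using elim by simp
    have "norm (h \<epsilon> x - h \<epsilon> y) \<le> L * norm (x - y)" for x y
      by (rule invariant_graph_Lipschitz[where g = "\<lambda>p. phase_field \<omega> \<Gamma> p (h \<epsilon> p)", OF h1 _ inv L0 gL])
        (use elim nn C in \<open>auto simp: L_def mult.assoc\<close>)
    then show ?case
      using Lipschitz_imp_dirder_bound[of "h \<epsilon>" L] torus_C_differentiable[OF h1] by auto
  qed
  then show thesis by (rule that)
qed

section \<open>The first-order expansion\<close>

text \<open>Minus the derivative of \<open>h0\<close> along the limiting phase field is the form in
  which the transport equation delivers \<open>h1\<close>.\<close>

lemma h1_nth:
  fixes H :: "real \<times> real \<Rightarrow> real" and \<theta> \<omega> :: "real^'n"
  assumes "\<And>z. H differentiable (at z)"
  shows "h1 \<omega> \<Gamma> H \<theta> $ i $ j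
    = - dirder (phase_field \<omega> \<Gamma> \<theta> (h0 H \<theta>)) (\<lambda>\<theta>. H (\<theta> $ i, \<theta> $ j)) \<theta>"
  by (simp add: h1_def dirder_phase_pair[OF assms])

text \<open>The phase field in \<open>h1\<close> splits into frequencies, which produce the pair
  terms, and coupling sums, which produce the triple terms with one more factor
  \<open>1 / CARD('n)\<close>.\<close>

lemma sum_h1_eq_pair_triple:
  fixes H :: "real \<times> real \<Rightarrow> real" and \<theta> \<omega> :: "real^'n"
  shows "1 / real CARD('n) * (\<Sum>j\<in>UNIV. h1 \<omega> \<Gamma> H \<theta> $ i $ j * \<Gamma> (\<theta> $ j - \<theta> $ i))
    = 1 / real CARD('n) * (\<Sum>j\<in>UNIV. pair_term \<omega> \<Gamma> H i j \<theta>)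
      + 1 / (real CARD('n))\<^sup>2 * (\<Sum>j\<in>UNIV. \<Sum>k\<in>UNIV. triple_term \<Gamma> H i j k \<theta>)"
proof -
  let ?N = "real CARD('n)"
  have "h1 \<omega> \<Gamma> H \<theta> $ i $ j * \<Gamma> (\<theta> $ j - \<theta> $ i)
      = pair_term \<omega> \<Gamma> H i j \<theta> + 1 / ?N * (\<Sum>k\<in>UNIV. triple_term \<Gamma> H i j k \<theta>)" for j
  proof -
    let ?S = "\<lambda>l. \<Sum>k\<in>UNIV. H (\<theta> $ l, \<theta> $ k) * \<Gamma> (\<theta> $ k - \<theta> $ l)"
    have tr: "(\<Sum>k\<in>UNIV. triple_term \<Gamma> H i j k \<theta>)
        = - \<Gamma> (\<theta> $ j - \<theta> $ i) * d1 H (\<theta> $ i) (\<theta> $ j) * ?S i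
          - \<Gamma> (\<theta> $ j - \<theta> $ i) * d2 H (\<theta> $ i) (\<theta> $ j) * ?S j"
      by (simp add: triple_term_def sum_subtractf sum_negf sum_distrib_left mult.assoc)
    show ?thesis
      by (simp add: tr h1_def phase_field_nth h0_nth pair_term_def algebra_simps add_divide_distrib diff_divide_distrib)
  qed
  then show ?thesis
    by (simp add: sum.distrib sum_distrib_left power2_eq_square algebra_simps sum_divide_distrib)
qed

theorem mainTheorem3:
  fixes \<omega> :: "real^'n" and \<Gamma> :: "real \<Rightarrow> real" and H :: "real \<times> real \<Rightarrow> real"
    and h :: "real \<Rightarrow> real^'n \<Rightarrow> real^'n^'n"
  assumes "torus_C 3 \<Gamma>"
    and "torus_C 3 H"
    and "slow_manifold \<omega> \<Gamma> H h"
  shows "little_o_eps_in_C 2 (\<lambda>\<epsilon> \<theta>. h \<epsilon> \<theta> - (h0 H \<theta> + \<epsilon> *\<^sub>R h1 \<omega> \<Gamma> H \<theta>))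
    \<and> (\<forall>i. little_o_eps_in_C 2 (\<lambda>\<epsilon> \<theta>.
          (\<omega> $ i + 1 / real CARD('n) * (\<Sum>j\<in>UNIV. h \<epsilon> \<theta> $ i $ j * \<Gamma> (\<theta> $ j - \<theta> $ i)))
        - (\<omega> $ i + 1 / real CARD('n) * (\<Sum>j\<in>UNIV. H (\<theta> $ i, \<theta> $ j) * \<Gamma> (\<theta> $ j - \<theta> $ i))
           + \<epsilon> / real CARD('n) * (\<Sum>j\<in>UNIV. pair_term \<omega> \<Gamma> H i j \<theta>)
           + \<epsilon> / (real CARD('n))\<^sup>2 * (\<Sum>j\<in>UNIV. \<Sum>k\<in>UNIV. triple_term \<Gamma> H i j k \<theta>))))"
proof -
  note \<Gamma> = assms(1) and H = assms(2) and sm = assms(3)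
  let ?N = "real CARD('n)"
  define Hp where "Hp i j = (\<lambda>\<theta>::real^'n. H (\<theta> $ i, \<theta> $ j))" for i j
  define \<Gamma>p where "\<Gamma>p i j = (\<lambda>\<theta>::real^'n. \<Gamma> (\<theta> $ j - \<theta> $ i))" for i j
  have Hp3: "torus_C 3 (Hp i j)" for i j unfolding Hp_def by (rule torus_C_phase_pair[OF H])
  have \<Gamma>p3: "torus_C 3 (\<Gamma>p i j)" for i j unfolding \<Gamma>p_def by (rule torus_C_phase_difference[OF \<Gamma>])
  have Hp2: "torus_C 2 (Hp i j)" and \<Gamma>p2: "torus_C 2 (\<Gamma>p i j)" for i j
    by (rule torus_C_mono[OF Hp3], simp, rule torus_C_mono[OF \<Gamma>p3], simp)
  have Hd: "Hp i j differentiable (at x)" for i j x using torus_C_differentiable[OF Hp3] by simp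
  have dH: "H differentiable (at z)" for z using torus_C_differentiable[OF H] by simp
  \<comment> \<open>The scaled deviation, one function for each entry \<open>m = (i, j)\<close>; the
    division by \<epsilon> turns the first-order expansion into plain convergence.\<close>
  define u where "u \<epsilon> m = (\<lambda>\<theta>. (1 / \<epsilon>) * (Hp (fst m) (snd m) \<theta> - h \<epsilon> \<theta> $ fst m $ snd m))"
    for \<epsilon> and m :: "'n \<times> 'n"
  define g where "g \<epsilon> \<theta> = phase_field \<omega> \<Gamma> \<theta> (h \<epsilon> \<theta>)" for \<epsilon> \<theta>
  \<comment> \<open>\<open>G b\<close> is the component along \<open>b\<close> of the phase field on
    the critical manifold, and \<open>Q b m\<close> the coefficient with which entry
    \<open>m\<close> enters it. \<open>G\<close> is an explicit sum, so that its regularity follows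
    term by term.\<close>
  define G where "G b \<theta> = (\<Sum>i\<in>UNIV. (\<omega> $ i + 1 / ?N * (\<Sum>j\<in>UNIV. Hp i j \<theta> * \<Gamma>p i j \<theta>)) * b $ i)"
    for b \<theta> :: "real^'n"
  define Q where "Q b m \<theta> = b $ fst m / ?N * \<Gamma>p (fst m) (snd m) \<theta>" for b \<theta> :: "real^'n" and m
  define a where "a b m = dirder b (Hp (fst m) (snd m))" for b m
  have Gf: "G b \<theta> = phase_field \<omega> \<Gamma> \<theta> (h0 H \<theta>) \<bullet> b" for b \<theta>
    by (simp add: G_def inner_vec_def phase_field_nth h0_nth Hp_def \<Gamma>p_def)
  have G2: "torus_C 2 (G b)" for b
    unfolding G_def[abs_def]
    by (intro torus_C_sum torus_C_mult torus_C_add torus_C_const Hp2 \<Gamma>p2)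
  have Q2: "torus_C 2 (Q b m)" for b m
    unfolding Q_def[abs_def] by (intro torus_C_mult torus_C_const \<Gamma>p2)
  have a2: "torus_C 2 (a b m)" for b m
    unfolding a_def using Hp3 by (intro torus_C_dirder) (simp add: numeral_3_eq_3 numeral_2_eq_2)
  note sol = slow_manifoldD(1)[OF sm H]
  obtain C where C: "0 \<le> C" "\<forall>\<^sub>F \<epsilon> in at_right 0. \<forall>\<theta>. norm (h \<epsilon> \<theta> - h0 H \<theta>) \<le> C * \<epsilon>"
    using slow_manifoldD(2)[OF sm H] by blast
  obtain L where L: "\<forall>\<^sub>F \<epsilon> in at_right 0. \<forall>v x. norm (dirder v (h \<epsilon>) x) \<le> L * norm v"
    using slow_manifold_gradient_bounded[OF \<Gamma> H sm] .
  have u3': "torus_C 3 (u \<epsilon> m)" if "torus_C 3 (h \<epsilon>)" for \<epsilon> m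
    unfolding u_def
    by (intro torus_C_mult torus_C_diff torus_C_const Hp3 torus_C_bounded_linear[OF bounded_linear_entry that])
  have du: "dirder v (u \<epsilon> m) x = (1 / \<epsilon>) * (dirder v (Hp (fst m) (snd m)) x - dirder v (h \<epsilon>) x $ fst m $ snd m)"
    if "torus_C 3 (h \<epsilon>)" for \<epsilon> m v x
  proof -
    have hd: "h \<epsilon> differentiable (at x)" using torus_C_differentiable[OF that] by simp
    have "(\<lambda>\<theta>. h \<epsilon> \<theta> $ fst m $ snd m) differentiable (at x)"
      using torus_C_differentiable[OF torus_C_bounded_linear[OF bounded_linear_entry that]] by simp
    then show ?thesis
      unfolding u_def using Hd dirder_bounded_linear[OF bounded_linear_entry hd]
      by (simp only: dirder_cmult dirder_diff differentiable_diff)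
  qed
  interpret relaxation u g G Q a
  proof
    show u3: "\<forall>\<^sub>F \<epsilon> in at_right 0. \<forall>m. torus_C 3 (u \<epsilon> m)"
      using sol by eventually_elim (blast intro: u3')
    show "\<forall>\<^sub>F \<epsilon> in at_right 0. \<forall>b\<in>Basis. \<forall>x. g \<epsilon> x \<bullet> b = G b x - \<epsilon> * (\<Sum>m\<in>UNIV. Q b m x * u \<epsilon> m x)"
      using eventually_at_right_less[of 0]
    proof eventually_elim
      case (elim \<epsilon>)
      have "g \<epsilon> x \<bullet> b = G b x - \<epsilon> * (\<Sum>m\<in>UNIV. Q b m x * u \<epsilon> m x)" for b x
      proof -
        have "(\<Sum>m\<in>UNIV. Q b m x * u \<epsilon> m x) = (\<Sum>i\<in>UNIV. \<Sum>j\<in>UNIV. Q b (i, j) x * u \<epsilon> (i, j) x)"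
          by (simp add: sum.cartesian_product)
        then have "\<epsilon> * (\<Sum>m\<in>UNIV. Q b m x * u \<epsilon> m x)
            = (\<Sum>i\<in>UNIV. (1 / ?N * (\<Sum>j\<in>UNIV. (Hp i j x - h \<epsilon> x $ i $ j) * \<Gamma>p i j x)) * b $ i)"
          using elim
          by (simp add: sum_distrib_left sum_distrib_right Q_def u_def mult_ac)
        moreover have "g \<epsilon> x \<bullet> b
            = (\<Sum>i\<in>UNIV. (\<omega> $ i + 1 / ?N * (\<Sum>j\<in>UNIV. h \<epsilon> x $ i $ j * \<Gamma>p i j x)) * b $ i)"
          by (simp add: g_def inner_vec_def phase_field_nth \<Gamma>p_def)
        ultimately show ?thesis
          unfolding G_def
          by (simp only: sum_subtractf[symmetric])
            (simp add: left_diff_distrib sum_subtractf diff_divide_distrib algebra_simps)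
      qed
      then show ?case by blast
    qed
    show "\<forall>\<^sub>F \<epsilon> in at_right 0. \<forall>m. transport \<epsilon> (g \<epsilon>) (u \<epsilon> m) (\<lambda>x. \<Sum>b\<in>Basis. (g \<epsilon> x \<bullet> b) * a b m x)"
      using sol eventually_at_right_less[of 0]
    proof eventually_elim
      case (elim \<epsilon>)
      have "u \<epsilon> m x + \<epsilon> * dirder (g \<epsilon> x) (u \<epsilon> m) x = (\<Sum>b\<in>Basis. (g \<epsilon> x \<bullet> b) * a b m x)" for m x
      proof -
        \<comment> \<open>By the invariance equation the derivative of \<open>h \<epsilon>\<close>
          along \<open>g\<close> is \<open>u\<close>, which cancels the zeroth-order term of the
          transport equation.\<close>
        have "dirder (g \<epsilon> x) (h \<epsilon>) x $ fst m $ snd m = u \<epsilon> m x"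
          using elim by (simp add: g_def u_def h0_nth Hp_def)
        moreover have "dirder (g \<epsilon> x) (Hp (fst m) (snd m)) x = (\<Sum>b\<in>Basis. (g \<epsilon> x \<bullet> b) * a b m x)"
          by (subst dirder_Basis_sum[OF Hd]) (simp add: a_def)
        ultimately show ?thesis using elim by (simp add: du)
      qed
      then show ?case by (simp add: transport_def)
    qed
    have bd: "\<forall>\<^sub>F \<epsilon> in at_right 0. class_C 0 (u \<epsilon> m) \<and> C_bdd 0 C (u \<epsilon> m)" for m
      using u3 C(2) eventually_at_right_less[of 0]
    proof eventually_elim
      case (elim \<epsilon>)
      have "\<bar>u \<epsilon> m x\<bar> \<le> C" for x
      proof -
        have "\<bar>Hp (fst m) (snd m) x - h \<epsilon> x $ fst m $ snd m\<bar> \<le> C * \<epsilon>"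
          using norm_entry_le[of "h \<epsilon> x - h0 H x" "fst m" "snd m"] elim(2)[THEN spec, of x]
          by (simp add: h0_nth Hp_def abs_minus_commute)
        then show ?thesis using elim(3) by (simp add: u_def abs_mult field_simps)
      qed
      moreover have "class_C 0 (u \<epsilon> m)"
        by (rule class_C_mono[of 3]) (use elim(1)[THEN spec, of m] in \<open>simp_all add: torus_C_def\<close>)
      ultimately show ?case by simp
    qed
    show "unif_bdd 0 (\<lambda>\<epsilon>. u \<epsilon> m)" for m by (rule unif_bddI[OF bd])
    fix b :: "real^'n" and m :: "'n \<times> 'n" assume b: "b \<in> Basis"
    obtain D where D: "\<And>x. \<bar>a b m x\<bar> \<le> D" using torus_C_bdd[OF a2[of b m]] C_bdd_norm by (metis real_norm_def)
    have "\<forall>\<^sub>F \<epsilon> in at_right 0. class_C 0 (\<lambda>x. \<epsilon> * dirder b (u \<epsilon> m) x) \<and> C_bdd 0 (D + L) (\<lambda>x. \<epsilon> * dirder b (u \<epsilon> m) x)"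
      using sol L eventually_at_right_less[of 0]
    proof eventually_elim
      case (elim \<epsilon>)
      have "\<bar>\<epsilon> * dirder b (u \<epsilon> m) x\<bar> \<le> D + L" for x
      proof -
        \<comment> \<open>The factor \<epsilon> cancels the division in \<open>u\<close>, leaving
          the derivatives of \<open>h0\<close> and \<open>h\<close>, the latter bounded by the
          uniform Lipschitz constant.\<close>
        have "\<epsilon> * dirder b (u \<epsilon> m) x = a b m x - dirder b (h \<epsilon>) x $ fst m $ snd m"
          using elim by (simp add: du a_def)
        moreover have "\<bar>dirder b (h \<epsilon>) x $ fst m $ snd m\<bar> \<le> L"
          using norm_entry_le[of "dirder b (h \<epsilon>) x" "fst m" "snd m"] elim(2)[THEN spec, THEN spec, of b x] b
          by simp
        ultimately show ?thesis using D[of x] by linarith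
      qed
      moreover have "torus_C (Suc 2) (u \<epsilon> m)" using u3' elim by (simp add: numeral_3_eq_3 numeral_2_eq_2)
      then have "class_C 0 (\<lambda>x. \<epsilon> * dirder b (u \<epsilon> m) x)"
        by (intro class_C_cmult class_C_mono[of 2 _ 0] class_C_dirder) (auto simp: torus_C_def)
      ultimately show ?case by simp
    qed
    then show "unif_bdd 0 (\<lambda>\<epsilon> x. \<epsilon> * dirder b (u \<epsilon> m) x)" by (rule unif_bddI)
  qed (use G2 Q2 a2 in auto)
  \<comment> \<open>The error in the convergence of \<open>u\<close> to \<open>r0\<close>. Since the
    entries of \<open>h1\<close> are \<open>- r0\<close>, the remainder of the expansion is exactly
    \<open>- \<epsilon> * z\<close>.\<close>
  define z where "z \<epsilon> i j \<theta> = u \<epsilon> (i, j) \<theta> - r0 (i, j) \<theta>" for \<epsilon> i j \<theta>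
  have r0: "h1 \<omega> \<Gamma> H \<theta> $ i $ j = - r0 (i, j) \<theta>" for i j \<theta>
    unfolding h1_nth[OF dH] r0_def Gf a_def Hp_def[symmetric]
    by (subst dirder_Basis_sum[OF Hd]) (simp add: mult.commute)
  have rem: "(h \<epsilon> \<theta> - (h0 H \<theta> + \<epsilon> *\<^sub>R h1 \<omega> \<Gamma> H \<theta>)) $ i $ j = - \<epsilon> * z \<epsilon> i j \<theta>" if "0 < \<epsilon>" for \<epsilon> \<theta> i j
    using that by (simp add: r0 z_def u_def h0_nth Hp_def right_diff_distrib)
  have z2: "\<forall>\<^sub>F \<epsilon> in at_right 0. \<forall>i j. torus_C 2 (z \<epsilon> i j)"
    using u3
  proof eventually_elim
    case (elim \<epsilon>)
    have "torus_C 2 (u \<epsilon> m)" for m by (rule torus_C_mono[OF elim[THEN spec, of m]]) simp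
    then show ?case unfolding z_def by (blast intro: torus_C_diff r0_C)
  qed
  have zb: "\<forall>\<^sub>F \<epsilon> in at_right 0. \<forall>i j. C_bdd 2 \<eta> (z \<epsilon> i j)" if "0 < \<eta>" for \<eta>
    using relaxation_limit[OF that] unfolding z_def by eventually_elim blast
  have z\<epsilon>: "torus_C 2 (\<lambda>\<theta>. - \<epsilon> * z \<epsilon> i j \<theta>)" "C_bdd 2 \<eta> (z \<epsilon> i j) \<Longrightarrow> C_bdd 2 (\<epsilon> * \<eta>) (\<lambda>\<theta>. - \<epsilon> * z \<epsilon> i j \<theta>)"
    if "\<forall>i j. torus_C 2 (z \<epsilon> i j)" "0 < \<epsilon>" for \<epsilon> \<eta> i j
  proof -
    show "torus_C 2 (\<lambda>\<theta>. - \<epsilon> * z \<epsilon> i j \<theta>)" using that(1) by (intro torus_C_mult torus_C_const) auto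
    assume "C_bdd 2 \<eta> (z \<epsilon> i j)"
    then have "C_bdd 2 (\<bar>- \<epsilon>\<bar> * \<eta>) (\<lambda>\<theta>. - \<epsilon> * z \<epsilon> i j \<theta>)"
      using that(1) by (intro C_bdd_cmult) (auto simp: torus_C_def)
    then show "C_bdd 2 (\<epsilon> * \<eta>) (\<lambda>\<theta>. - \<epsilon> * z \<epsilon> i j \<theta>)" using that(2) by simp
  qed
  show ?thesis
  proof (intro conjI allI)
    show "little_o_eps_in_C 2 (\<lambda>\<epsilon> \<theta>. h \<epsilon> \<theta> - (h0 H \<theta> + \<epsilon> *\<^sub>R h1 \<omega> \<Gamma> H \<theta>))"
    proof (rule little_o_eps_in_CI)
      show "\<forall>\<^sub>F \<epsilon> in at_right 0. torus_C 2 (\<lambda>\<theta>. h \<epsilon> \<theta> - (h0 H \<theta> + \<epsilon> *\<^sub>R h1 \<omega> \<Gamma> H \<theta>))"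
        using z2 eventually_at_right_less[of 0]
        by eventually_elim (rule torus_C_matrix, simp only: rem, rule z\<epsilon>(1))
      fix \<eta> :: real assume \<eta>: "0 < \<eta>"
      \<comment> \<open>Compensates the factor \<open>?N * ?N\<close> from
        \<open>C_bdd_matrix\<close>.\<close>
      have "0 < \<eta> / (?N * ?N)" using \<eta> by simp
      from z2 eventually_at_right_less[of 0] zb[OF this]
      show "\<forall>\<^sub>F \<epsilon> in at_right 0. C_bdd 2 (\<eta> * \<epsilon>) (\<lambda>\<theta>. h \<epsilon> \<theta> - (h0 H \<theta> + \<epsilon> *\<^sub>R h1 \<omega> \<Gamma> H \<theta>))"
      proof eventually_elim
        case (elim \<epsilon>)
        have "C_bdd 2 (?N * (?N * (\<epsilon> * (\<eta> / (?N * ?N))))) (\<lambda>\<theta>. h \<epsilon> \<theta> - (h0 H \<theta> + \<epsilon> *\<^sub>R h1 \<omega> \<Gamma> H \<theta>))"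
          using z\<epsilon>[OF elim(1,2)] elim(3)
          by (intro C_bdd_matrix) (simp_all only: rem[OF elim(2)] torus_C_def)
        then show ?case by (simp add: field_simps)
      qed
    qed
  next
    fix i :: 'n
    let ?R = "\<lambda>\<epsilon> \<theta>. (\<omega> $ i + 1 / ?N * (\<Sum>j\<in>UNIV. h \<epsilon> \<theta> $ i $ j * \<Gamma> (\<theta> $ j - \<theta> $ i)))
        - (\<omega> $ i + 1 / ?N * (\<Sum>j\<in>UNIV. H (\<theta> $ i, \<theta> $ j) * \<Gamma> (\<theta> $ j - \<theta> $ i))
           + \<epsilon> / ?N * (\<Sum>j\<in>UNIV. pair_term \<omega> \<Gamma> H i j \<theta>)
           + \<epsilon> / ?N\<^sup>2 * (\<Sum>j\<in>UNIV. \<Sum>k\<in>UNIV. triple_term \<Gamma> H i j k \<theta>))"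
    \<comment> \<open>The phase equation is affine in the entries of \<open>h\<close>, so its
      remainder is the coupling average of the remainder of \<open>h\<close>; the pair and triple
      terms are the contribution of \<open>h1\<close>.\<close>
    have R: "?R \<epsilon> = (\<lambda>\<theta>. 1 / ?N * (\<Sum>j\<in>UNIV. (- \<epsilon> * z \<epsilon> i j \<theta>) * \<Gamma>p i j \<theta>))" if "0 < \<epsilon>" for \<epsilon>
    proof
      fix \<theta>
      have "?R \<epsilon> \<theta> = 1 / ?N * (\<Sum>j\<in>UNIV. h \<epsilon> \<theta> $ i $ j * \<Gamma> (\<theta> $ j - \<theta> $ i))
          - 1 / ?N * (\<Sum>j\<in>UNIV. H (\<theta> $ i, \<theta> $ j) * \<Gamma> (\<theta> $ j - \<theta> $ i))
          - \<epsilon> * (1 / ?N * (\<Sum>j\<in>UNIV. h1 \<omega> \<Gamma> H \<theta> $ i $ j * \<Gamma> (\<theta> $ j - \<theta> $ i)))"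
        unfolding sum_h1_eq_pair_triple by (simp add: algebra_simps)
      also have "\<dots> = 1 / ?N * (\<Sum>j\<in>UNIV. h \<epsilon> \<theta> $ i $ j * \<Gamma> (\<theta> $ j - \<theta> $ i)
          - H (\<theta> $ i, \<theta> $ j) * \<Gamma> (\<theta> $ j - \<theta> $ i) - \<epsilon> * (h1 \<omega> \<Gamma> H \<theta> $ i $ j * \<Gamma> (\<theta> $ j - \<theta> $ i)))"
        by (simp add: sum_subtractf sum_distrib_left[symmetric] diff_divide_distrib)
      also have "\<dots> = 1 / ?N * (\<Sum>j\<in>UNIV. (- \<epsilon> * z \<epsilon> i j \<theta>) * \<Gamma>p i j \<theta>)"
        unfolding rem[OF that, symmetric] by (simp add: \<Gamma>p_def h0_nth algebra_simps)
      finally show "?R \<epsilon> \<theta> = 1 / ?N * (\<Sum>j\<in>UNIV. (- \<epsilon> * z \<epsilon> i j \<theta>) * \<Gamma>p i j \<theta>)" .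
    qed
    have "\<exists>D. \<forall>j. 0 \<le> D j \<and> C_bdd 2 (D j) (\<Gamma>p i j)"
      using torus_C_bdd[OF \<Gamma>p2] C_bdd_nonneg by (intro choice allI) blast
    then obtain D where D: "\<And>j. 0 \<le> D j" "\<And>j. C_bdd 2 (D j) (\<Gamma>p i j)" by blast
    \<comment> \<open>The 4 is the factor \<open>2\<^sup>2\<close> of \<open>C_bdd_mult\<close> at
      order two.\<close>
    define K where "K = (\<Sum>j\<in>UNIV. 4 * D j)"
    have K: "0 \<le> K" unfolding K_def using D(1) by (intro sum_nonneg) simp
    show "little_o_eps_in_C 2 ?R"
    proof (rule little_o_eps_in_CI)
      show "\<forall>\<^sub>F \<epsilon> in at_right 0. torus_C 2 (?R \<epsilon>)"
        using z2 eventually_at_right_less[of 0]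
      proof eventually_elim
        case (elim \<epsilon>)
        show ?case
          unfolding R[OF elim(2)]
          by (intro torus_C_mult[OF torus_C_const] torus_C_sum torus_C_mult[OF z\<epsilon>(1)[OF elim] \<Gamma>p2])
      qed
      fix \<eta> :: real assume \<eta>: "0 < \<eta>"
      \<comment> \<open>The denominator \<open>K + 1\<close> is positive even if
        \<open>K = 0\<close>, and \<open>K / (K + 1) \<le> 1\<close> gives the bound
        \<open>\<eta> * \<epsilon>\<close>.\<close>
      define \<delta> where "\<delta> = \<eta> * ?N / (K + 1)"
      have \<delta>: "0 < \<delta>" using \<eta> K by (simp add: \<delta>_def)
      show "\<forall>\<^sub>F \<epsilon> in at_right 0. C_bdd 2 (\<eta> * \<epsilon>) (?R \<epsilon>)"
        using z2 eventually_at_right_less[of 0] zb[OF \<delta>]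
      proof eventually_elim
        case (elim \<epsilon>)
        have cl: "class_C 2 (\<lambda>\<theta>. - \<epsilon> * z \<epsilon> i j \<theta>)" "class_C 2 (\<Gamma>p i j)" for j
          using z\<epsilon>(1)[OF elim(1,2)] \<Gamma>p2 by (auto simp: torus_C_def)
        have "C_bdd 2 (\<bar>1 / ?N\<bar> * (\<Sum>j\<in>UNIV. 2\<^sup>2 * (\<epsilon> * \<delta> * D j)))
            (\<lambda>\<theta>. 1 / ?N * (\<Sum>j\<in>UNIV. (- \<epsilon> * z \<epsilon> i j \<theta>) * \<Gamma>p i j \<theta>))"
          using elim(3)
          by (intro C_bdd_cmult C_bdd_sum C_bdd_mult class_C_sum class_C_mult[OF cl] cl D(2) z\<epsilon>(2)[OF elim(1,2)]) auto
        moreover have "\<bar>1 / ?N\<bar> * (\<Sum>j\<in>UNIV. 2\<^sup>2 * (\<epsilon> * \<delta> * D j)) = \<epsilon> * \<delta> * K / ?N"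
          by (simp add: K_def sum_distrib_left sum_divide_distrib mult_ac)
        moreover have "\<epsilon> * \<delta> * K / ?N \<le> \<eta> * \<epsilon>"
        proof -
          have "\<epsilon> * \<delta> * K / ?N = \<eta> * \<epsilon> * (K / (K + 1))" by (simp add: \<delta>_def)
          also have "\<dots> \<le> \<eta> * \<epsilon>" using K \<eta> elim(2) by (intro mult_left_le) auto
          finally show ?thesis .
        qed
        ultimately show ?case unfolding R[OF elim(2)] by (simp only: C_bdd_weaken)
      qed
    qed
  qed
qed

end
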